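(* Let $G$ be a group equipped with a conjugation-invariant norm. (a) For any non-principal ultrafilter $\omega$ on $\mathbb{N}$ and any scaling sequence $\mathbf{s}=(s_n)$ there is a natural (well-defined) homomorphism $$\rho_{\omega,\mathbf{s}}\colon \hat{\mathcal{C}}(G)\to \mathrm{Cone}_\omega(G,\mathbf{s}),\qquad [g]\mapsto \{g(s_n)\}_n ,$$ which is Lipschitz with constant $1$. (b) $\rho_{\omega,\mathbf{s}}$ is injective for every non-principal ultrafilter $\omega$ and every scaling sequence $\mathbf{s}$ if and only if $G$ is independent of scaling.
   Context: Norms. A norm on a group $G$ is a function $\|\cdot\|\colon G\to[0,\infty)$ with $\|g\|=0\iff g=1$, $\|g^{-1}\|=\|g\|$ and $\|gh\|\le\|g\|+\|h\|$; for a pseudonorm one only requires $\|1\|=0$ instead of the first condition. It is conjugation-invariant if $\|hgh^{-1}\|=\|g\|$ for all $g,h$. It induces the bi-invariant (pseudo)metric $d(g,h)=\|g^{-1}h\|$; all metric notions refer to it. A homomorphism $\varphi$ is Lipschitz with constant $C$ iff $\|\varphi(g)\|\le C\|g\|$ for all $g$. The groups $F_{\mathbb{R}}(G)$ and $F(G)$. Let $G$ be a group with a conjugation-invariant norm. $F_{\mathbb{R}}(G)$ is the free product of copies of the additive group $\mathbb{R}$ indexed by the elements $g$ of the set $G$; the element $r$ of the copy indexed by $g$ is written $\overline{g}(r)$. It carries the conjugation-invariant pseudonorm $$\|x\|=\inf\Big\{\sum_{i=1}^n |r_i|\,\|g_i\| : x=\prod_{i=1}^n h_i\,\overline{g_i}(r_i)^{\pm1}h_i^{-1},\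 h_i\in F_{\mathbb{R}}(G)\Big\}.$$ $F(G)\le F_{\mathbb{R}}(G)$ is the subgroup generated by the elements $\overline{g}:=\overline{g}(1)$; it is free on $\{\overline{g}: g\in G\}$. For $t\in\mathbb{R}$, $\psi_t\colon F_{\mathbb{R}}(G)\to F_{\mathbb{R}}(G)$ is the homomorphism with $\psi_t(\overline{g}(r))=\overline{g}(tr)$. $\pi\colon F(G)\to G$ is the homomorphism with $\pi(\overline{g})=g$. Directional asymptotic cone. A scaling set is an unbounded subset $T\subseteq(0,\infty)$; limits over $t\in T$ are taken as $t\to\infty$. A function $f$ from $T$ to a pseudometric space is Cauchy if for every $\epsilon>0$, $d(f(t),f(t'))<\epsilon$ for all sufficiently large $t,t'\in T$. $\mathcal{D}(G,T)$ is the group (pointwise product) of all functions $w\colon T\to F(G)$ such that $t\mapsto\psi_{1/t}(w(t))\in F_{\mathbb{R}}(G)$ is Cauchy, with pseudonorm $\|w\|=\lim_{t\in T}\|\psi_{1/t}(w(t))\|$. $\mathcal{C}(G,T)=\{\pi\circ w: w\in\mathcal{D}(G,T)\}$, a group of functions $T\to G$, with pseudonorm $\|g\|=\inf\{\|w\|: w\in\mathcal{D}(G,T),\ \pi\circ w=g\}$. The directional asymptotic cone $\hat{\mathcal{C}}(G,T)$ is the quotient of $\mathcal{C}(G,T)$ by the normal subgroup of elements of pseudonorm $0$, with the induced conjugation-invariant norm; $[g]$ denotes the class of $g$. Write $\hat{\mathcal{C}}(G)=\hat{\mathcal{C}}(G,(0,\infty))$. Independence of scaling. For scaling sets $T\subseteq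 T'$ there is a well-defined homomorphism $\hat{\mathcal{C}}(G,T')\to\hat{\mathcal{C}}(G,T)$, $[g]\mapsto[g|_T]$. $G$ is independent of scaling if this is an isometry for all scaling sets $T\subseteq T'$. Ultrafilter cone. A scaling sequence is a sequence $\mathbf{s}=(s_n)$ of positive reals with $s_n\to\infty$. For a non-principal ultrafilter $\omega$ on $\mathbb{N}$, $\mathrm{Cone}_\omega(G,\mathbf{s})$ is the group of sequences $(g_n)$ in $G$ with $\limsup_n\|g_n\|/s_n<\infty$ (pointwise product), modulo $(g_n)\sim(h_n)\iff\omega\text{-}\lim_n\|g_n^{-1}h_n\|/s_n=0$, with the norm $\|\{g_n\}\|=\omega\text{-}\lim_n\|g_n\|/s_n$; $\{g_n\}$ denotes the class of $(g_n)$. *)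

theory Defs
  imports Complex_Main "HOL-Library.Extended_Real" "HOL-Algebra.Product_Groups"
begin

section \<open>Groups with a conjugation-invariant norm\<close>

locale conj_invariant_normed_group = group G for G (structure) +
  fixes nm :: "'a \<Rightarrow> real"
  assumes norm_nonneg: "g \<in> carrier G \<Longrightarrow> 0 \<le> nm g"
    and norm_eq_0_iff: "g \<in> carrier G \<Longrightarrow> nm g = 0 \<longleftrightarrow> g = \<one>"
    and norm_inv: "g \<in> carrier G \<Longrightarrow> nm (inv g) = nm g"
    and norm_mult: "g \<in> carrier G \<Longrightarrow> h \<in> carrier G \<Longrightarrow> nm (g \<otimes> h) \<le> nm g + nm h"
    and norm_conj: "g \<in> carrier G \<Longrightarrow> h \<in> carrier G \<Longrightarrow> nm (h \<otimes> g \<otimes> inv h) = nm g"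

definition norm_dist :: "('a, 'b) monoid_scheme \<Rightarrow> ('a \<Rightarrow> real) \<Rightarrow> 'a \<Rightarrow> 'a \<Rightarrow> real"
  where "norm_dist G nm g h = nm (inv\<^bsub>G\<^esub> g \<otimes>\<^bsub>G\<^esub> h)"

definition lipschitz_hom ::
    "('a, 'c) monoid_scheme \<Rightarrow> ('a \<Rightarrow> real) \<Rightarrow> ('b, 'd) monoid_scheme \<Rightarrow> ('b \<Rightarrow> real) \<Rightarrow> real
      \<Rightarrow> ('a \<Rightarrow> 'b) \<Rightarrow> bool"
  where "lipschitz_hom G nm H nm' C f \<longleftrightarrow>
    f \<in> hom G H \<and> (\<forall>g\<in>carrier G. nm' (f g) \<le> C * nm g)"

text \<open>An isometry is a distance-preserving map that is also bijective.\<close>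

definition isometry ::
    "('a, 'c) monoid_scheme \<Rightarrow> ('a \<Rightarrow> real) \<Rightarrow> ('b, 'd) monoid_scheme \<Rightarrow> ('b \<Rightarrow> real)
      \<Rightarrow> ('a \<Rightarrow> 'b) \<Rightarrow> bool"
  where "isometry G nm H nm' f \<longleftrightarrow>
    bij_betw f (carrier G) (carrier H) \<and>
    (\<forall>g\<in>carrier G. \<forall>h\<in>carrier G. norm_dist H nm' (f g) (f h) = norm_dist G nm g h)"


section \<open>The free product of copies of the reals\<close>

text \<open>The free product of copies of the additive group of the reals indexed by \<open>I\<close> is
  constructed as the monoid of words in letters \<open>(i, r)\<close>, standing for the element \<open>r\<close> of the
  copy indexed by \<open>i\<close>, modulo the congruence generated by \<open>(i, r) (i, s) = (i, r + s)\<close> and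
  \<open>(i, 0) = 1\<close>.\<close>

type_synonym 'a word = "('a \<times> real) list"

abbreviation words :: "'a set \<Rightarrow> 'a word set"
  where "words I \<equiv> lists (I \<times> UNIV)"

inductive_set word_rel :: "'a set \<Rightarrow> ('a word \<times> 'a word) set" for I
  where
    refl: "u \<in> words I \<Longrightarrow> (u, u) \<in> word_rel I"
  | sym: "(u, v) \<in> word_rel I \<Longrightarrow> (v, u) \<in> word_rel I"
  | trans: "(u, v) \<in> word_rel I \<Longrightarrow> (v, w) \<in> word_rel I \<Longrightarrow> (u, w) \<in> word_rel I"
  | add: "i \<in> I \<Longrightarrow> u \<in> words I \<Longrightarrow> v \<in> words I \<Longrightarrow>
      (u @ [(i, r), (i, s)] @ v, u @ [(i, r + s)] @ v) \<in> word_rel I"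
  | zero: "i \<in> I \<Longrightarrow> u \<in> words I \<Longrightarrow> v \<in> words I \<Longrightarrow> (u @ [(i, 0)] @ v, u @ v) \<in> word_rel I"

definition real_free_product :: "'a set \<Rightarrow> 'a word set monoid"
  where "real_free_product I =
    \<lparr>carrier = words I // word_rel I,
     monoid.mult = (\<lambda>X Y. \<Union>u\<in>X. \<Union>v\<in>Y. word_rel I `` {u @ v}),
     one = word_rel I `` {[]}\<rparr>"

abbreviation FR :: "('a, 'b) monoid_scheme \<Rightarrow> 'a word set monoid"
  where "FR G \<equiv> real_free_product (carrier G)"

definition letter :: "('a, 'b) monoid_scheme \<Rightarrow> 'a \<Rightarrow> real \<Rightarrow> 'a word set"
  where "letter G g r = word_rel (carrier G) `` {[(g, r)]}"

text \<open>A tuple \<open>(h, g, r, e)\<close> with \<open>e = 1\<close> or \<open>e = -1\<close> encodes the factor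
  \<open>h \<cdot> g(r)\<^sup>e \<cdot> h\<^sup>-\<^sup>1\<close> in the definition of the pseudonorm, and contributes
  \<open>\<bar>r\<bar> * nm g\<close> to the sum.\<close>

fun conj_letter :: "('a, 'b) monoid_scheme \<Rightarrow> 'a word set \<times> 'a \<times> real \<times> int \<Rightarrow> 'a word set"
  where "conj_letter G (h, g, r, e) =
    h \<otimes>\<^bsub>FR G\<^esub> (letter G g r [^]\<^bsub>FR G\<^esub> e) \<otimes>\<^bsub>FR G\<^esub> inv\<^bsub>FR G\<^esub> h"

definition FR_norm :: "('a, 'b) monoid_scheme \<Rightarrow> ('a \<Rightarrow> real) \<Rightarrow> 'a word set \<Rightarrow> real"
  where "FR_norm G nm x =
    Inf {(\<Sum>(h, g, r, e)\<leftarrow>ps. \<bar>r\<bar> * nm g) | ps.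
      ps \<in> lists (carrier (FR G) \<times> carrier G \<times> UNIV \<times> {1, -1}) \<and>
      x = foldr (\<otimes>\<^bsub>FR G\<^esub>) (map (conj_letter G) ps) \<one>\<^bsub>FR G\<^esub>}"

definition FZ :: "('a, 'b) monoid_scheme \<Rightarrow> 'a word set monoid"
  where "FZ G = subgroup_generated (FR G) ((\<lambda>g. letter G g 1) ` carrier G)"

definition scale :: "('a, 'b) monoid_scheme \<Rightarrow> real \<Rightarrow> 'a word set \<Rightarrow> 'a word set"
  where "scale G t x = (\<Union>u\<in>x. word_rel (carrier G) `` {map (\<lambda>(g, r). (g, t * r)) u})"

text \<open>The homomorphism \<open>\<pi>\<close> exists and is unique as an extensional function, see
  \<open>proj_hom\<close> and \<open>proj_unique\<close> below.\<close>

definition proj :: "('a, 'b) monoid_scheme \<Rightarrow> 'a word set \<Rightarrow> 'a"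
  where "proj G = (THE p. p \<in> hom (FZ G) G \<and> p \<in> extensional (carrier (FZ G)) \<and>
    (\<forall>g\<in>carrier G. p (letter G g 1) = g))"


section \<open>The directional asymptotic cone\<close>

text \<open>Functions on a scaling set \<open>T\<close> are represented by functions that are
  \<^const>\<open>undefined\<close> outside \<open>T\<close>.\<close>

definition scaling_set :: "real set \<Rightarrow> bool"
  where "scaling_set T \<longleftrightarrow> T \<subseteq> {0<..} \<and> \<not> bdd_above T"

definition rescaled :: "('a, 'b) monoid_scheme \<Rightarrow> (real \<Rightarrow> 'a word set) \<Rightarrow> real \<Rightarrow> 'a word set"
  where "rescaled G w t = scale G (1 / t) (w t)"

definition Cauchy_on ::
    "('x, 'y) monoid_scheme \<Rightarrow> ('x \<Rightarrow> real) \<Rightarrow> real set \<Rightarrow> (real \<Rightarrow> 'x) \<Rightarrow> bool"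
  where "Cauchy_on H nm T f \<longleftrightarrow>
    (\<forall>\<epsilon>>0. \<exists>t\<^sub>0. \<forall>t\<in>T. \<forall>t'\<in>T. t \<ge> t\<^sub>0 \<longrightarrow> t' \<ge> t\<^sub>0 \<longrightarrow> norm_dist H nm (f t) (f t') < \<epsilon>)"

definition dir_group ::
    "('a, 'b) monoid_scheme \<Rightarrow> ('a \<Rightarrow> real) \<Rightarrow> real set \<Rightarrow> (real \<Rightarrow> 'a word set) monoid"
  where "dir_group G nm T = (product_group T (\<lambda>_. FZ G))
    \<lparr>carrier := {w \<in> T \<rightarrow>\<^sub>E carrier (FZ G). Cauchy_on (FR G) (FR_norm G nm) T (rescaled G w)}\<rparr>"

definition dir_norm ::
    "('a, 'b) monoid_scheme \<Rightarrow> ('a \<Rightarrow> real) \<Rightarrow> real set \<Rightarrow> (real \<Rightarrow> 'a word set) \<Rightarrow> real"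
  where "dir_norm G nm T w =
    Lim (inf at_top (principal T)) (\<lambda>t. FR_norm G nm (rescaled G w t))"

definition proj_on ::
    "('a, 'b) monoid_scheme \<Rightarrow> real set \<Rightarrow> (real \<Rightarrow> 'a word set) \<Rightarrow> real \<Rightarrow> 'a"
  where "proj_on G T w = (\<lambda>t\<in>T. proj G (w t))"

definition precone ::
    "('a, 'b) monoid_scheme \<Rightarrow> ('a \<Rightarrow> real) \<Rightarrow> real set \<Rightarrow> (real \<Rightarrow> 'a) monoid"
  where "precone G nm T = (product_group T (\<lambda>_. G))
    \<lparr>carrier := proj_on G T ` carrier (dir_group G nm T)\<rparr>"

definition precone_norm ::
    "('a, 'b) monoid_scheme \<Rightarrow> ('a \<Rightarrow> real) \<Rightarrow> real set \<Rightarrow> (real \<Rightarrow> 'a) \<Rightarrow> real"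
  where "precone_norm G nm T g =
    Inf {dir_norm G nm T w | w. w \<in> carrier (dir_group G nm T) \<and> proj_on G T w = g}"

definition null_subgroup ::
    "('a, 'b) monoid_scheme \<Rightarrow> ('a \<Rightarrow> real) \<Rightarrow> real set \<Rightarrow> (real \<Rightarrow> 'a) set"
  where "null_subgroup G nm T = {g \<in> carrier (precone G nm T). precone_norm G nm T g = 0}"

definition dir_cone ::
    "('a, 'b) monoid_scheme \<Rightarrow> ('a \<Rightarrow> real) \<Rightarrow> real set \<Rightarrow> (real \<Rightarrow> 'a) set monoid"
  where "dir_cone G nm T = precone G nm T Mod null_subgroup G nm T"

definition dir_class ::
    "('a, 'b) monoid_scheme \<Rightarrow> ('a \<Rightarrow> real) \<Rightarrow> real set \<Rightarrow> (real \<Rightarrow> 'a) \<Rightarrow> (real \<Rightarrow> 'a) set"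
  where "dir_class G nm T g = null_subgroup G nm T #>\<^bsub>precone G nm T\<^esub> g"

text \<open>As in the library's treatment of factor groups, functions induced on classes are
  defined by \<^const>\<open>the_elem\<close>: the common value on all representatives.\<close>

definition dir_cone_norm ::
    "('a, 'b) monoid_scheme \<Rightarrow> ('a \<Rightarrow> real) \<Rightarrow> real set \<Rightarrow> (real \<Rightarrow> 'a) set \<Rightarrow> real"
  where "dir_cone_norm G nm T X = the_elem (precone_norm G nm T ` X)"

definition restriction ::
    "('a, 'b) monoid_scheme \<Rightarrow> ('a \<Rightarrow> real) \<Rightarrow> real set \<Rightarrow> (real \<Rightarrow> 'a) set \<Rightarrow> (real \<Rightarrow> 'a) set"
  where "restriction G nm T X = the_elem ((\<lambda>g. dir_class G nm T (restrict g T)) ` X)"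

definition independent_of_scaling :: "('a, 'b) monoid_scheme \<Rightarrow> ('a \<Rightarrow> real) \<Rightarrow> bool"
  where "independent_of_scaling G nm \<longleftrightarrow>
    (\<forall>T T'. scaling_set T \<longrightarrow> scaling_set T' \<longrightarrow> T \<subseteq> T' \<longrightarrow>
      isometry (dir_cone G nm T') (dir_cone_norm G nm T') (dir_cone G nm T) (dir_cone_norm G nm T)
        (restriction G nm T))"


section \<open>The ultrafilter cone\<close>

definition nonprincipal_ultrafilter :: "nat filter \<Rightarrow> bool"
  where "nonprincipal_ultrafilter \<omega> \<longleftrightarrow>
    \<omega> \<noteq> bot \<and> (\<forall>P. eventually P \<omega> \<or> eventually (\<lambda>n. \<not> P n) \<omega>) \<and> (\<forall>n. \<omega> \<noteq> principal {n})"

definition scaling_sequence :: "(nat \<Rightarrow> real) \<Rightarrow> bool"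
  where "scaling_sequence s \<longleftrightarrow> (\<forall>n. 0 < s n) \<and> filterlim s at_top sequentially"

definition bounded_sequences ::
    "('a, 'b) monoid_scheme \<Rightarrow> ('a \<Rightarrow> real) \<Rightarrow> (nat \<Rightarrow> real) \<Rightarrow> (nat \<Rightarrow> 'a) monoid"
  where "bounded_sequences G nm s = (product_group UNIV (\<lambda>_. G))
    \<lparr>carrier := {g. (\<forall>n. g n \<in> carrier G) \<and> limsup (\<lambda>n. ereal (nm (g n) / s n)) < \<infinity>}\<rparr>"

definition ultra_rel ::
    "('a, 'b) monoid_scheme \<Rightarrow> ('a \<Rightarrow> real) \<Rightarrow> nat filter \<Rightarrow> (nat \<Rightarrow> real) \<Rightarrow> ((nat \<Rightarrow> 'a) \<times> (nat \<Rightarrow> 'a)) set"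
  where "ultra_rel G nm \<omega> s =
    {(g, h). g \<in> carrier (bounded_sequences G nm s) \<and> h \<in> carrier (bounded_sequences G nm s) \<and>
      ((\<lambda>n. nm (inv\<^bsub>G\<^esub> (g n) \<otimes>\<^bsub>G\<^esub> h n) / s n) \<longlongrightarrow> 0) \<omega>}"

definition ultra_class ::
    "('a, 'b) monoid_scheme \<Rightarrow> ('a \<Rightarrow> real) \<Rightarrow> nat filter \<Rightarrow> (nat \<Rightarrow> real) \<Rightarrow> (nat \<Rightarrow> 'a) \<Rightarrow> (nat \<Rightarrow> 'a) set"
  where "ultra_class G nm \<omega> s g = ultra_rel G nm \<omega> s `` {g}"

definition ultra_cone ::
    "('a, 'b) monoid_scheme \<Rightarrow> ('a \<Rightarrow> real) \<Rightarrow> nat filter \<Rightarrow> (nat \<Rightarrow> real) \<Rightarrow> (nat \<Rightarrow> 'a) set monoid"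
  where "ultra_cone G nm \<omega> s =
    \<lparr>carrier = carrier (bounded_sequences G nm s) // ultra_rel G nm \<omega> s,
     monoid.mult = set_mult (bounded_sequences G nm s),
     one = ultra_class G nm \<omega> s \<one>\<^bsub>bounded_sequences G nm s\<^esub>\<rparr>"

definition ultra_cone_norm ::
    "('a \<Rightarrow> real) \<Rightarrow> nat filter \<Rightarrow> (nat \<Rightarrow> real) \<Rightarrow> (nat \<Rightarrow> 'a) set \<Rightarrow> real"
  where "ultra_cone_norm nm \<omega> s X = the_elem ((\<lambda>g. Lim \<omega> (\<lambda>n. nm (g n) / s n)) ` X)"

definition rho ::
    "('a, 'b) monoid_scheme \<Rightarrow> ('a \<Rightarrow> real) \<Rightarrow> nat filter \<Rightarrow> (nat \<Rightarrow> real) \<Rightarrow> (real \<Rightarrow> 'a) set \<Rightarrow> (nat \<Rightarrow> 'a) set"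
  where "rho G nm \<omega> s X = the_elem ((\<lambda>g. ultra_class G nm \<omega> s (\<lambda>n. g (s n))) ` X)"


section \<open>Well-definedness of the free product constructions\<close>

lemma word_rel_words: "(u, v) \<in> word_rel I \<Longrightarrow> u \<in> words I \<and> v \<in> words I"
  by (induction rule: word_rel.induct) auto

lemma equiv_word_rel: "equiv (words I) (word_rel I)"
  by (intro equivI refl_onI symI transI)
    (auto dest: word_rel_words intro: word_rel.refl word_rel.sym word_rel.trans)

lemma word_rel_append_left:
  assumes "(u, v) \<in> word_rel I" "w \<in> words I"
  shows "(w @ u, w @ v) \<in> word_rel I"
  using assms
proof (induction rule: word_rel.induct)
  case (add i u v r s)
  then show ?case using word_rel.add[of i I "w @ u" v r s] by simp
next
  case (zero i u v)
  then show ?case using word_rel.zero[of i I "w @ u" v] by simp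
next
  case (refl u)
  then show ?case using word_rel.refl[of "w @ u" I] by simp
qed (blast intro: word_rel.sym word_rel.trans)+

lemma word_rel_append_right:
  assumes "(u, v) \<in> word_rel I" "w \<in> words I"
  shows "(u @ w, v @ w) \<in> word_rel I"
  using assms
proof (induction rule: word_rel.induct)
  case (add i u v r s)
  then show ?case using word_rel.add[of i I u "v @ w" r s] by simp
next
  case (zero i u v)
  then show ?case using word_rel.zero[of i I u "v @ w"] by simp
next
  case (refl u)
  then show ?case using word_rel.refl[of "u @ w" I] by simp
qed (blast intro: word_rel.sym word_rel.trans)+

lemma word_rel_append:
  "(u, u') \<in> word_rel I \<Longrightarrow> (v, v') \<in> word_rel I \<Longrightarrow> (u @ v, u' @ v') \<in> word_rel I"
  by (meson word_rel.trans word_rel_append_left word_rel_append_right word_rel_words)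

lemma word_rel_class_eq_iff:
  "u \<in> words I \<Longrightarrow> v \<in> words I \<Longrightarrow>
    word_rel I `` {u} = word_rel I `` {v} \<longleftrightarrow> (u, v) \<in> word_rel I"
  using eq_equiv_class_iff[OF equiv_word_rel] by blast

lemma mult_word_class:
  assumes "u \<in> words I" "v \<in> words I"
  shows "word_rel I `` {u} \<otimes>\<^bsub>real_free_product I\<^esub> word_rel I `` {v} = word_rel I `` {u @ v}"
proof -
  have "congruent2 (word_rel I) (word_rel I) (\<lambda>u v. word_rel I `` {u @ v})"
    by (intro congruent2I')
      (simp add: equiv_class_eq[OF equiv_word_rel] word_rel_append)
  then show ?thesis
    unfolding real_free_product_def
    by (simp add: UN_equiv_class2[OF equiv_word_rel equiv_word_rel] assms)
qed

lemma one_real_free_product: "\<one>\<^bsub>real_free_product I\<^esub> = word_rel I `` {[]}"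
  by (simp add: real_free_product_def)

lemma carrier_real_free_productE:
  assumes "x \<in> carrier (real_free_product I)"
  obtains u where "u \<in> words I" "x = word_rel I `` {u}"
  using assms that unfolding real_free_product_def partial_object.simps by (elim quotientE) blast

lemma word_class_in_carrier:
  "u \<in> words I \<Longrightarrow> word_rel I `` {u} \<in> carrier (real_free_product I)"
  by (auto simp: real_free_product_def intro: quotientI)

lemma word_inverse:
  assumes "u \<in> words I"
  shows "(rev (map (\<lambda>(i, r). (i, - r)) u) @ u, []) \<in> word_rel I"
  using assms
proof (induction u rule: list.induct)
  case Nil
  then show ?case by (simp add: word_rel.refl)
next
  case (Cons a u)
  obtain i r where a: "a = (i, r)" by (cases a)
  let ?v = "rev (map (\<lambda>(i, r). (i, - r)) u)"
  have iu: "i \<in> I" "u \<in> words I" using Cons.prems a by auto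
  then have v: "?v \<in> words I" by (auto simp: lists_eq_set)
  have "(?v @ [(i, - r), (i, r)] @ u, ?v @ [(i, - r + r)] @ u) \<in> word_rel I"
    by (rule word_rel.add[OF iu(1) v iu(2)])
  moreover have "(?v @ [(i, - r + r)] @ u, ?v @ u) \<in> word_rel I"
    using word_rel.zero[OF iu(1) v iu(2)] by simp
  moreover have "(?v @ u, []) \<in> word_rel I"
    using Cons.IH iu by simp
  ultimately show ?case
    using a by (auto intro: word_rel.trans)
qed

lemma group_real_free_product: "group (real_free_product I)"
proof (rule groupI)
  fix x y assume "x \<in> carrier (real_free_product I)" "y \<in> carrier (real_free_product I)"
  then show "x \<otimes>\<^bsub>real_free_product I\<^esub> y \<in> carrier (real_free_product I)"
    by (elim carrier_real_free_productE) (auto simp: mult_word_class intro!: word_class_in_carrier)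
next
  show "\<one>\<^bsub>real_free_product I\<^esub> \<in> carrier (real_free_product I)"
    by (auto simp: one_real_free_product intro: word_class_in_carrier)
next
  fix x y z assume "x \<in> carrier (real_free_product I)" "y \<in> carrier (real_free_product I)"
    "z \<in> carrier (real_free_product I)"
  then show "x \<otimes>\<^bsub>real_free_product I\<^esub> y \<otimes>\<^bsub>real_free_product I\<^esub> z
      = x \<otimes>\<^bsub>real_free_product I\<^esub> (y \<otimes>\<^bsub>real_free_product I\<^esub> z)"
    by (elim carrier_real_free_productE) (simp add: mult_word_class)
next
  fix x assume "x \<in> carrier (real_free_product I)"
  then show "\<one>\<^bsub>real_free_product I\<^esub> \<otimes>\<^bsub>real_free_product I\<^esub> x = x"
    by (elim carrier_real_free_productE) (simp add: mult_word_class one_real_free_product)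
next
  fix x assume "x \<in> carrier (real_free_product I)"
  then obtain u where u: "u \<in> words I" "x = word_rel I `` {u}"
    by (rule carrier_real_free_productE)
  let ?v = "rev (map (\<lambda>(i, r). (i, - r)) u)"
  have v: "?v \<in> words I" using u by (auto simp: lists_eq_set)
  have "word_rel I `` {?v} \<otimes>\<^bsub>real_free_product I\<^esub> x = \<one>\<^bsub>real_free_product I\<^esub>"
    using u v word_inverse[OF u(1)]
    by (simp add: mult_word_class one_real_free_product word_rel_class_eq_iff)
  then show "\<exists>y\<in>carrier (real_free_product I).
      y \<otimes>\<^bsub>real_free_product I\<^esub> x = \<one>\<^bsub>real_free_product I\<^esub>"
    using v word_class_in_carrier by blast
qed

lemma letter_in_carrier: "g \<in> carrier G \<Longrightarrow> letter G g r \<in> carrier (FR G)"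
  by (auto simp: letter_def intro: word_class_in_carrier)

lemma letter_add:
  "g \<in> carrier G \<Longrightarrow> letter G g r \<otimes>\<^bsub>FR G\<^esub> letter G g s = letter G g (r + s)"
  using word_rel.add[of g "carrier G" "[]" "[]" r s]
  by (simp add: letter_def mult_word_class word_rel_class_eq_iff)

lemma scale_word_rel:
  assumes "(u, v) \<in> word_rel I"
  shows "(map (\<lambda>(g, r). (g, t * r)) u, map (\<lambda>(g, r). (g, t * r)) v) \<in> word_rel I"
  using assms
proof (induction rule: word_rel.induct)
  case (refl u)
  then have "map (\<lambda>(g, r). (g, t * r)) u \<in> words I" by (auto simp: lists_eq_set)
  then show ?case by (rule word_rel.refl)
next
  case (add i u v r s)
  then show ?case
    using word_rel.add[of i I "map (\<lambda>(g, r). (g, t * r)) u" "map (\<lambda>(g, r). (g, t * r)) v" "t * r" "t * s"]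
    by (fastforce simp: lists_eq_set distrib_left)
next
  case (zero i u v)
  then show ?case
    using word_rel.zero[of i I "map (\<lambda>(g, r). (g, t * r)) u" "map (\<lambda>(g, r). (g, t * r)) v"]
    by (fastforce simp: lists_eq_set)
qed (auto intro: word_rel.sym word_rel.trans)

lemma scale_word_class:
  assumes "u \<in> words (carrier G)"
  shows "scale G t (word_rel (carrier G) `` {u})
    = word_rel (carrier G) `` {map (\<lambda>(g, r). (g, t * r)) u}"
proof -
  have "congruent (word_rel (carrier G))
      (\<lambda>u. word_rel (carrier G) `` {map (\<lambda>(g, r). (g, t * r)) u})"
    by (intro congruentI) (simp add: equiv_class_eq[OF equiv_word_rel] scale_word_rel)
  then show ?thesis
    unfolding scale_def by (simp add: UN_equiv_class[OF equiv_word_rel] assms)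
qed

lemma scale_hom: "scale G t \<in> hom (FR G) (FR G)"
proof (rule homI)
  have *: "map (\<lambda>(g, r). (g, t * r)) u \<in> words (carrier G)" if "u \<in> words (carrier G)" for u
    using that by (auto simp: lists_eq_set)
  fix x assume "x \<in> carrier (FR G)"
  then show "scale G t x \<in> carrier (FR G)"
    by (elim carrier_real_free_productE) (simp add: scale_word_class word_class_in_carrier *)
  fix y assume "y \<in> carrier (FR G)"
  with \<open>x \<in> carrier (FR G)\<close>
  show "scale G t (x \<otimes>\<^bsub>FR G\<^esub> y) = scale G t x \<otimes>\<^bsub>FR G\<^esub> scale G t y"
    by (elim carrier_real_free_productE) (simp add: scale_word_class mult_word_class *)
qed

lemma scale_letter: "g \<in> carrier G \<Longrightarrow> scale G t (letter G g r) = letter G g (t * r)"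
  by (simp add: letter_def scale_word_class)


subsection \<open>Normal forms and the projection to the group\<close>

fun cons_reduced :: "'a \<times> real \<Rightarrow> 'a word \<Rightarrow> 'a word"
  where
    "cons_reduced (g, r) [] = (if r = 0 then [] else [(g, r)])"
  | "cons_reduced (g, r) ((h, s) # w) =
      (if r = 0 then (h, s) # w
       else if g = h then (if r + s = 0 then w else (g, r + s) # w)
       else (g, r) # (h, s) # w)"

fun reduced :: "'a word \<Rightarrow> bool"
  where
    "reduced [] \<longleftrightarrow> True"
  | "reduced [(g, r)] \<longleftrightarrow> r \<noteq> 0"
  | "reduced ((g, r) # (h, s) # w) \<longleftrightarrow> r \<noteq> 0 \<and> g \<noteq> h \<and> reduced ((h, s) # w)"

abbreviation normal_form :: "'a word \<Rightarrow> 'a word"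
  where "normal_form u \<equiv> foldr cons_reduced u []"

lemma reduced_tl: "reduced (a # w) \<Longrightarrow> reduced w"
  by (cases a; cases w) auto

lemma reduced_cons_reduced: "reduced w \<Longrightarrow> reduced (cons_reduced a w)"
  by (induction a w rule: cons_reduced.induct) (auto dest: reduced_tl elim: reduced.elims)

lemma reduced_foldr: "reduced w \<Longrightarrow> reduced (foldr cons_reduced u w)"
  by (induction u) (auto intro: reduced_cons_reduced)

lemma cons_reduced_add:
  assumes "reduced w"
  shows "cons_reduced (g, r) (cons_reduced (g, s) w) = cons_reduced (g, r + s) w"
proof (cases w)
  case Nil
  then show ?thesis by auto
next
  case (Cons a v)
  show ?thesis
  proof (cases v)
    case Nil
    with Cons assms show ?thesis by (cases a) auto
  next
    case (Cons b v')
    with \<open>w = a # v\<close> assms show ?thesis by (cases a; cases b) auto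
  qed
qed

lemma cons_reduced_zero: "cons_reduced (g, 0) w = w"
  by (cases w) auto

lemma normal_form_word_rel: "(u, v) \<in> word_rel I \<Longrightarrow> normal_form u = normal_form v"
  by (induction rule: word_rel.induct)
    (auto simp: cons_reduced_add reduced_foldr cons_reduced_zero)

definition integral_word :: "'a word \<Rightarrow> bool"
  where "integral_word u \<longleftrightarrow> (\<forall>(g, r)\<in>set u. r \<in> \<int>)"

primrec word_value :: "('a, 'b) monoid_scheme \<Rightarrow> 'a word \<Rightarrow> 'a"
  where
    "word_value G [] = \<one>\<^bsub>G\<^esub>"
  | "word_value G (a # u) = (fst a [^]\<^bsub>G\<^esub> \<lfloor>snd a\<rfloor>) \<otimes>\<^bsub>G\<^esub> word_value G u"

context group
begin

lemma word_value_closed: "u \<in> words (carrier G) \<Longrightarrow> word_value G u \<in> carrier G"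
  by (induction u) auto

lemma word_value_append:
  "u \<in> words (carrier G) \<Longrightarrow> v \<in> words (carrier G) \<Longrightarrow>
    word_value G (u @ v) = word_value G u \<otimes> word_value G v"
proof (induction u)
  case Nil
  then show ?case using word_value_closed[of v] by simp
next
  case (Cons a u)
  then have "fst a \<in> carrier G" "u \<in> words (carrier G)" by auto
  with Cons show ?case using word_value_closed[of u] word_value_closed[of v] by (simp add: m_assoc)
qed

lemma word_value_cons_reduced:
  assumes "g \<in> carrier G" "r \<in> \<int>" "w \<in> words (carrier G)" "integral_word w"
  shows "cons_reduced (g, r) w \<in> words (carrier G) \<and> integral_word (cons_reduced (g, r) w) \<and>
    word_value G (cons_reduced (g, r) w) = g [^] \<lfloor>r\<rfloor> \<otimes> word_value G w"
proof (cases w)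
  case Nil
  with assms show ?thesis by (auto simp: integral_word_def)
next
  case (Cons a v)
  obtain h s where a: "a = (h, s)" by (cases a)
  obtain m n where mn: "r = of_int m" "s = of_int n"
    using assms Cons a by (auto simp: integral_word_def elim!: Ints_cases)
  have hv: "h \<in> carrier G" "v \<in> words (carrier G)" "integral_word v"
    using assms Cons a by (auto simp: integral_word_def)
  have eq: "g [^] (m + n) \<otimes> word_value G v = g [^] m \<otimes> (g [^] n \<otimes> word_value G v)"
    using assms hv by (simp add: int_pow_mult word_value_closed m_assoc)
  show ?thesis
  proof (cases "g = h \<and> r \<noteq> 0")
    case True
    have rs: "r + s = of_int (m + n)" using mn by simp
    have "m + n = 0 \<longleftrightarrow> r + s = 0" unfolding rs by (simp only: of_int_eq_0_iff)
    with True eq show ?thesis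
      using Cons a assms hv word_value_closed[of v]
      by (auto simp: integral_word_def rs simp del: of_int_add) (auto simp: mn)
  next
    case False
    then show ?thesis
      using Cons a assms hv word_value_closed[of v] by (auto simp: integral_word_def)
  qed
qed

lemma word_value_normal_form:
  assumes "u \<in> words (carrier G)" "integral_word u"
  shows "normal_form u \<in> words (carrier G) \<and> integral_word (normal_form u) \<and>
    word_value G (normal_form u) = word_value G u"
  using assms
proof (induction u rule: list.induct)
  case Nil
  then show ?case by auto
next
  case (Cons a u)
  have "fst a \<in> carrier G" "snd a \<in> \<int>" "u \<in> words (carrier G)" "integral_word u"
    using Cons.prems by (auto simp: integral_word_def split: prod.splits)
  with Cons.IH show ?case
    using word_value_cons_reduced[of "fst a" "snd a" "normal_form u"] by simp
qed

lemma letter_in_FZ: "g \<in> carrier G \<Longrightarrow> letter G g 1 \<in> carrier (FZ G)"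
  by (auto simp: FZ_def carrier_subgroup_generated letter_in_carrier intro: generate.incl)

lemma FZ_integral_word:
  assumes "x \<in> carrier (FZ G)"
  obtains u where "u \<in> words (carrier G)" "integral_word u" "x = word_rel (carrier G) `` {u}"
proof -
  interpret FR: group "FR G" by (rule group_real_free_product)
  have gen: "generate (FR G) ((\<lambda>g. letter G g 1) ` carrier G) = carrier (FZ G)"
    unfolding FZ_def carrier_subgroup_generated
    by (rule arg_cong[where f = "generate (FR G)"]) (auto simp: letter_in_carrier)
  have "\<exists>u. u \<in> words (carrier G) \<and> integral_word u \<and> x = word_rel (carrier G) `` {u}"
    using assms[folded gen]
  proof (induction rule: generate.induct)
    case one
    then show ?case by (intro exI[of _ "[]"]) (auto simp: integral_word_def one_real_free_product)
  next
    case (incl h)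
    then obtain g where "g \<in> carrier G" "h = letter G g 1" by auto
    then show ?case by (intro exI[of _ "[(g, 1)]"]) (auto simp: integral_word_def letter_def)
  next
    case (inv h)
    then obtain g where g: "g \<in> carrier G" "h = letter G g 1" by auto
    have "letter G g (- 1) \<otimes>\<^bsub>FR G\<^esub> h = letter G g 0"
      using g by (simp add: letter_add)
    also have "\<dots> = \<one>\<^bsub>FR G\<^esub>"
      using word_rel.zero[OF g(1), of "[]" "[]"] g
      by (simp add: letter_def one_real_free_product word_rel_class_eq_iff)
    finally have "inv\<^bsub>FR G\<^esub> h = letter G g (- 1)"
      using g FR.inv_equality letter_in_carrier by metis
    then show ?case using g by (intro exI[of _ "[(g, -1)]"]) (auto simp: integral_word_def letter_def)
  next
    case (eng h1 h2)
    then obtain u v where "u \<in> words (carrier G)" "integral_word u" "h1 = word_rel (carrier G) `` {u}"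
      "v \<in> words (carrier G)" "integral_word v" "h2 = word_rel (carrier G) `` {v}"
      by blast
    then show ?case
      by (intro exI[of _ "u @ v"]) (auto simp: integral_word_def mult_word_class)
  qed
  then show thesis using that by blast
qed

lemma ex_proj:
  "\<exists>p. p \<in> hom (FZ G) G \<and> p \<in> extensional (carrier (FZ G)) \<and>
    (\<forall>g\<in>carrier G. p (letter G g 1) = g)"
proof -
  interpret FR: group "FR G" by (rule group_real_free_product)
  define p where "p = (\<lambda>x\<in>carrier (FZ G). word_value G (normal_form (SOME u. u \<in> x)))"
  have p: "p (word_rel (carrier G) `` {u}) = word_value G u"
    if "u \<in> words (carrier G)" "integral_word u" "word_rel (carrier G) `` {u} \<in> carrier (FZ G)" for u
  proof -
    have "(SOME v. v \<in> word_rel (carrier G) `` {u}) \<in> word_rel (carrier G) `` {u}"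
      using word_rel.refl[OF that(1)] by (intro someI[of "\<lambda>v. v \<in> word_rel (carrier G) `` {u}" u]) simp
    then have "normal_form (SOME v. v \<in> word_rel (carrier G) `` {u}) = normal_form u"
      using normal_form_word_rel by (metis Image_singleton_iff)
    then show ?thesis
      using that word_value_normal_form by (simp add: p_def)
  qed
  have "p \<in> hom (FZ G) G"
  proof (rule homI)
    fix x assume x: "x \<in> carrier (FZ G)"
    then show "p x \<in> carrier G"
      by (elim FZ_integral_word) (use x in \<open>simp add: p word_value_closed\<close>)
    fix y assume y: "y \<in> carrier (FZ G)"
    obtain u where u: "u \<in> words (carrier G)" "integral_word u" "x = word_rel (carrier G) `` {u}"
      using x by (rule FZ_integral_word)
    obtain v where v: "v \<in> words (carrier G)" "integral_word v" "y = word_rel (carrier G) `` {v}"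
      using y by (rule FZ_integral_word)
    have xy: "x \<otimes>\<^bsub>FZ G\<^esub> y = word_rel (carrier G) `` {u @ v}"
      using u v by (simp add: FZ_def mult_word_class)
    have "x \<otimes>\<^bsub>FZ G\<^esub> y \<in> carrier (FZ G)"
      using x y group.subgroup_self[of "FZ G"] subgroup.m_closed FR.group_subgroup_generated
      unfolding FZ_def by metis
    then have "p (x \<otimes>\<^bsub>FZ G\<^esub> y) = word_value G (u @ v)"
      unfolding xy using u v by (intro p) (auto simp: integral_word_def)
    then show "p (x \<otimes>\<^bsub>FZ G\<^esub> y) = p x \<otimes> p y"
      using p[OF u(1,2)] p[OF v(1,2)] x y u v by (simp add: word_value_append)
  qed
  moreover have "p (letter G g 1) = g" if "g \<in> carrier G" for g
    using p[of "[(g, 1)]"] that letter_in_FZ[OF that] by (simp add: letter_def integral_word_def)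
  ultimately show ?thesis by (intro exI[of _ p]) (auto simp: p_def)
qed

lemma proj_unique:
  assumes "p \<in> hom (FZ G) G \<and> p \<in> extensional (carrier (FZ G)) \<and> (\<forall>g\<in>carrier G. p (letter G g 1) = g)"
    and "q \<in> hom (FZ G) G \<and> q \<in> extensional (carrier (FZ G)) \<and> (\<forall>g\<in>carrier G. q (letter G g 1) = g)"
  shows "p = q"
proof (rule extensionalityI)
  interpret FR: group "FR G" by (rule group_real_free_product)
  interpret FZ: group "FZ G" unfolding FZ_def by (rule FR.group_subgroup_generated)
  interpret p: group_hom "FZ G" G p using assms by (unfold_locales) auto
  interpret q: group_hom "FZ G" G q using assms by (unfold_locales) auto
  fix x assume x: "x \<in> carrier (FZ G)"
  have carr: "carrier (FZ G) = generate (FR G) (carrier (FR G) \<inter> (\<lambda>g. letter G g 1) ` carrier G)"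
    by (simp add: FZ_def carrier_subgroup_generated)
  have inv_FZ: "inv\<^bsub>FR G\<^esub> h = inv\<^bsub>FZ G\<^esub> h" if "h \<in> carrier (FZ G)" for h
    using that unfolding FZ_def by simp
  from x[unfolded carr] show "p x = q x"
  proof (induction rule: generate.induct)
    case one
    then show ?case using p.hom_one q.hom_one by (simp add: FZ_def)
  next
    case (incl h)
    then show ?case using assms by auto
  next
    case (inv h)
    then obtain g where g: "g \<in> carrier G" "h = letter G g 1" by auto
    then have h: "h \<in> carrier (FZ G)" and "p h = q h" using assms letter_in_FZ by auto
    then show ?case using p.hom_inv[OF h] q.hom_inv[OF h] inv_FZ[OF h] by simp
  next
    case (eng h1 h2)
    then show ?case
      using p.hom_mult[of h1 h2] q.hom_mult[of h1 h2] unfolding carr[symmetric] by (simp add: FZ_def)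
  qed
qed (use assms in auto)

lemma proj_hom: "proj G \<in> hom (FZ G) G"
  and proj_letter: "g \<in> carrier G \<Longrightarrow> proj G (letter G g 1) = g"
  using theI'[of "\<lambda>p. p \<in> hom (FZ G) G \<and> p \<in> extensional (carrier (FZ G)) \<and>
    (\<forall>g\<in>carrier G. p (letter G g 1) = g)"] ex_proj proj_unique
  unfolding proj_def by blast+

end

end

theory Submission
  imports Defs
begin

text \<open>
  Everything rests on a description of the elements \<open>g\<close> of pseudonorm \<open>0\<close> in \<open>\<C>(G,T)\<close> that does
  not mention free products: they are those with \<open>\<parallel>g(t)\<parallel> / t \<rightarrow> 0\<close> along \<open>T\<close>
  (\<open>precone_norm_eq_0_iff\<close>).

  One direction holds because \<open>\<pi>\<close> is Lipschitz with constant \<open>1\<close> (\<open>norm_proj_le\<close>): for a lift \<open>w\<close>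
  of \<open>g\<close>, the quotient \<open>\<parallel>g(t)\<parallel> / t\<close> is at most \<open>\<parallel>w(t)\<parallel> / t\<close>, whose limit is \<open>\<parallel>w\<parallel>\<close>. The same
  inequality gives the first part of the theorem, since \<open>\<rho>\<close> is induced by sampling at the
  points \<open>s\<^sub>n\<close>. For the converse, a sublinear \<open>g\<close> is the projection of the sublinear function
  that sends \<open>t\<close> to the generator named \<open>g(t)\<close>.

  That \<open>\<pi>\<close> does not increase norms needs an argument, because the pseudonorm of \<open>F\<^sub>\<real>(G)\<close> allows
  real exponents and \<open>\<pi>\<close> is defined on integral words only. An element of norm less than \<open>c\<close> is
  represented by words which become trivial after exponents are changed at total cost at most \<open>c\<close>,
  where changing the exponent of \<open>g\<close> by \<open>r\<close> costs \<open>\<bar>r\<bar> \<parallel>g\<parallel>\<close>. That this does not depend on the word is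
  proved by invariance under the defining relations (\<open>cancels_word_rel\<close>). Now let an integral word
  be given. After the change of exponents it is trivial in the free product, so it is not reduced:
  either two adjacent letters have the same generator, and are merged, or the exponent of a letter
  has become \<open>0\<close>, and the letter is deleted at the cost of the norm of its integral power. By
  induction on the length the value of the word in \<open>G\<close> has norm at most \<open>c\<close>.

  The second tool is extension (\<open>extend_dir_group\<close>). Every element of \<open>\<D>(G,T)\<close> extends to each larger
  scaling set \<open>T'\<close>: at \<open>t'\<close> one takes the value at a much smaller \<open>\<sigma> \<in> T\<close>, rescales by \<open>t'/\<sigma>\<close> and
  rounds the exponents. The extension has the same norm, as both norms are limits and \<open>T\<close> is
  unbounded. So restriction from \<open>T'\<close> to \<open>T\<close> is a metric quotient map, and is an isometry if and
  only if it is injective (\<open>restriction_isometry_iff_inj\<close>).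

  In the second part of the theorem both sides now say that sublinearity of \<open>k\<close> on a small set of
  scales forces sublinearity on all scales. For injectivity of \<open>\<rho>\<close> the small set is a sequence \<open>s\<close>
  seen through \<open>\<omega>\<close>, for independence of scaling it is a scaling set. A function that is sublinear
  along \<open>\<omega>\<close> is sublinear along some scaling set (\<open>sublinear_along_scaling_set\<close>); conversely each scaling set contains a scaling sequence, and a
  limit along it is a limit for every ultrafilter. Extension passes from a general \<open>T'\<close> to the
  positive reals.
\<close>

section \<open>Groups with a conjugation-invariant pseudonorm\<close>

text \<open>Four pseudonorms occur: on the free product, on \<open>\<D>(G,T)\<close>, on \<open>\<C>(G,T)\<close> and on the bounded
  sequences. This locale treats their metric and their quotient by the null elements uniformly.\<close>

locale conj_invariant_pseudonormed_group = group G for G (structure) +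
  fixes nm :: "'a \<Rightarrow> real"
  assumes nonneg: "g \<in> carrier G \<Longrightarrow> 0 \<le> nm g"
    and one: "nm \<one> = 0"
    and inverse: "g \<in> carrier G \<Longrightarrow> nm (inv g) = nm g"
    and mult: "g \<in> carrier G \<Longrightarrow> h \<in> carrier G \<Longrightarrow> nm (g \<otimes> h) \<le> nm g + nm h"
    and conj: "g \<in> carrier G \<Longrightarrow> h \<in> carrier G \<Longrightarrow> nm (h \<otimes> g \<otimes> inv h) = nm g"

sublocale conj_invariant_normed_group \<subseteq> conj_invariant_pseudonormed_group
  by unfold_locales (simp_all add: norm_nonneg norm_eq_0_iff norm_inv norm_mult norm_conj)

context conj_invariant_pseudonormed_group
begin

abbreviation dist where "dist \<equiv> norm_dist G nm"

lemma conj': "g \<in> carrier G \<Longrightarrow> h \<in> carrier G \<Longrightarrow> nm (inv h \<otimes> g \<otimes> h) = nm g"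
  using conj[of g "inv h"] by simp

lemma dist_nonneg: "a \<in> carrier G \<Longrightarrow> b \<in> carrier G \<Longrightarrow> 0 \<le> dist a b"
  by (simp add: norm_dist_def nonneg)

lemma dist_self: "a \<in> carrier G \<Longrightarrow> dist a a = 0"
  by (simp add: norm_dist_def one)

lemma dist_commute: "a \<in> carrier G \<Longrightarrow> b \<in> carrier G \<Longrightarrow> dist a b = dist b a"
  using inverse[of "inv a \<otimes> b"] by (simp add: norm_dist_def inv_mult_group)

lemma dist_triangle:
  assumes "a \<in> carrier G" "b \<in> carrier G" "c \<in> carrier G"
  shows "dist a c \<le> dist a b + dist b c"
proof -
  have "(inv a \<otimes> b) \<otimes> (inv b \<otimes> c) = inv a \<otimes> c"
    using assms by (metis inv_closed m_assoc m_closed r_inv l_one)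
  then show ?thesis
    using mult[of "inv a \<otimes> b" "inv b \<otimes> c"] assms by (simp add: norm_dist_def)
qed

lemma norm_le_dist:
  assumes "a \<in> carrier G" "b \<in> carrier G"
  shows "nm b \<le> nm a + dist a b"
  using mult[of a "inv a \<otimes> b"] assms by (simp add: norm_dist_def m_assoc[symmetric])

lemma norm_diff_le_dist:
  assumes "a \<in> carrier G" "b \<in> carrier G"
  shows "\<bar>nm a - nm b\<bar> \<le> dist a b"
  using norm_le_dist[of a b] norm_le_dist[of b a] dist_commute[of a b] assms by linarith

text \<open>Multiplication and inversion are compatible with the metric because it is bi-invariant, which
  is conjugation-invariance of the pseudonorm.\<close>

lemma dist_mult:
  assumes "a \<in> carrier G" "b \<in> carrier G" "c \<in> carrier G" "e \<in> carrier G"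
  shows "dist (a \<otimes> b) (c \<otimes> e) \<le> dist a c + dist b e"
proof -
  have cancel: "b \<otimes> (inv b \<otimes> e) = e"
    using assms by (simp add: m_assoc[symmetric])
  have "inv (a \<otimes> b) \<otimes> (c \<otimes> e) = (inv b \<otimes> (inv a \<otimes> c) \<otimes> b) \<otimes> (inv b \<otimes> e)"
    using assms cancel by (simp add: inv_mult_group m_assoc)
  then show ?thesis
    using mult[of "inv b \<otimes> (inv a \<otimes> c) \<otimes> b" "inv b \<otimes> e"] conj'[of "inv a \<otimes> c" b] assms
    by (simp add: norm_dist_def)
qed

lemma dist_inv:
  assumes "a \<in> carrier G" "b \<in> carrier G"
  shows "dist (inv a) (inv b) = dist a b"
proof -
  have "b \<otimes> (inv b \<otimes> a) \<otimes> inv b = a \<otimes> inv b"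
    using assms by (simp add: m_assoc[symmetric])
  then show ?thesis
    using conj[of "inv b \<otimes> a" b] dist_commute[OF assms] assms by (simp add: norm_dist_def)
qed

lemma norm_nat_pow: "g \<in> carrier G \<Longrightarrow> nm (g [^] (n::nat)) \<le> real n * nm g"
proof (induction n)
  case (Suc n)
  then show ?case using mult[of "g [^] n" g] by (simp add: algebra_simps)
qed (simp add: one)

lemma norm_int_pow:
  assumes "g \<in> carrier G"
  shows "nm (g [^] (k::int)) \<le> \<bar>real_of_int k\<bar> * nm g"
proof (cases "k < 0")
  case True
  have "nm (g [^] k) = nm (g [^] nat (- k))"
    unfolding int_pow_def2[where a = g and z = k] using True assms by (simp only: if_True inverse nat_pow_closed)
  moreover have "real (nat (- k)) = \<bar>real_of_int k\<bar>" using True by simp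
  ultimately show ?thesis using norm_nat_pow[OF assms, of "nat (- k)"] by simp
next
  case False
  have "g [^] k = g [^] nat k"
    unfolding int_pow_def2[where a = g and z = k] using False by (simp only: if_False)
  moreover have "real (nat k) = \<bar>real_of_int k\<bar>" using False by simp
  ultimately show ?thesis using norm_nat_pow[OF assms, of "nat k"] by (simp only:)
qed

subsection \<open>The quotient by the null elements\<close>

abbreviation null where "null \<equiv> {g \<in> carrier G. nm g = 0}"

lemma null_normal: "null \<lhd> G"
proof (rule normal_invI)
  show "subgroup null G"
  proof (rule subgroupI)
    show "null \<noteq> {}" using one by blast
  next
    fix a b assume "a \<in> null" "b \<in> null"
    then show "a \<otimes> b \<in> null" using mult[of a b] nonneg[of "a \<otimes> b"] by auto
  qed (auto simp: inverse)
qed (auto simp: conj)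

lemma subgroup_null: "subgroup null G"
  using null_normal by (rule normal_imp_subgroup)

lemma mem_null_coset_iff:
  assumes "g \<in> carrier G"
  shows "h \<in> null #> g \<longleftrightarrow> h \<in> carrier G \<and> dist g h = 0"
proof
  assume h: "h \<in> null #> g"
  then obtain k where k: "k \<in> carrier G" "nm k = 0" "h = k \<otimes> g" by (auto simp: r_coset_def)
  have "inv g \<otimes> h = inv g \<otimes> k \<otimes> g" using k assms by (simp add: m_assoc)
  then have "dist g h = 0" using conj'[OF k(1) assms] k(2) by (simp add: norm_dist_def)
  then show "h \<in> carrier G \<and> dist g h = 0" using k assms by simp
next
  assume h: "h \<in> carrier G \<and> dist g h = 0"
  have "nm (h \<otimes> inv g) = dist (inv h) (inv g)"
    using h assms by (simp add: norm_dist_def)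
  also have "\<dots> = 0"
    using h assms by (metis dist_inv dist_commute)
  finally have "h \<otimes> inv g \<in> null" using h assms by simp
  moreover have "h = h \<otimes> inv g \<otimes> g" using h assms by (simp add: m_assoc)
  ultimately show "h \<in> null #> g" unfolding r_coset_def by blast
qed

lemma null_coset_eq_iff:
  assumes "g \<in> carrier G" "h \<in> carrier G"
  shows "null #> g = null #> h \<longleftrightarrow> dist g h = 0"
proof
  assume "null #> g = null #> h"
  then show "dist g h = 0"
    using rcos_self[OF assms(2) subgroup_null] mem_null_coset_iff[OF assms(1)] by simp
next
  assume "dist g h = 0"
  then show "null #> g = null #> h"
    using repr_independence[of h null g] mem_null_coset_iff[OF assms(1)] assms subgroup_null by simp
qed

lemma the_elem_null_coset:
  assumes "g \<in> carrier G" "\<And>h. h \<in> carrier G \<Longrightarrow> dist g h = 0 \<Longrightarrow> f h = f g"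
  shows "the_elem (f ` (null #> g)) = f g"
proof -
  have const: "f h = f g" if "h \<in> null #> g" for h
    using that mem_null_coset_iff[OF assms(1)] assms(2) by blast
  have "f ` (null #> g) = {f g}"
    using const rcos_self[OF assms(1) subgroup_null] by blast
  then show ?thesis by simp
qed

lemma norm_null_coset:
  assumes "g \<in> carrier G"
  shows "the_elem (nm ` (null #> g)) = nm g"
proof (rule the_elem_null_coset[OF assms])
  fix h assume "h \<in> carrier G" "dist g h = 0"
  then show "nm h = nm g" using norm_diff_le_dist[of g h] assms by simp
qed

lemma carrier_Mod_null: "carrier (G Mod null) = (\<lambda>g. null #> g) ` carrier G"
  by (auto simp: FactGroup_def RCOSETS_def)

lemma mult_null_cosets:
  "g \<in> carrier G \<Longrightarrow> h \<in> carrier G \<Longrightarrow> (null #> g) <#> (null #> h) = null #> (g \<otimes> h)"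
  by (rule normal.rcos_sum[OF null_normal])

lemma inv_Mod_null: "g \<in> carrier G \<Longrightarrow> inv\<^bsub>G Mod null\<^esub> (null #> g) = null #> inv g"
  using normal.inv_FactGroup[OF null_normal, of "null #> g"] normal.rcos_inv[OF null_normal, of g]
  by (simp add: carrier_Mod_null)

end

lemma (in conj_invariant_pseudonormed_group) pseudonorm_on_subgroup:
  assumes "subgroup H G"
  shows "conj_invariant_pseudonormed_group (G\<lparr>carrier := H\<rparr>) nm"
proof -
  interpret H: group "G\<lparr>carrier := H\<rparr>" using assms by (rule subgroup_imp_group)
  have H: "x \<in> carrier G" if "x \<in> H" for x
    using that subgroup.mem_carrier[OF assms] by blast
  show ?thesis
    by unfold_locales
      (auto simp: nonneg one mult conj inverse H m_inv_consistent[OF assms])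
qed

text \<open>Inverses, conjugates and products of preimages are preimages of the inverses, conjugates and
  products, so the axioms pass to the infimum over the fibres.\<close>

lemma (in conj_invariant_pseudonormed_group) quotient_pseudonorm:
  assumes H: "group H" and f: "f \<in> hom G H" and surj: "f ` carrier G = carrier H"
  shows "conj_invariant_pseudonormed_group H (\<lambda>y. Inf {nm x | x. x \<in> carrier G \<and> f x = y})"
proof -
  interpret H: group H by (rule H)
  interpret f: group_hom G H f using f by unfold_locales
  define q where "q y = Inf {nm x | x. x \<in> carrier G \<and> f x = y}" for y
  have bdd: "bdd_below {nm x | x. x \<in> carrier G \<and> f x = y}" for y
    by (rule bdd_belowI[of _ 0]) (auto simp: nonneg)
  have le: "q (f x) \<le> nm x" if "x \<in> carrier G" for x
    unfolding q_def using that by (intro cInf_lower bdd) auto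
  have ge: "c \<le> q y" if "y \<in> carrier H" "\<And>x. x \<in> carrier G \<Longrightarrow> f x = y \<Longrightarrow> c \<le> nm x" for c y
    unfolding q_def
  proof (rule cInf_greatest)
    have "y \<in> f ` carrier G" using that(1) surj by simp
    then show "{nm x | x. x \<in> carrier G \<and> f x = y} \<noteq> {}" by blast
  qed (use that(2) in blast)
  have q_inv: "q y \<le> q (inv\<^bsub>H\<^esub> y)" if "y \<in> carrier H" for y
  proof (rule ge)
    fix x assume "x \<in> carrier G" "f x = inv\<^bsub>H\<^esub> y"
    then show "q y \<le> nm x" using le[of "inv x"] that by (simp add: inverse)
  qed (use that in simp)
  have q_conj: "q (h \<otimes>\<^bsub>H\<^esub> y \<otimes>\<^bsub>H\<^esub> inv\<^bsub>H\<^esub> h) \<le> q y" if "y \<in> carrier H" "h \<in> carrier H" for y h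
  proof (rule ge)
    fix x assume x: "x \<in> carrier G" "f x = y"
    have "h \<in> f ` carrier G" using that(2) surj by simp
    then obtain k where k: "k \<in> carrier G" "h = f k" by blast
    then show "q (h \<otimes>\<^bsub>H\<^esub> y \<otimes>\<^bsub>H\<^esub> inv\<^bsub>H\<^esub> h) \<le> nm x"
      using le[of "k \<otimes> x \<otimes> inv k"] x by (simp add: conj)
  qed (use that in simp)
  have "conj_invariant_pseudonormed_group H q"
  proof
    fix y assume y: "y \<in> carrier H"
    show "0 \<le> q y" by (rule ge) (auto simp: y nonneg)
    show "q (inv\<^bsub>H\<^esub> y) = q y" using q_inv[of y] q_inv[of "inv\<^bsub>H\<^esub> y"] y by simp
    fix z assume z: "z \<in> carrier H"
    have "q (y \<otimes>\<^bsub>H\<^esub> z) - nm x' \<le> q y" if x': "x' \<in> carrier G" "f x' = z" for x'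
    proof (rule ge[OF y])
      fix x assume "x \<in> carrier G" "f x = y"
      then show "q (y \<otimes>\<^bsub>H\<^esub> z) - nm x' \<le> nm x"
        using le[of "x \<otimes> x'"] mult[of x x'] x' by simp
    qed
    then have "q (y \<otimes>\<^bsub>H\<^esub> z) - q y \<le> q z"
      by (intro ge[OF z]) (auto simp: algebra_simps)
    then show "q (y \<otimes>\<^bsub>H\<^esub> z) \<le> q y + q z" by simp
    have "inv\<^bsub>H\<^esub> z \<otimes>\<^bsub>H\<^esub> (z \<otimes>\<^bsub>H\<^esub> y \<otimes>\<^bsub>H\<^esub> inv\<^bsub>H\<^esub> z) \<otimes>\<^bsub>H\<^esub> inv\<^bsub>H\<^esub> (inv\<^bsub>H\<^esub> z) = y"
      using y z by (simp add: H.m_assoc) (simp add: H.m_assoc[symmetric])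
    then show "q (z \<otimes>\<^bsub>H\<^esub> y \<otimes>\<^bsub>H\<^esub> inv\<^bsub>H\<^esub> z) = q y"
      using q_conj[OF y z] q_conj[of "z \<otimes>\<^bsub>H\<^esub> y \<otimes>\<^bsub>H\<^esub> inv\<^bsub>H\<^esub> z" "inv\<^bsub>H\<^esub> z"] y z by simp
  next
    have "0 \<le> q \<one>\<^bsub>H\<^esub>" by (rule ge) (auto simp: nonneg)
    then show "q \<one>\<^bsub>H\<^esub> = 0" using le[of \<one>] by (simp add: one)
  qed
  then show ?thesis unfolding q_def .
qed

text \<open>The axioms hold in each coordinate and pass to the limit. This covers both the pseudonorm of \<open>\<D>(G,T)\<close> and that of the ultrafilter cone.\<close>

lemma (in conj_invariant_pseudonormed_group) limit_pseudonorm: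
  fixes N :: "('i \<Rightarrow> 'a) \<Rightarrow> real"
  assumes H: "subgroup H (product_group I (\<lambda>_. G))"
    and F: "F \<noteq> bot" "\<forall>\<^sub>F i in F. i \<in> I" and s: "\<And>i. i \<in> I \<Longrightarrow> 0 < s i"
    and N: "\<And>g. g \<in> H \<Longrightarrow> ((\<lambda>i. nm (g i) / s i) \<longlongrightarrow> N g) F"
  shows "conj_invariant_pseudonormed_group ((product_group I (\<lambda>_. G))\<lparr>carrier := H\<rparr>) N"
proof -
  let ?P = "product_group I (\<lambda>_. G)" and ?H = "(product_group I (\<lambda>_. G))\<lparr>carrier := H\<rparr>"
  interpret P: group ?P by simp
  interpret H: group ?H using H by (rule P.subgroup_imp_group)
  have mem: "g i \<in> carrier G" if "g \<in> H" "i \<in> I" for g i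
    using subgroup.mem_carrier[OF H that(1)] that(2) by auto
  have inv: "(inv\<^bsub>?H\<^esub> g) i = inv g i" if "g \<in> H" "i \<in> I" for g i
    using P.m_inv_consistent[OF H that(1)] subgroup.mem_carrier[OF H that(1)] that(2)
    by (simp add: is_group)
  have inv_H: "inv\<^bsub>?H\<^esub> g \<in> H" if "g \<in> H" for g
    using H.inv_closed[of g] that by simp
  have mult_H: "(\<lambda>i\<in>I. g i \<otimes> h i) \<in> H" if "g \<in> H" "h \<in> H" for g h
    using H.m_closed[of g h] that by simp
  have eqI: "N g = N h"
    if "g \<in> H" "h \<in> H" "\<And>i. i \<in> I \<Longrightarrow> nm (g i) = nm (h i)" for g h
  proof (rule tendsto_unique[OF F(1) N[OF that(1)]])
    have "\<forall>\<^sub>F i in F. nm (h i) / s i = nm (g i) / s i"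
      using F(2) by eventually_elim (simp add: that)
    with N[OF that(2)] show "((\<lambda>i. nm (g i) / s i) \<longlongrightarrow> N h) F" by (rule Lim_transform_eventually)
  qed
  show ?thesis
  proof
    fix g assume "g \<in> carrier ?H"
    then have g: "g \<in> H" by simp
    have "\<forall>\<^sub>F i in F. 0 \<le> nm (g i) / s i"
      using F(2) by eventually_elim (use g in \<open>simp add: mem nonneg s less_imp_le\<close>)
    then show "0 \<le> N g" by (rule tendsto_lowerbound[OF N[OF g] _ F(1)])
    show "N (inv\<^bsub>?H\<^esub> g) = N g"
      using g inv_H[of g] by (intro eqI) (auto simp: inv inverse mem)
    fix h assume "h \<in> carrier ?H"
    then have h: "h \<in> H" by simp
    have "\<forall>\<^sub>F i in F. nm ((\<lambda>i\<in>I. g i \<otimes> h i) i) / s i \<le> nm (g i) / s i + nm (h i) / s i"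
      using F(2)
    proof eventually_elim
      case (elim i)
      then show ?case
        using mult[OF mem[OF g elim] mem[OF h elim]] s[OF elim]
        by (simp add: add_divide_distrib[symmetric] divide_right_mono)
    qed
    then show "N (g \<otimes>\<^bsub>?H\<^esub> h) \<le> N g + N h"
      using tendsto_le[OF F(1) tendsto_add[OF N[OF g] N[OF h]] N[OF mult_H[OF g h]]] by simp
    have "h \<otimes>\<^bsub>?H\<^esub> g \<otimes>\<^bsub>?H\<^esub> inv\<^bsub>?H\<^esub> h \<in> H"
      using H.m_closed[of "h \<otimes>\<^bsub>?H\<^esub> g" "inv\<^bsub>?H\<^esub> h"] H.m_closed[of h g] H.inv_closed[of h] g h by simp
    then show "N (h \<otimes>\<^bsub>?H\<^esub> g \<otimes>\<^bsub>?H\<^esub> inv\<^bsub>?H\<^esub> h) = N g"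
      using g h by (intro eqI) (auto simp: inv mem conj)
  next
    have one_H: "(\<lambda>i\<in>I. \<one>) \<in> H" using H.one_closed by simp
    have "\<forall>\<^sub>F i in F. 0 = nm ((\<lambda>i\<in>I. \<one>) i) / s i"
      using F(2) by eventually_elim (simp add: one)
    then have "((\<lambda>i. nm ((\<lambda>i\<in>I. \<one>) i) / s i) \<longlongrightarrow> 0) F"
      by (rule Lim_transform_eventually[OF tendsto_const])
    then show "N \<one>\<^bsub>?H\<^esub> = 0"
      using tendsto_unique[OF F(1) N[OF one_H]] by simp
  qed
qed

section \<open>The pseudonorm on the free product\<close>

text \<open>The costs of the representations of an element as a product of conjugates of letters. As an
  inductive predicate, they allow rule induction instead of reasoning about lists of tuples.\<close>

inductive FR_cost :: "('a, 'b) monoid_scheme \<Rightarrow> ('a \<Rightarrow> real) \<Rightarrow> 'a word set \<Rightarrow> real \<Rightarrow> bool"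
  for G nm where
    one: "FR_cost G nm \<one>\<^bsub>FR G\<^esub> 0"
  | step: "h \<in> carrier (FR G) \<Longrightarrow> g \<in> carrier G \<Longrightarrow> FR_cost G nm x c \<Longrightarrow>
      FR_cost G nm (h \<otimes>\<^bsub>FR G\<^esub> letter G g r \<otimes>\<^bsub>FR G\<^esub> inv\<^bsub>FR G\<^esub> h \<otimes>\<^bsub>FR G\<^esub> x) (\<bar>r\<bar> * nm g + c)"

lemma letter_zero: "g \<in> carrier G \<Longrightarrow> letter G g 0 = \<one>\<^bsub>FR G\<^esub>"
  using word_rel.zero[of g "carrier G" "[]" "[]"]
  by (simp add: letter_def one_real_free_product word_rel_class_eq_iff)

lemma inv_letter:
  assumes "g \<in> carrier G"
  shows "inv\<^bsub>FR G\<^esub> letter G g r = letter G g (- r)"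
proof -
  interpret FR: group "FR G" by (rule group_real_free_product)
  have "letter G g (- r) \<otimes>\<^bsub>FR G\<^esub> letter G g r = \<one>\<^bsub>FR G\<^esub>"
    using assms by (simp add: letter_add letter_zero)
  then show ?thesis using assms by (intro FR.inv_equality letter_in_carrier)
qed

text \<open>Powers of a letter are letters, so the exponents \<open>\<plusminus>1\<close> in the definition of the pseudonorm
  can be absorbed into the real exponents.\<close>

lemma letter_int_pow:
  assumes "g \<in> carrier G"
  shows "letter G g r [^]\<^bsub>FR G\<^esub> (k::int) = letter G g (real_of_int k * r)"
proof -
  interpret FR: group "FR G" by (rule group_real_free_product)
  have nat: "letter G g r [^]\<^bsub>FR G\<^esub> n = letter G g (real n * r)" for n :: nat
    using assms by (induction n) (simp_all add: letter_zero letter_add algebra_simps)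
  show ?thesis
  proof (cases "k < 0")
    case True
    then show ?thesis
      unfolding int_pow_def2[where z = k] using assms by (simp only: if_True nat inv_letter) simp
  next
    case False
    then show ?thesis
      unfolding int_pow_def2[where z = k] by (simp only: if_False nat) simp
  qed
qed

lemma FR_cost_carrier: "FR_cost G nm x c \<Longrightarrow> x \<in> carrier (FR G)"
proof (induction rule: FR_cost.induct)
  interpret FR: group "FR G" by (rule group_real_free_product)
  show "\<one>\<^bsub>FR G\<^esub> \<in> carrier (FR G)" by simp
  show "h \<otimes>\<^bsub>FR G\<^esub> letter G g r \<otimes>\<^bsub>FR G\<^esub> inv\<^bsub>FR G\<^esub> h \<otimes>\<^bsub>FR G\<^esub> x \<in> carrier (FR G)"
    if "h \<in> carrier (FR G)" "g \<in> carrier G" "x \<in> carrier (FR G)" for h g x r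
    using that by (simp add: letter_in_carrier)
qed

lemma FR_cost_representation:
  "FR_cost G nm x c \<longleftrightarrow> (\<exists>ps. c = (\<Sum>(h, g, r, e)\<leftarrow>ps. \<bar>r\<bar> * nm g) \<and>
      ps \<in> lists (carrier (FR G) \<times> carrier G \<times> UNIV \<times> {1, -1}) \<and>
      x = foldr (\<otimes>\<^bsub>FR G\<^esub>) (map (conj_letter G) ps) \<one>\<^bsub>FR G\<^esub>)"
proof
  interpret FR: group "FR G" by (rule group_real_free_product)
  assume "FR_cost G nm x c"
  then show "\<exists>ps. c = (\<Sum>(h, g, r, e)\<leftarrow>ps. \<bar>r\<bar> * nm g) \<and>
      ps \<in> lists (carrier (FR G) \<times> carrier G \<times> UNIV \<times> {1, -1}) \<and>
      x = foldr (\<otimes>\<^bsub>FR G\<^esub>) (map (conj_letter G) ps) \<one>\<^bsub>FR G\<^esub>"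
  proof (induction rule: FR_cost.induct)
    case one
    show ?case by (intro exI[of _ "[]"]) simp
  next
    case (step h g x c r)
    then obtain ps where "c = (\<Sum>(h, g, r, e)\<leftarrow>ps. \<bar>r\<bar> * nm g)"
      "ps \<in> lists (carrier (FR G) \<times> carrier G \<times> UNIV \<times> {1, -1})"
      "x = foldr (\<otimes>\<^bsub>FR G\<^esub>) (map (conj_letter G) ps) \<one>\<^bsub>FR G\<^esub>"
      by blast
    then show ?case
      using step.hyps(1,2)
      by (intro exI[of _ "(h, g, r, 1) # ps"]) (simp add: letter_in_carrier)
  qed
next
  interpret FR: group "FR G" by (rule group_real_free_product)
  assume "\<exists>ps. c = (\<Sum>(h, g, r, e)\<leftarrow>ps. \<bar>r\<bar> * nm g) \<and>
      ps \<in> lists (carrier (FR G) \<times> carrier G \<times> UNIV \<times> {1, -1}) \<and>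
      x = foldr (\<otimes>\<^bsub>FR G\<^esub>) (map (conj_letter G) ps) \<one>\<^bsub>FR G\<^esub>"
  then obtain ps where ps: "c = (\<Sum>(h, g, r, e)\<leftarrow>ps. \<bar>r\<bar> * nm g)"
      "ps \<in> lists (carrier (FR G) \<times> carrier G \<times> UNIV \<times> {1, -1})"
      "x = foldr (\<otimes>\<^bsub>FR G\<^esub>) (map (conj_letter G) ps) \<one>\<^bsub>FR G\<^esub>"
    by blast
  from ps(2) have "FR_cost G nm (foldr (\<otimes>\<^bsub>FR G\<^esub>) (map (conj_letter G) ps) \<one>\<^bsub>FR G\<^esub>)
      (\<Sum>(h, g, r, e)\<leftarrow>ps. \<bar>r\<bar> * nm g)"
  proof (induction ps rule: list.induct)
    case Nil
    show ?case by (simp add: FR_cost.one)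
  next
    case (Cons p ps)
    obtain h g r e where p: "p = (h, g, r, e)" by (cases p)
    with Cons.prems have mem: "h \<in> carrier (FR G)" "g \<in> carrier G" and e: "e = 1 \<or> e = -1"
      and ps: "ps \<in> lists (carrier (FR G) \<times> carrier G \<times> UNIV \<times> {1, -1})"
      by auto
    have "\<bar>real_of_int e * r\<bar> = \<bar>r\<bar>" using e by auto
    then show ?case
      using FR_cost.step[OF mem Cons.IH[OF ps], of "real_of_int e * r"]
      by (simp add: p letter_int_pow[OF mem(2)])
  qed
  then show "FR_cost G nm x c" using ps by simp
qed

lemma FR_norm_eq_Inf_FR_cost: "FR_norm G nm x = Inf {c. FR_cost G nm x c}"
  unfolding FR_norm_def FR_cost_representation by (rule arg_cong[where f = Inf]) auto

lemma FR_cost_mult: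
  assumes "FR_cost G nm x c" "FR_cost G nm y d"
  shows "FR_cost G nm (x \<otimes>\<^bsub>FR G\<^esub> y) (c + d)"
  using assms(1)
proof (induction rule: FR_cost.induct)
  interpret FR: group "FR G" by (rule group_real_free_product)
  have y: "y \<in> carrier (FR G)" using assms(2) by (rule FR_cost_carrier)
  case one
  then show ?case using y assms(2) by simp
next
  interpret FR: group "FR G" by (rule group_real_free_product)
  have y: "y \<in> carrier (FR G)" using assms(2) by (rule FR_cost_carrier)
  case (step h g x c r)
  note mem = step.hyps(1) letter_in_carrier[OF step.hyps(2)] FR_cost_carrier[OF step.hyps(3)] y
  have "h \<otimes>\<^bsub>FR G\<^esub> letter G g r \<otimes>\<^bsub>FR G\<^esub> inv\<^bsub>FR G\<^esub> h \<otimes>\<^bsub>FR G\<^esub> (x \<otimes>\<^bsub>FR G\<^esub> y)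
      = h \<otimes>\<^bsub>FR G\<^esub> letter G g r \<otimes>\<^bsub>FR G\<^esub> inv\<^bsub>FR G\<^esub> h \<otimes>\<^bsub>FR G\<^esub> x \<otimes>\<^bsub>FR G\<^esub> y"
    using mem by (simp add: FR.m_assoc)
  then show ?case using FR_cost.step[OF step.hyps(1,2) step.IH, of r] by (simp add: add.assoc)
qed

lemma FR_cost_conj_letter:
  assumes "h \<in> carrier (FR G)" "g \<in> carrier G"
  shows "FR_cost G nm (h \<otimes>\<^bsub>FR G\<^esub> letter G g r \<otimes>\<^bsub>FR G\<^esub> inv\<^bsub>FR G\<^esub> h) (\<bar>r\<bar> * nm g)"
proof -
  interpret FR: group "FR G" by (rule group_real_free_product)
  show ?thesis using FR_cost.step[OF assms FR_cost.one, of nm r] assms by (simp add: letter_in_carrier)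
qed

lemma FR_cost_letter:
  assumes "g \<in> carrier G"
  shows "FR_cost G nm (letter G g r) (\<bar>r\<bar> * nm g)"
proof -
  interpret FR: group "FR G" by (rule group_real_free_product)
  show ?thesis
    using FR_cost_conj_letter[OF FR.one_closed assms, of nm r] assms by (simp add: letter_in_carrier)
qed

lemma FR_cost_inv: "FR_cost G nm x c \<Longrightarrow> FR_cost G nm (inv\<^bsub>FR G\<^esub> x) c"
proof (induction rule: FR_cost.induct)
  interpret FR: group "FR G" by (rule group_real_free_product)
  case one
  then show ?case by (simp add: FR_cost.one)
next
  interpret FR: group "FR G" by (rule group_real_free_product)
  case (step h g x c r)
  note mem = step.hyps(1) letter_in_carrier[OF step.hyps(2)] FR_cost_carrier[OF step.hyps(3)]
  have "inv\<^bsub>FR G\<^esub> (h \<otimes>\<^bsub>FR G\<^esub> letter G g r \<otimes>\<^bsub>FR G\<^esub> inv\<^bsub>FR G\<^esub> h \<otimes>\<^bsub>FR G\<^esub> x)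
      = inv\<^bsub>FR G\<^esub> x \<otimes>\<^bsub>FR G\<^esub> (h \<otimes>\<^bsub>FR G\<^esub> letter G g (- r) \<otimes>\<^bsub>FR G\<^esub> inv\<^bsub>FR G\<^esub> h)"
    using mem step.hyps(2) by (simp add: FR.inv_mult_group FR.m_assoc inv_letter)
  then show ?case
    using FR_cost_mult[OF step.IH FR_cost_conj_letter[OF step.hyps(1,2), of nm "- r"]]
    by (simp add: add.commute)
qed

lemma FR_cost_conj:
  assumes "FR_cost G nm x c" "k \<in> carrier (FR G)"
  shows "FR_cost G nm (k \<otimes>\<^bsub>FR G\<^esub> x \<otimes>\<^bsub>FR G\<^esub> inv\<^bsub>FR G\<^esub> k) c"
  using assms(1)
proof (induction rule: FR_cost.induct)
  interpret FR: group "FR G" by (rule group_real_free_product)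
  case one
  then show ?case using assms(2) by (simp add: FR_cost.one)
next
  interpret FR: group "FR G" by (rule group_real_free_product)
  case (step h g x c r)
  note mem = step.hyps(1) letter_in_carrier[OF step.hyps(2)] FR_cost_carrier[OF step.hyps(3)] assms(2)
  have cancel: "inv\<^bsub>FR G\<^esub> k \<otimes>\<^bsub>FR G\<^esub> (k \<otimes>\<^bsub>FR G\<^esub> z) = z" if "z \<in> carrier (FR G)" for z
    using that assms(2) by (simp add: FR.m_assoc[symmetric])
  have "k \<otimes>\<^bsub>FR G\<^esub> (h \<otimes>\<^bsub>FR G\<^esub> letter G g r \<otimes>\<^bsub>FR G\<^esub> inv\<^bsub>FR G\<^esub> h \<otimes>\<^bsub>FR G\<^esub> x) \<otimes>\<^bsub>FR G\<^esub> inv\<^bsub>FR G\<^esub> k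
      = (k \<otimes>\<^bsub>FR G\<^esub> h) \<otimes>\<^bsub>FR G\<^esub> letter G g r \<otimes>\<^bsub>FR G\<^esub> inv\<^bsub>FR G\<^esub> (k \<otimes>\<^bsub>FR G\<^esub> h)
        \<otimes>\<^bsub>FR G\<^esub> (k \<otimes>\<^bsub>FR G\<^esub> x \<otimes>\<^bsub>FR G\<^esub> inv\<^bsub>FR G\<^esub> k)"
    using mem by (simp add: FR.inv_mult_group FR.m_assoc cancel)
  then show ?case
    using FR_cost.step[OF _ step.hyps(2) step.IH, of "k \<otimes>\<^bsub>FR G\<^esub> h" r] mem by simp
qed

lemma FR_cost_scale:
  assumes "FR_cost G nm x c"
  shows "FR_cost G nm (scale G t x) (\<bar>t\<bar> * c)"
  using assms
proof (induction rule: FR_cost.induct)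
  interpret s: group_hom "FR G" "FR G" "scale G t"
    by (intro group_hom.intro group_hom_axioms.intro group_real_free_product scale_hom)
  case one
  then show ?case by (simp add: FR_cost.one)
next
  interpret s: group_hom "FR G" "FR G" "scale G t"
    by (intro group_hom.intro group_hom_axioms.intro group_real_free_product scale_hom)
  case (step h g x c r)
  note mem = step.hyps(1) letter_in_carrier[OF step.hyps(2)] FR_cost_carrier[OF step.hyps(3)]
  show ?case
    using FR_cost.step[OF s.hom_closed[OF step.hyps(1)] step.hyps(2) step.IH, of "t * r"] mem step.hyps(2)
    by (simp add: scale_letter abs_mult algebra_simps)
qed

context conj_invariant_normed_group
begin

lemma FR_cost_nonneg: "FR_cost G nm x c \<Longrightarrow> 0 \<le> c"
  by (induction rule: FR_cost.induct) (auto simp: norm_nonneg)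

lemma FR_cost_bdd_below: "bdd_below {c. FR_cost G nm x c}"
  by (rule bdd_belowI[of _ 0]) (simp add: FR_cost_nonneg)

lemma FR_norm_le_FR_cost: "FR_cost G nm x c \<Longrightarrow> FR_norm G nm x \<le> c"
  unfolding FR_norm_eq_Inf_FR_cost by (rule cInf_lower) (simp_all add: FR_cost_bdd_below)

lemma FR_cost_word:
  "u \<in> words (carrier G) \<Longrightarrow> FR_cost G nm (word_rel (carrier G) `` {u}) (\<Sum>(g, r)\<leftarrow>u. \<bar>r\<bar> * nm g)"
proof (induction u rule: list.induct)
  case Nil
  show ?case using FR_cost.one by (simp add: one_real_free_product)
next
  case (Cons a u)
  obtain g r where a: "a = (g, r)" by (cases a)
  with Cons.prems have "g \<in> carrier G" "u \<in> words (carrier G)" by auto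
  then show ?case
    using FR_cost_mult[OF FR_cost_letter[of g G nm r] Cons.IH] a
    by (simp add: letter_def mult_word_class)
qed

lemma FR_cost_ex: "x \<in> carrier (FR G) \<Longrightarrow> \<exists>c. FR_cost G nm x c"
  using FR_cost_word by (elim carrier_real_free_productE) blast

lemma FR_norm_greatest:
  "x \<in> carrier (FR G) \<Longrightarrow> (\<And>c. FR_cost G nm x c \<Longrightarrow> b \<le> c) \<Longrightarrow> b \<le> FR_norm G nm x"
  unfolding FR_norm_eq_Inf_FR_cost by (rule cInf_greatest) (auto dest: FR_cost_ex)

lemma FR_norm_mono:
  assumes "y \<in> carrier (FR G)" "\<And>c. FR_cost G nm y c \<Longrightarrow> FR_cost G nm x c"
  shows "FR_norm G nm x \<le> FR_norm G nm y"
  using assms by (intro FR_norm_greatest FR_norm_le_FR_cost)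

lemma FR_pseudonormed: "conj_invariant_pseudonormed_group (FR G) (FR_norm G nm)"
proof -
  interpret FR: group "FR G" by (rule group_real_free_product)
  show ?thesis
  proof
    fix x assume x: "x \<in> carrier (FR G)"
    show "0 \<le> FR_norm G nm x" using x by (rule FR_norm_greatest) (rule FR_cost_nonneg)
    show "FR_norm G nm (inv\<^bsub>FR G\<^esub> x) = FR_norm G nm x"
      using FR_norm_mono[of x "inv\<^bsub>FR G\<^esub> x"] FR_norm_mono[of "inv\<^bsub>FR G\<^esub> x" x] x
        FR_cost_inv[of G nm "inv\<^bsub>FR G\<^esub> x"] FR_cost_inv[of G nm x]
      by (simp add: order_antisym)
    fix y assume y: "y \<in> carrier (FR G)"
    have "FR_norm G nm (x \<otimes>\<^bsub>FR G\<^esub> y) - d \<le> FR_norm G nm x" if "FR_cost G nm y d" for d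
      using FR_norm_le_FR_cost[OF FR_cost_mult[OF _ that]]
      by (intro FR_norm_greatest[OF x]) (simp add: algebra_simps)
    then have "FR_norm G nm (x \<otimes>\<^bsub>FR G\<^esub> y) - FR_norm G nm x \<le> FR_norm G nm y"
      by (intro FR_norm_greatest[OF y]) (simp add: algebra_simps)
    then show "FR_norm G nm (x \<otimes>\<^bsub>FR G\<^esub> y) \<le> FR_norm G nm x + FR_norm G nm y" by simp
    have "FR_norm G nm (y \<otimes>\<^bsub>FR G\<^esub> x \<otimes>\<^bsub>FR G\<^esub> inv\<^bsub>FR G\<^esub> y) \<le> FR_norm G nm x"
      using FR_cost_conj[OF _ y] by (intro FR_norm_mono x)
    moreover have "FR_norm G nm x \<le> FR_norm G nm (y \<otimes>\<^bsub>FR G\<^esub> x \<otimes>\<^bsub>FR G\<^esub> inv\<^bsub>FR G\<^esub> y)"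
    proof (rule FR_norm_mono)
      fix c assume "FR_cost G nm (y \<otimes>\<^bsub>FR G\<^esub> x \<otimes>\<^bsub>FR G\<^esub> inv\<^bsub>FR G\<^esub> y) c"
      then have "FR_cost G nm (inv\<^bsub>FR G\<^esub> y \<otimes>\<^bsub>FR G\<^esub> (y \<otimes>\<^bsub>FR G\<^esub> x \<otimes>\<^bsub>FR G\<^esub> inv\<^bsub>FR G\<^esub> y)
          \<otimes>\<^bsub>FR G\<^esub> inv\<^bsub>FR G\<^esub> (inv\<^bsub>FR G\<^esub> y)) c"
        using y by (rule FR_cost_conj[OF _ FR.inv_closed])
      moreover have "inv\<^bsub>FR G\<^esub> y \<otimes>\<^bsub>FR G\<^esub> (y \<otimes>\<^bsub>FR G\<^esub> x \<otimes>\<^bsub>FR G\<^esub> inv\<^bsub>FR G\<^esub> y)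
          \<otimes>\<^bsub>FR G\<^esub> inv\<^bsub>FR G\<^esub> (inv\<^bsub>FR G\<^esub> y) = x"
        using x y by (simp add: FR.m_assoc) (simp add: FR.m_assoc[symmetric])
      ultimately show "FR_cost G nm x c" by (simp only:)
    qed (use x y in simp)
    ultimately show "FR_norm G nm (y \<otimes>\<^bsub>FR G\<^esub> x \<otimes>\<^bsub>FR G\<^esub> inv\<^bsub>FR G\<^esub> y) = FR_norm G nm x"
      by (rule order_antisym)
  next
    show "FR_norm G nm \<one>\<^bsub>FR G\<^esub> = 0"
      using FR_norm_le_FR_cost[OF FR_cost.one] FR_norm_greatest[OF FR.one_closed FR_cost_nonneg]
      by (rule order_antisym)
  qed
qed

lemma FR_norm_letter: "g \<in> carrier G \<Longrightarrow> FR_norm G nm (letter G g r) \<le> \<bar>r\<bar> * nm g"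
  by (intro FR_norm_le_FR_cost FR_cost_letter)

lemma scale_closed: "x \<in> carrier (FR G) \<Longrightarrow> scale G t x \<in> carrier (FR G)"
  using scale_hom[of G t] by (auto simp: hom_def)

lemma scale_scale: "x \<in> carrier (FR G) \<Longrightarrow> scale G s (scale G t x) = scale G (s * t) x"
proof (elim carrier_real_free_productE)
  fix u assume u: "u \<in> words (carrier G)" "x = word_rel (carrier G) `` {u}"
  then have "map (\<lambda>(g, r). (g, t * r)) u \<in> words (carrier G)" by (auto simp: lists_eq_set)
  moreover have "map (\<lambda>(g, r). (g, s * r)) (map (\<lambda>(g, r). (g, t * r)) u) = map (\<lambda>(g, r). (g, s * t * r)) u"
    by (auto simp: mult.assoc)
  ultimately show ?thesis using u by (simp only: scale_word_class)
qed

lemma scale_1: "x \<in> carrier (FR G) \<Longrightarrow> scale G 1 x = x"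
  by (elim carrier_real_free_productE) (simp add: scale_word_class)

lemma FR_norm_scale:
  assumes x: "x \<in> carrier (FR G)" and t: "0 < t"
  shows "FR_norm G nm (scale G t x) = t * FR_norm G nm x"
proof -
  have le: "FR_norm G nm (scale G t x) \<le> t * FR_norm G nm x" if "x \<in> carrier (FR G)" "0 < t" for x t
  proof -
    have "FR_norm G nm (scale G t x) / t \<le> FR_norm G nm x"
      using that FR_norm_le_FR_cost[OF FR_cost_scale[of G nm x _ t]]
      by (intro FR_norm_greatest) (auto simp: field_simps)
    then show ?thesis using that by (simp add: field_simps)
  qed
  have "FR_norm G nm x \<le> (1 / t) * FR_norm G nm (scale G t x)"
    using le[of "scale G t x" "1 / t"] x t by (simp add: scale_closed scale_scale scale_1)
  then have "t * FR_norm G nm x \<le> FR_norm G nm (scale G t x)"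
    using t by (simp add: field_simps)
  then show ?thesis using le[OF x t] by simp
qed

text \<open>By bi-invariance the distances of corresponding letters add up. This bounds the error of
  rounding exponents.\<close>

lemma FR_dist_words_le:
  assumes "\<And>a. a \<in> set u \<Longrightarrow> fst a \<in> carrier G"
  shows "norm_dist (FR G) (FR_norm G nm) (word_rel (carrier G) `` {map (\<lambda>a. (fst a, r a)) u})
      (word_rel (carrier G) `` {map (\<lambda>a. (fst a, s a)) u}) \<le> (\<Sum>a\<leftarrow>u. \<bar>r a - s a\<bar> * nm (fst a))"
  using assms
proof (induction u)
  interpret FR: conj_invariant_pseudonormed_group "FR G" "FR_norm G nm" by (rule FR_pseudonormed)
  case Nil
  then show ?case by (simp add: FR.dist_self word_class_in_carrier)
next
  interpret FR: conj_invariant_pseudonormed_group "FR G" "FR_norm G nm" by (rule FR_pseudonormed)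
  case (Cons a u)
  have a: "fst a \<in> carrier G" and u: "map (\<lambda>a. (fst a, q a)) u \<in> words (carrier G)" for q
    using Cons.prems by (auto simp: lists_eq_set)
  have split: "word_rel (carrier G) `` {map (\<lambda>a. (fst a, q a)) (a # u)}
      = letter G (fst a) (q a) \<otimes>\<^bsub>FR G\<^esub> word_rel (carrier G) `` {map (\<lambda>a. (fst a, q a)) u}" for q
    using a u[of q] by (simp add: letter_def mult_word_class)
  have "FR.dist (letter G (fst a) (r a)) (letter G (fst a) (s a)) \<le> \<bar>s a - r a\<bar> * nm (fst a)"
    using FR_norm_letter[OF a, of "s a - r a"] a by (simp add: norm_dist_def inv_letter letter_add)
  moreover have "FR.dist (word_rel (carrier G) `` {map (\<lambda>a. (fst a, r a)) u})
      (word_rel (carrier G) `` {map (\<lambda>a. (fst a, s a)) u}) \<le> (\<Sum>a\<leftarrow>u. \<bar>r a - s a\<bar> * nm (fst a))"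
    using Cons by auto
  ultimately show ?case
    unfolding split
    using FR.dist_mult[OF letter_in_carrier[OF a, of "r a"] word_class_in_carrier[OF u, of r]
        letter_in_carrier[OF a, of "s a"] word_class_in_carrier[OF u, of s]]
    by (simp add: abs_minus_commute)
qed

end

section \<open>Cancelling words, and the norm of the projection\<close>

subsection \<open>Normal forms decide the word problem\<close>

lemma reduced_normal_form: "reduced (normal_form u)"
  by (rule reduced_foldr) simp

lemma normal_form_of_reduced: "reduced u \<Longrightarrow> normal_form u = u"
proof (induction u rule: reduced.induct)
  case (3 g r h s w)
  then have "normal_form ((h, s) # w) = (h, s) # w" by simp
  then have "normal_form ((g, r) # (h, s) # w) = cons_reduced (g, r) ((h, s) # w)"
    by (simp only: foldr_Cons o_apply)
  then show ?case using 3 by simp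
qed auto

lemma cons_reduced_word_rel: "(cons_reduced (g, r) w, (g, r) # w) \<in> word_rel UNIV"
proof -
  have zero: "(w, (g, 0) # w) \<in> word_rel UNIV" for g :: 'a and w
    using word_rel.sym[OF word_rel.zero[of g UNIV "[]" w]] by auto
  show ?thesis
  proof (cases w)
    case Nil
    then show ?thesis using zero[of "[]" g] by (auto intro: word_rel.refl)
  next
    case (Cons a v)
    obtain h s where a: "a = (h, s)" by (cases a)
    have add: "((g, r + s) # v, (g, r) # (g, s) # v) \<in> word_rel UNIV"
      using word_rel.sym[OF word_rel.add[of g UNIV "[]" v r s]] by auto
    have "r + s = 0 \<Longrightarrow> (v, (g, r) # (g, s) # v) \<in> word_rel UNIV"
      using word_rel.trans[OF zero[of v g]] add by simp
    then show ?thesis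
      using Cons a zero[of "(h, s) # v" g] add by (auto intro: word_rel.refl)
  qed
qed

lemma normal_form_word_rel_self: "(normal_form u, u) \<in> word_rel UNIV"
proof (induction u)
  case Nil
  then show ?case by (auto intro: word_rel.refl)
next
  case (Cons a u)
  obtain g r where a: "a = (g, r)" by (cases a)
  have "((g, r) # normal_form u, (g, r) # u) \<in> word_rel UNIV"
    using word_rel_append_left[OF Cons.IH, of "[(g, r)]"] by auto
  then show ?case using word_rel.trans[OF cons_reduced_word_rel[of g r "normal_form u"]] a by simp
qed

lemma normal_form_eq_iff: "normal_form u = normal_form v \<longleftrightarrow> (u, v) \<in> word_rel UNIV"
  using normal_form_word_rel[of u v UNIV] normal_form_word_rel_self[of u]
    normal_form_word_rel_self[of v] word_rel.trans word_rel.sym by metis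

text \<open>In a group, \<open>x y = 1\<close> implies \<open>y x = 1\<close>.\<close>

lemma normal_form_rotate:
  assumes "normal_form (u @ v) = []"
  shows "normal_form (v @ u) = []"
proof -
  interpret F: group "real_free_product (UNIV :: 'a set)" by (rule group_real_free_product)
  let ?c = "\<lambda>u. word_rel (UNIV :: 'a set) `` {u}"
  have W: "w \<in> words (UNIV :: 'a set)" for w by (auto simp: lists_eq_set)
  have "?c u \<otimes>\<^bsub>real_free_product UNIV\<^esub> ?c v = \<one>\<^bsub>real_free_product UNIV\<^esub>"
    using assms normal_form_eq_iff[of "u @ v" "[]"]
    by (simp add: mult_word_class[OF W W] one_real_free_product word_rel_class_eq_iff[OF W W])
  then have "?c v \<otimes>\<^bsub>real_free_product UNIV\<^esub> ?c u = \<one>\<^bsub>real_free_product UNIV\<^esub>"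
    by (rule F.inv_comm[OF _ word_class_in_carrier[OF W] word_class_in_carrier[OF W]])
  then show ?thesis
    using normal_form_eq_iff[of "v @ u" "[]"]
    by (simp add: mult_word_class[OF W W] one_real_free_product word_rel_class_eq_iff[OF W W])
qed

lemma not_reduced_cases:
  assumes "\<not> reduced u"
  obtains v g w where "u = v @ (g, 0) # w"
  | v g r s w where "u = v @ (g, r) # (g, s) # w"
proof -
  have "(\<exists>v g w. u = v @ (g, 0) # w) \<or> (\<exists>v g r s w. u = v @ (g, r) # (g, s) # w)"
    using assms
  proof (induction u rule: reduced.induct)
    case (2 g r)
    then show ?case by (metis append_Nil reduced.simps(2))
  next
    case (3 g r h s w)
    consider "r = 0" | "g = h" | "\<not> reduced ((h, s) # w)" using 3 by auto
    then show ?case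
    proof cases
      case 3
      have "r \<noteq> 0 \<and> g \<noteq> h \<or> r = 0 \<or> g = h" by blast
      then show ?thesis using 3 "3.IH" by (metis append_Cons append_Nil)
    qed (metis append_Nil)+
  qed auto
  then show thesis using that by blast
qed

subsection \<open>Changing exponents\<close>

definition same_letters :: "'a word \<Rightarrow> 'a word \<Rightarrow> bool"
  where "same_letters = list_all2 (\<lambda>a b. fst a = fst b)"

definition change_cost :: "('a \<Rightarrow> real) \<Rightarrow> 'a word \<Rightarrow> 'a word \<Rightarrow> real"
  where "change_cost nm u v = (\<Sum>(a, b)\<leftarrow>zip u v. \<bar>snd a - snd b\<bar> * nm (fst a))"

text \<open>Here \<open>c\<close> bounds the weighted change of exponents that turns \<open>u\<close> into a word for \<open>1\<close>. This
  combinatorial quantity bounds the pseudonorm from below without mentioning conjugating elements.\<close>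

definition cancels :: "('a \<Rightarrow> real) \<Rightarrow> 'a word \<Rightarrow> real \<Rightarrow> bool"
  where "cancels nm u c \<longleftrightarrow> (\<exists>v. same_letters u v \<and> normal_form v = [] \<and> change_cost nm u v \<le> c)"

lemma same_letters_simps [simp]:
  "same_letters [] v \<longleftrightarrow> v = []"
  "same_letters v [] \<longleftrightarrow> v = []"
  "same_letters ((g, r) # u) ((h, s) # v) \<longleftrightarrow> g = h \<and> same_letters u v"
  by (auto simp: same_letters_def)

lemma same_letters_refl [simp]: "same_letters u u"
  by (simp add: same_letters_def list_all2_refl)

lemma same_letters_Cons: "same_letters ((g, r) # u) v \<longleftrightarrow> (\<exists>s v'. v = (g, s) # v' \<and> same_letters u v')"
  by (auto simp: same_letters_def list_all2_Cons1)

lemma same_letters_append1: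
  "same_letters (u @ u') v \<longleftrightarrow> (\<exists>w w'. v = w @ w' \<and> same_letters u w \<and> same_letters u' w')"
  unfolding same_letters_def list_all2_append1 by (metis list_all2_lengthD)

lemma same_letters_append:
  "same_letters u v \<Longrightarrow> same_letters u' v' \<Longrightarrow> same_letters (u @ u') (v @ v')"
  by (auto simp: same_letters_append1)

lemma same_letters_trans: "same_letters u v \<Longrightarrow> same_letters v w \<Longrightarrow> same_letters u w"
  unfolding same_letters_def by (rule list_all2_trans) auto

lemma same_letters_length: "same_letters u v \<Longrightarrow> length u = length v"
  unfolding same_letters_def by (rule list_all2_lengthD)

lemma same_letters_sym: "same_letters u v \<Longrightarrow> same_letters v u"
  unfolding same_letters_def by (auto simp: list_all2_conv_all_nth)

lemma change_cost_simps [simp]: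
  "change_cost nm [] v = 0"
  "change_cost nm ((g, r) # u) ((h, s) # v) = \<bar>r - s\<bar> * nm g + change_cost nm u v"
  by (simp_all add: change_cost_def)

lemma change_cost_refl [simp]: "change_cost nm u u = 0"
  by (induction u) (auto simp: change_cost_def)

lemma change_cost_append:
  "same_letters u v \<Longrightarrow> change_cost nm (u @ u') (v @ v') = change_cost nm u v + change_cost nm u' v'"
  by (simp add: change_cost_def same_letters_length)

lemma change_cost_triangle:
  assumes "same_letters u v" "same_letters v w" "\<forall>a\<in>set u. 0 \<le> nm (fst a)"
  shows "change_cost nm u w \<le> change_cost nm u v + change_cost nm v w"
  using assms
proof (induction u arbitrary: v w)
  case (Cons a u)
  obtain g r where a: "a = (g, r)" by (cases a)
  obtain s v' where v: "v = (g, s) # v'" "same_letters u v'"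
    using Cons.prems(1) by (auto simp: a same_letters_Cons)
  obtain t w' where w: "w = (g, t) # w'" "same_letters v' w'"
    using Cons.prems(2) by (auto simp: v same_letters_Cons)
  have "\<bar>r - t\<bar> * nm g \<le> (\<bar>r - s\<bar> + \<bar>s - t\<bar>) * nm g"
    using Cons.prems(3) by (intro mult_right_mono) (auto simp: a)
  then show ?case
    using Cons.IH[OF v(2) w(2)] Cons.prems(3) by (simp add: a v w algebra_simps)
qed auto

text \<open>A letter of the normal form is the product of letters of the word; so it can be removed by
  changing exponents in the word, and this costs no more than removing it from the normal form.
  Multiplying the normal form by one letter on the left only affects its first letter, which
  allows induction on the word.\<close>

lemma remove_normal_form_letter:
  assumes "normal_form u = z @ (g, r) # z'"
  shows "\<exists>v. same_letters u v \<and> normal_form v = normal_form (z @ z') \<and> change_cost nm u v = \<bar>r\<bar> * nm g"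
  using assms
proof (induction u arbitrary: z)
  case Nil
  then show ?case by simp
next
  case (Cons a u)
  obtain h s where a: "a = (h, s)" by (cases a)
  define n where "n = normal_form u"
  have red: "reduced n" "\<And>w. reduced (normal_form w)" by (auto simp: n_def reduced_normal_form)
  have nf: "cons_reduced (h, s) n = z @ (g, r) # z'" using Cons.prems by (simp add: a n_def)
  \<comment> \<open>the removed letter occurs already in the normal form of the tail\<close>
  have tail: ?case if y: "n = y @ (g, r) # z'"
    "cons_reduced (h, s) (normal_form (y @ z')) = normal_form (z @ z')" for y
  proof -
    obtain v where "same_letters u v" "normal_form v = normal_form (y @ z')"
      "change_cost nm u v = \<bar>r\<bar> * nm g"
      using Cons.IH[of y] y(1) unfolding n_def by blast
    with y(2) show ?thesis by (intro exI[of _ "(h, s) # v"]) (simp add: a)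
  qed
  show ?case
  proof (cases "s = 0")
    case True
    then show ?thesis using nf by (intro tail[of z]) (simp_all add: cons_reduced_zero)
  next
    case s: False
    show ?thesis
    proof (cases "\<exists>t n'. n = (h, t) # n'")
      case True
      then obtain t n' where n: "n = (h, t) # n'" by blast
      have n': "normal_form n' = n'" using red(1) n reduced_tl normal_form_of_reduced by metis
      show ?thesis
      proof (cases "s + t = 0")
        case True
        then have "n' = z @ (g, r) # z'" using nf n s by simp
        moreover have "cons_reduced (h, s) (cons_reduced (h, t) (normal_form (z @ z'))) = normal_form (z @ z')"
          unfolding cons_reduced_add[OF red(2)] True by (rule cons_reduced_zero)
        ultimately show ?thesis using n by (intro tail[of "(h, t) # z"]) simp_all
      next
        case False
        then have *: "(h, s + t) # n' = z @ (g, r) # z'" using nf n s by simp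
        show ?thesis
        proof (cases z)
          case Nil
          then have "g = h" "r = s + t" "z' = n'" using * by auto
          moreover have "cons_reduced (h, - t) n = n'" using red(1) n by (cases n') auto
          ultimately show ?thesis
            using Nil n' n_def by (intro exI[of _ "(h, - t) # u"]) (simp add: a)
        next
          case (Cons b y)
          then have b: "b = (h, s + t)" "n' = y @ (g, r) # z'" using * by auto
          have "cons_reduced (h, s) (cons_reduced (h, t) (normal_form (y @ z'))) = normal_form (z @ z')"
            unfolding cons_reduced_add[OF red(2)] using Cons b by simp
          then show ?thesis using n b by (intro tail[of "(h, t) # y"]) simp_all
        qed
      qed
    next
      case False
      then have *: "(h, s) # n = z @ (g, r) # z'" using nf s by (cases n) (auto split: if_splits)
      show ?thesis
      proof (cases z)
        case Nil
        then have "g = h" "r = s" "z' = n" using * by auto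
        then show ?thesis
          using Nil normal_form_of_reduced[OF red(1)] n_def
          by (intro exI[of _ "(h, 0) # u"]) (simp add: a cons_reduced_zero)
      next
        case (Cons b y)
        then show ?thesis using * by (intro tail[of y]) simp_all
      qed
    qed
  qed
qed

text \<open>The essential point of the invariance under \<^const>\<open>word_rel\<close>: the cancellation may change
  the exponent of the superfluous letter from \<open>0\<close> to \<open>a\<close>. Without this letter the other letters
  multiply to a conjugate of \<open>g(-a)\<close>, which the previous lemma removes at the same cost.\<close>

lemma cancels_remove_zero:
  assumes nonneg: "\<forall>a\<in>set (u @ u'). 0 \<le> nm (fst a)"
    and "cancels nm (u @ (g, 0) # u') c"
  shows "cancels nm (u @ u') c"
proof -
  obtain a v v' where v: "same_letters u v" "same_letters u' v'" "normal_form (v @ (g, a) # v') = []"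
    "change_cost nm (u @ (g, 0) # u') (v @ (g, a) # v') \<le> c"
    using assms(2) unfolding cancels_def same_letters_append1 same_letters_Cons by blast
  have cost: "change_cost nm (u @ u') (v @ v') + \<bar>a\<bar> * nm g \<le> c"
    using v by (simp add: change_cost_append algebra_simps)
  have "normal_form (((g, a) # v') @ v) = []" by (rule normal_form_rotate[OF v(3)])
  then have "cons_reduced (g, a) (normal_form (v' @ v)) = []" by simp
  then have "cons_reduced (g, - a) (cons_reduced (g, a) (normal_form (v' @ v))) = cons_reduced (g, - a) []"
    by simp
  then have nf: "normal_form (v' @ v) = cons_reduced (g, - a) []"
    unfolding cons_reduced_add[OF reduced_normal_form] by (simp only: cons_reduced_zero add.left_inverse)
  obtain w where w: "same_letters (v' @ v) w" "normal_form w = []"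
    "change_cost nm (v' @ v) w \<le> \<bar>a\<bar> * nm g"
  proof (cases "a = 0")
    case True
    then show ?thesis using that[of "v' @ v"] nf by simp
  next
    case False
    then have "normal_form (v' @ v) = [] @ (g, - a) # []" using nf by simp
    from remove_normal_form_letter[OF this, of nm] show ?thesis using that by auto
  qed
  obtain x' x where x: "w = x' @ x" "same_letters v' x'" "same_letters v x"
    using w(1) unfolding same_letters_append1 by blast
  have "normal_form (x @ x') = []" using normal_form_rotate w(2) x(1) by metis
  moreover have "change_cost nm (v @ v') (x @ x') \<le> \<bar>a\<bar> * nm g"
    using w(3) x by (simp add: change_cost_append)
  moreover have "change_cost nm (u @ u') (x @ x')
      \<le> change_cost nm (u @ u') (v @ v') + change_cost nm (v @ v') (x @ x')"
    using v x nonneg by (intro change_cost_triangle same_letters_append)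
  moreover have "same_letters (u @ u') (x @ x')"
    using v x same_letters_trans same_letters_append by metis
  ultimately show ?thesis
    unfolding cancels_def using cost by (intro exI[of _ "x @ x'"]) linarith
qed

lemma cancels_insert_zero:
  assumes "cancels nm (u @ u') c"
  shows "cancels nm (u @ (g, 0) # u') c"
proof -
  obtain v v' where v: "same_letters u v" "same_letters u' v'" "normal_form (v @ v') = []"
    "change_cost nm (u @ u') (v @ v') \<le> c"
    using assms unfolding cancels_def same_letters_append1 by blast
  have "normal_form (v @ (g, 0) # v') = []" using v(3) by (simp add: cons_reduced_zero)
  then show ?thesis
    unfolding cancels_def using v
    by (intro exI[of _ "v @ (g, 0) # v'"]) (auto simp: change_cost_append intro!: same_letters_append)
qed

lemma cancels_add_iff:
  assumes "0 \<le> nm g"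
  shows "cancels nm (u @ (g, r) # (g, s) # u') c \<longleftrightarrow> cancels nm (u @ (g, r + s) # u') c"
proof
  assume "cancels nm (u @ (g, r) # (g, s) # u') c"
  then obtain a b v v' where v: "same_letters u v" "same_letters u' v'"
    "normal_form (v @ (g, a) # (g, b) # v') = []"
    "change_cost nm (u @ (g, r) # (g, s) # u') (v @ (g, a) # (g, b) # v') \<le> c"
    unfolding cancels_def same_letters_append1 same_letters_Cons by blast
  have "normal_form (v @ (g, a + b) # v') = []"
    using v(3) by (simp add: cons_reduced_add reduced_normal_form)
  moreover have "\<bar>(r + s) - (a + b)\<bar> * nm g \<le> (\<bar>r - a\<bar> + \<bar>s - b\<bar>) * nm g"
    using assms by (intro mult_right_mono) auto
  then have "change_cost nm (u @ (g, r + s) # u') (v @ (g, a + b) # v') \<le> c"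
    using v by (simp add: change_cost_append distrib_right)
  ultimately show "cancels nm (u @ (g, r + s) # u') c"
    unfolding cancels_def using v
    by (intro exI[of _ "v @ (g, a + b) # v'"]) (auto intro!: same_letters_append)
next
  assume "cancels nm (u @ (g, r + s) # u') c"
  then obtain a v v' where v: "same_letters u v" "same_letters u' v'"
    "normal_form (v @ (g, a) # v') = []"
    "change_cost nm (u @ (g, r + s) # u') (v @ (g, a) # v') \<le> c"
    unfolding cancels_def same_letters_append1 same_letters_Cons by blast
  have "normal_form (v @ (g, a - s) # (g, s) # v') = []"
    using v(3) by (simp add: cons_reduced_add reduced_normal_form)
  moreover have "change_cost nm (u @ (g, r) # (g, s) # u') (v @ (g, a - s) # (g, s) # v') \<le> c"
    using v by (simp add: change_cost_append algebra_simps)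
  ultimately show "cancels nm (u @ (g, r) # (g, s) # u') c"
    unfolding cancels_def using v
    by (intro exI[of _ "v @ (g, a - s) # (g, s) # v'"]) (auto intro!: same_letters_append)
qed

lemma cancels_word_rel:
  assumes "(u, v) \<in> word_rel I" "\<And>g. g \<in> I \<Longrightarrow> 0 \<le> nm g"
  shows "cancels nm u c \<longleftrightarrow> cancels nm v c"
  using assms(1)
proof (induction rule: word_rel.induct)
  case (add i u v r s)
  then show ?case using cancels_add_iff[of nm i u r s v c] assms(2) by simp
next
  case (zero i u v)
  then have "\<forall>a\<in>set (u @ v). 0 \<le> nm (fst a)" using assms(2) by (auto simp: lists_eq_set)
  then show ?case
    using cancels_remove_zero[of u v nm i c] cancels_insert_zero[of nm u v c i] by auto
qed auto

lemma word_inverse_right: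
  assumes "u \<in> words I"
  shows "(u @ rev (map (\<lambda>(i, r). (i, - r)) u), []) \<in> word_rel I"
proof -
  have "rev (map (\<lambda>(i, r). (i, - r)) u) \<in> words I" using assms by (auto simp: lists_eq_set)
  then have "(rev (map (\<lambda>(i, r). (i, - r)) (rev (map (\<lambda>(i, r). (i, - r)) u)))
      @ rev (map (\<lambda>(i, r). (i, - r)) u), []) \<in> word_rel I"
    by (rule word_inverse)
  moreover have "rev (map (\<lambda>(i, r). (i, - r)) (rev (map (\<lambda>(i, r). (i, - r)) u))) = u"
    by (simp add: rev_map[symmetric] o_def case_prod_beta)
  ultimately show ?thesis by simp
qed

text \<open>A product of conjugates of letters cancels when the exponents of these letters are set to
  \<open>0\<close>; by invariance, every other word for the same element cancels at the same cost.\<close>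

lemma FR_cost_cancels:
  assumes nonneg: "\<And>g. g \<in> carrier G \<Longrightarrow> 0 \<le> nm g"
    and "FR_cost G nm x c" "u \<in> words (carrier G)" "x = word_rel (carrier G) `` {u}"
  shows "cancels nm u c"
  using assms(2-)
proof (induction arbitrary: u rule: FR_cost.induct)
  case one
  then have "(u, []) \<in> word_rel (carrier G)"
    by (simp add: one_real_free_product word_rel_class_eq_iff word_rel.sym)
  from cancels_word_rel[OF this nonneg] show ?case by (simp add: cancels_def)
next
  case (step h g x c r)
  interpret FR: group "FR G" by (rule group_real_free_product)
  obtain k where k: "k \<in> words (carrier G)" "h = word_rel (carrier G) `` {k}"
    using step.hyps(1) by (rule carrier_real_free_productE)
  obtain y where y: "y \<in> words (carrier G)" "x = word_rel (carrier G) `` {y}"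
    using FR_cost_carrier[OF step.hyps(3)] by (rule carrier_real_free_productE)
  define k' where "k' = rev (map (\<lambda>(i, r). (i, - r)) k)"
  have k': "k' \<in> words (carrier G)" using k by (auto simp: lists_eq_set k'_def)
  have g: "[(g, r)] \<in> words (carrier G)" using step.hyps(2) by simp
  have inv_h: "inv\<^bsub>FR G\<^esub> h = word_rel (carrier G) `` {k'}"
  proof (rule FR.inv_equality)
    show "word_rel (carrier G) `` {k'} \<otimes>\<^bsub>FR G\<^esub> h = \<one>\<^bsub>FR G\<^esub>"
      using k k' word_inverse[OF k(1)]
      by (simp add: k'_def mult_word_class one_real_free_product word_rel_class_eq_iff)
  qed (use k k' in \<open>auto intro: word_class_in_carrier\<close>)
  have "word_rel (carrier G) `` {u} = word_rel (carrier G) `` {k @ [(g, r)] @ k' @ y}"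
    using step.prems(2) k k' y g unfolding inv_h by (simp add: letter_def mult_word_class)
  then have rel: "(u, k @ [(g, r)] @ k' @ y) \<in> word_rel (carrier G)"
    using step.prems(1) k k' y g by (simp add: word_rel_class_eq_iff)
  obtain v where v: "same_letters y v" "normal_form v = []" "change_cost nm y v \<le> c"
    using step.IH[OF y] by (auto simp: cancels_def)
  have "normal_form (k @ k') = []"
    using normal_form_word_rel[OF word_inverse_right[OF k(1)]] by (simp add: k'_def)
  then have "normal_form (k @ [(g, 0)] @ k' @ v) = []"
    using v(2) by (simp add: cons_reduced_zero)
  moreover have "same_letters (k @ [(g, r)] @ k' @ y) (k @ [(g, 0)] @ k' @ v)"
    using v(1) by (intro same_letters_append) simp_all
  moreover have "change_cost nm (k @ [(g, r)] @ k' @ y) (k @ [(g, 0)] @ k' @ v) \<le> \<bar>r\<bar> * nm g + c"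
    using v(3) by (simp add: change_cost_append)
  ultimately have "cancels nm (k @ [(g, r)] @ k' @ y) (\<bar>r\<bar> * nm g + c)"
    unfolding cancels_def by blast
  then show ?case using cancels_word_rel[OF rel nonneg] by simp
qed

context conj_invariant_normed_group
begin

subsection \<open>The projection is Lipschitz\<close>

text \<open>The exponents after the cancellation may be real although those of \<open>u\<close> are integers.
  Induction on the length: the cancelled word is not reduced. Merging two adjacent letters with
  the same generator does not increase the cost, and a letter whose exponent is cancelled to \<open>0\<close>
  can be deleted from \<open>u\<close>, since its integral power has norm at most its share of the cost.\<close>

lemma norm_word_value_le_change_cost:
  assumes "u \<in> words (carrier G)" "integral_word u" "same_letters u v" "normal_form v = []"
  shows "nm (word_value G u) \<le> change_cost nm u v"
  using assms
proof (induction "length u" arbitrary: u v rule: less_induct)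
  case less
  show ?case
  proof (cases "v = []")
    case True
    then show ?thesis using less.prems by (simp add: one)
  next
    case False
    then have "\<not> reduced v" using less.prems(4) normal_form_of_reduced by metis
    then show ?thesis
    proof (cases rule: not_reduced_cases)
      case (1 v1 g v2)
      have "same_letters (v1 @ (g, 0) # v2) u" using less.prems(3) 1 same_letters_sym by simp
      then obtain u1 n u2 where u: "u = u1 @ (g, n) # u2" "same_letters v1 u1" "same_letters v2 u2"
        unfolding same_letters_append1 same_letters_Cons by blast
      have mem: "g \<in> carrier G" "u1 \<in> words (carrier G)" "u2 \<in> words (carrier G)" "n \<in> \<int>"
        "integral_word (u1 @ u2)"
        using less.prems(1,2) u(1) by (auto simp: integral_word_def)
      have nf: "normal_form (v1 @ v2) = []" using less.prems(4) 1 by (simp add: cons_reduced_zero)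
      have "nm (word_value G (u1 @ u2)) \<le> change_cost nm (u1 @ u2) (v1 @ v2)"
        using mem u nf by (intro less.hyps) (auto intro: same_letters_append same_letters_sym)
      moreover have "nm (word_value G u) \<le> \<bar>n\<bar> * nm g + nm (word_value G (u1 @ u2))"
      proof -
        let ?a = "word_value G u1" and ?b = "word_value G u2" and ?p = "g [^] \<lfloor>n\<rfloor>"
        have cl: "?a \<in> carrier G" "?b \<in> carrier G" "?p \<in> carrier G"
          using mem word_value_closed by auto
        have "word_value G ((g, n) # u2) = ?p \<otimes> ?b" by simp
        moreover have "(g, n) # u2 \<in> words (carrier G)" using mem by simp
        ultimately have "word_value G u = ?a \<otimes> (?p \<otimes> ?b)"
          unfolding u(1) using word_value_append[OF mem(2)] by simp
        also have "\<dots> = (?a \<otimes> ?p \<otimes> inv ?a) \<otimes> (?a \<otimes> ?b)"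
          using cl by (simp add: m_assoc) (simp add: m_assoc[symmetric])
        finally have "nm (word_value G u) \<le> nm ?p + nm (?a \<otimes> ?b)"
          using mult[of "?a \<otimes> ?p \<otimes> inv ?a" "?a \<otimes> ?b"] conj[of ?p ?a] cl by simp
        moreover have "nm ?p \<le> \<bar>n\<bar> * nm g"
          using norm_int_pow[OF mem(1), of "\<lfloor>n\<rfloor>"] mem(4) by (auto elim: Ints_cases)
        ultimately show ?thesis using word_value_append[OF mem(2,3)] by simp
      qed
      ultimately show ?thesis
        using u 1 by (simp add: change_cost_append same_letters_sym)
    next
      case (2 v1 g a b v2)
      have "same_letters (v1 @ (g, a) # (g, b) # v2) u" using less.prems(3) 2 same_letters_sym by simp
      then obtain u1 m n u2 where u: "u = u1 @ (g, m) # (g, n) # u2" "same_letters v1 u1" "same_letters v2 u2"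
        unfolding same_letters_append1 same_letters_Cons by blast
      have mem: "g \<in> carrier G" "u1 \<in> words (carrier G)" "u2 \<in> words (carrier G)"
        "u1 @ (g, m + n) # u2 \<in> words (carrier G)"
        "m \<in> \<int>" "n \<in> \<int>" "integral_word (u1 @ (g, m + n) # u2)"
        using less.prems(1,2) u(1) by (auto simp: integral_word_def)
      have nf: "normal_form (v1 @ (g, a + b) # v2) = []"
        using less.prems(4) 2 by (simp add: cons_reduced_add reduced_normal_form)
      have "nm (word_value G (u1 @ (g, m + n) # u2)) \<le> change_cost nm (u1 @ (g, m + n) # u2) (v1 @ (g, a + b) # v2)"
        using mem u nf by (intro less.hyps) (auto intro!: same_letters_append intro: same_letters_sym)
      moreover have "word_value G (u1 @ (g, m + n) # u2) = word_value G u"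
      proof -
        have "\<lfloor>m + n\<rfloor> = \<lfloor>m\<rfloor> + \<lfloor>n\<rfloor>" using mem by (auto elim!: Ints_cases)
        then have "word_value G ((g, m + n) # u2) = word_value G ((g, m) # (g, n) # u2)"
          using mem word_value_closed[OF mem(3)] by (simp add: int_pow_mult m_assoc)
        then show ?thesis unfolding u(1) using mem by (subst (1 2) word_value_append) auto
      qed
      moreover have "\<bar>(m + n) - (a + b)\<bar> * nm g \<le> (\<bar>m - a\<bar> + \<bar>n - b\<bar>) * nm g"
        using mem(1) by (intro mult_right_mono) (auto simp: norm_nonneg)
      ultimately show ?thesis
        using u 2 by (simp add: change_cost_append same_letters_sym distrib_right)
    qed
  qed
qed

lemma group_FZ: "group (FZ G)"
  unfolding FZ_def by (intro group.group_subgroup_generated group_real_free_product)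

lemma FZ_subset_FR: "x \<in> carrier (FZ G) \<Longrightarrow> x \<in> carrier (FR G)"
  using FZ_integral_word word_class_in_carrier by metis

lemma subgroup_FZ: "subgroup (carrier (FZ G)) (FR G)"
  unfolding FZ_def by (intro group.subgroup_subgroup_generated group_real_free_product)

lemma mult_FZ [simp]: "x \<otimes>\<^bsub>FZ G\<^esub> y = x \<otimes>\<^bsub>FR G\<^esub> y"
  by (simp add: FZ_def)

lemma one_FZ [simp]: "\<one>\<^bsub>FZ G\<^esub> = \<one>\<^bsub>FR G\<^esub>"
  by (simp add: FZ_def)

lemma inv_FZ: "x \<in> carrier (FZ G) \<Longrightarrow> inv\<^bsub>FZ G\<^esub> x = inv\<^bsub>FR G\<^esub> x"
  unfolding FZ_def by (intro group.inv_subgroup_generated group_real_free_product)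

lemma FZ_eq: "FZ G = (FR G)\<lparr>carrier := carrier (FZ G)\<rparr>"
  by (simp add: FZ_def subgroup_generated_def real_free_product_def)

lemma FZ_pseudonormed: "conj_invariant_pseudonormed_group (FZ G) (FR_norm G nm)"
  using conj_invariant_pseudonormed_group.pseudonorm_on_subgroup[OF FR_pseudonormed subgroup_FZ]
  by (subst FZ_eq)

lemma proj_closed: "x \<in> carrier (FZ G) \<Longrightarrow> proj G x \<in> carrier G"
  using proj_hom by (auto simp: hom_def)

lemma proj_mult:
  "x \<in> carrier (FZ G) \<Longrightarrow> y \<in> carrier (FZ G) \<Longrightarrow> proj G (x \<otimes>\<^bsub>FR G\<^esub> y) = proj G x \<otimes> proj G y"
  using proj_hom by (auto simp: hom_def)

lemma integral_word_in_FZ: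
  assumes "u \<in> words (carrier G)" "integral_word u"
  shows "word_rel (carrier G) `` {u} \<in> carrier (FZ G)
    \<and> proj G (word_rel (carrier G) `` {u}) = word_value G u"
  using assms
proof (induction u rule: list.induct)
  interpret proj: group_hom "FZ G" G "proj G"
    by (intro group_hom.intro group_hom_axioms.intro group_FZ proj_hom is_group)
  interpret FR: group "FR G" by (rule group_real_free_product)
  case Nil
  then show ?case
    using proj.G.one_closed proj.hom_one by (simp add: one_real_free_product)
next
  interpret proj: group_hom "FZ G" G "proj G"
    by (intro group_hom.intro group_hom_axioms.intro group_FZ proj_hom is_group)
  case (Cons a u)
  obtain g r where a: "a = (g, r)" by (cases a)
  obtain k where k: "r = of_int k" using Cons.prems a by (auto simp: integral_word_def elim: Ints_cases)
  have mem: "g \<in> carrier G" "u \<in> words (carrier G)" "integral_word u"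
    using Cons.prems a by (auto simp: integral_word_def)
  have g1: "letter G g 1 \<in> carrier (FZ G)" using mem(1) by (rule letter_in_FZ)
  have pow: "letter G g r = letter G g 1 [^]\<^bsub>FZ G\<^esub> k"
    using g1 mem(1) unfolding FZ_def
    by (simp add: group.int_pow_subgroup_generated[OF group_real_free_product] letter_int_pow k)
  have gr: "letter G g r \<in> carrier (FZ G)" unfolding pow using g1 by simp
  have "proj G (letter G g r) = g [^] k"
    unfolding pow using proj.hom_int_pow[OF g1] proj_letter[OF mem(1)] by simp
  moreover have "word_rel (carrier G) `` {a # u} = letter G g r \<otimes>\<^bsub>FR G\<^esub> word_rel (carrier G) `` {u}"
    using mem a by (simp add: letter_def mult_word_class)
  ultimately show ?case
    using Cons.IH[OF mem(2,3)] gr proj.G.m_closed[OF gr] proj_mult[OF gr] k a by simp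
qed

text \<open>The infimum in \<open>\<parallel>x\<parallel>\<close> runs over representations with real exponents and conjugators outside
  \<open>F(G)\<close>, to which \<open>\<pi>\<close> does not apply; but each of them cancels a fixed integral word for \<open>x\<close> at
  its cost.\<close>

lemma norm_proj_le:
  assumes "x \<in> carrier (FZ G)"
  shows "nm (proj G x) \<le> FR_norm G nm x"
proof -
  obtain u where u: "u \<in> words (carrier G)" "integral_word u" "x = word_rel (carrier G) `` {u}"
    using assms by (rule FZ_integral_word)
  show ?thesis
  proof (rule FR_norm_greatest[OF FZ_subset_FR[OF assms]])
    fix c assume "FR_cost G nm x c"
    from FR_cost_cancels[OF norm_nonneg this u(1,3)] obtain v where
      "same_letters u v" "normal_form v = []" "change_cost nm u v \<le> c"
      by (auto simp: cancels_def)
    then show "nm (proj G x) \<le> c"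
      using norm_word_value_le_change_cost[OF u(1,2)] integral_word_in_FZ[OF u(1,2)] u(3) by force
  qed
qed

text \<open>Rounding moves each exponent by less than \<open>1\<close>, whatever the factor \<open>t\<close>. So the sum of the norms
  of the letters of one word for \<open>x\<close> serves as a bound for all \<open>t\<close>.\<close>

lemma scale_near_FZ:
  assumes "x \<in> carrier (FR G)"
  shows "\<exists>K\<ge>0. \<forall>t. \<exists>z\<in>carrier (FZ G). norm_dist (FR G) (FR_norm G nm) (scale G t x) z \<le> K"
proof -
  obtain u where u: "u \<in> words (carrier G)" "x = word_rel (carrier G) `` {u}"
    using assms by (rule carrier_real_free_productE)
  have mem: "fst a \<in> carrier G" if "a \<in> set u" for a using u(1) that by (auto simp: lists_eq_set)
  define K where "K = (\<Sum>a\<leftarrow>u. nm (fst a))"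
  have "0 \<le> K" unfolding K_def using mem by (intro sum_list_nonneg) (auto simp: norm_nonneg)
  moreover have "\<exists>z\<in>carrier (FZ G). norm_dist (FR G) (FR_norm G nm) (scale G t x) z \<le> K" for t
  proof -
    let ?v = "map (\<lambda>a. (fst a, of_int \<lfloor>t * snd a\<rfloor>)) u"
    have v: "?v \<in> words (carrier G)" "integral_word ?v"
      using mem by (auto simp: lists_eq_set integral_word_def)
    have sc: "scale G t x = word_rel (carrier G) `` {map (\<lambda>a. (fst a, t * snd a)) u}"
      using u scale_word_class[OF u(1), of t] by (simp add: case_prod_unfold)
    have "norm_dist (FR G) (FR_norm G nm) (scale G t x) (word_rel (carrier G) `` {?v})
        \<le> (\<Sum>a\<leftarrow>u. \<bar>t * snd a - of_int \<lfloor>t * snd a\<rfloor>\<bar> * nm (fst a))"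
      unfolding sc using mem by (rule FR_dist_words_le)
    also have "\<dots> \<le> K"
      unfolding K_def
    proof (rule sum_list_mono)
      fix a assume a: "a \<in> set u"
      have "\<bar>t * snd a - of_int \<lfloor>t * snd a\<rfloor>\<bar> \<le> 1" by linarith
      from mult_right_mono[OF this norm_nonneg[OF mem[OF a]]]
      show "\<bar>t * snd a - of_int \<lfloor>t * snd a\<rfloor>\<bar> * nm (fst a) \<le> nm (fst a)" by simp
    qed
    finally show ?thesis using integral_word_in_FZ[OF v] by blast
  qed
  ultimately show ?thesis by blast
qed

end

section \<open>Limits along a scaling set\<close>

abbreviation along :: "real set \<Rightarrow> real filter"
  where "along T \<equiv> inf at_top (principal T)"

lemma eventually_along: "eventually P (along T) \<longleftrightarrow> (\<exists>t\<^sub>0. \<forall>t\<in>T. t\<^sub>0 \<le> t \<longrightarrow> P t)"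
  by (auto simp: eventually_inf_principal eventually_at_top_linorder)

lemma eventually_along_mem: "\<forall>\<^sub>F t in along T. t \<in> T"
  by (auto simp: eventually_along)

lemma scaling_set_pos: "scaling_set T \<Longrightarrow> t \<in> T \<Longrightarrow> 0 < t"
  by (auto simp: scaling_set_def)

lemma scaling_set_unbounded: "scaling_set T \<Longrightarrow> \<exists>t\<in>T. b \<le> t"
  unfolding scaling_set_def bdd_above_def by (meson linear)

lemma along_neq_bot: "scaling_set T \<Longrightarrow> along T \<noteq> bot"
  using scaling_set_unbounded unfolding trivial_limit_def eventually_along by blast

lemma along_mono: "T \<subseteq> T' \<Longrightarrow> along T \<le> along T'"
  by (intro inf_mono) auto

lemma scaling_set_UNIV: "scaling_set {0<..}"
proof -
  have "\<not> bdd_above {0::real<..}"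
  proof
    assume "bdd_above {0::real<..}"
    then obtain b where b: "\<And>t::real. 0 < t \<Longrightarrow> t \<le> b" by (auto simp: bdd_above_def)
    have "\<bar>b\<bar> + 1 \<le> b" by (rule b) simp
    then show False by linarith
  qed
  then show ?thesis by (simp add: scaling_set_def)
qed

text \<open>A limit of the values at a sequence in \<open>T\<close> that tends to infinity is the limit along \<open>T\<close>.\<close>

lemma convergent_along_of_Cauchy:
  fixes f :: "real \<Rightarrow> real"
  assumes T: "scaling_set T"
    and Cauchy: "\<And>\<epsilon>. 0 < \<epsilon> \<Longrightarrow> \<exists>t\<^sub>0. \<forall>t\<in>T. \<forall>t'\<in>T. t\<^sub>0 \<le> t \<longrightarrow> t\<^sub>0 \<le> t' \<longrightarrow> \<bar>f t - f t'\<bar> < \<epsilon>"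
  shows "\<exists>L. (f \<longlongrightarrow> L) (along T)"
proof -
  have "\<forall>n::nat. \<exists>t. t \<in> T \<and> real n \<le> t" using scaling_set_unbounded[OF T] by blast
  then obtain x where x: "\<And>n. x n \<in> T" "\<And>n. real n \<le> x n" by metis
  have "Cauchy (\<lambda>n. f (x n))"
  proof (rule metric_CauchyI)
    fix \<epsilon> :: real assume "0 < \<epsilon>"
    from Cauchy[OF this] obtain t\<^sub>0 where
      t\<^sub>0: "\<And>t t'. t \<in> T \<Longrightarrow> t' \<in> T \<Longrightarrow> t\<^sub>0 \<le> t \<Longrightarrow> t\<^sub>0 \<le> t' \<Longrightarrow> \<bar>f t - f t'\<bar> < \<epsilon>"
      by blast
    obtain M :: nat where M: "t\<^sub>0 \<le> real M" using real_arch_simple by blast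
    have "t\<^sub>0 \<le> x n" if "M \<le> n" for n
      using M x(2)[of n] that by (meson of_nat_mono order_trans)
    then show "\<exists>M. \<forall>m\<ge>M. \<forall>n\<ge>M. dist (f (x m)) (f (x n)) < \<epsilon>"
      using t\<^sub>0 x(1) by (intro exI[of _ M]) (simp add: dist_real_def)
  qed
  then obtain L where L: "(\<lambda>n. f (x n)) \<longlonglongrightarrow> L"
    using Cauchy_convergent convergent_def by blast
  have "(f \<longlongrightarrow> L) (along T)"
  proof (rule tendstoI)
    fix \<epsilon> :: real assume "0 < \<epsilon>"
    then have "0 < \<epsilon> / 2" by simp
    from Cauchy[OF this] obtain t\<^sub>0 where
      t\<^sub>0: "\<And>t t'. t \<in> T \<Longrightarrow> t' \<in> T \<Longrightarrow> t\<^sub>0 \<le> t \<Longrightarrow> t\<^sub>0 \<le> t' \<Longrightarrow> \<bar>f t - f t'\<bar> < \<epsilon> / 2"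
      by blast
    obtain M where M: "\<And>n. M \<le> n \<Longrightarrow> \<bar>f (x n) - L\<bar> < \<epsilon> / 2"
      using LIMSEQ_D[OF L \<open>0 < \<epsilon> / 2\<close>] by (auto simp: real_norm_def)
    obtain k :: nat where k: "t\<^sub>0 \<le> real k" using real_arch_simple by blast
    define n where "n = max M k"
    have n: "M \<le> n" "t\<^sub>0 \<le> x n" using k x(2)[of n] unfolding n_def by (simp, linarith)
    have "\<bar>f t - L\<bar> < \<epsilon>" if "t \<in> T" "t\<^sub>0 \<le> t" for t
      using t\<^sub>0[OF that(1) x(1) that(2) n(2)] M[OF n(1)] by linarith
    then show "\<forall>\<^sub>F t in along T. dist (f t) L < \<epsilon>"
      unfolding eventually_along dist_real_def by blast
  qed
  then show ?thesis by blast
qed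

section \<open>The groups \<open>\<D>(G,T)\<close> and \<open>\<C>(G,T)\<close>\<close>

context conj_invariant_normed_group
begin

abbreviation FR_dist where "FR_dist \<equiv> norm_dist (FR G) (FR_norm G nm)"

lemma FR_dist_scale:
  assumes "x \<in> carrier (FR G)" "y \<in> carrier (FR G)" "0 < t"
  shows "FR_dist (scale G t x) (scale G t y) = t * FR_dist x y"
proof -
  interpret s: group_hom "FR G" "FR G" "scale G t"
    by (intro group_hom.intro group_hom_axioms.intro group_real_free_product scale_hom)
  have eq: "inv\<^bsub>FR G\<^esub> scale G t x \<otimes>\<^bsub>FR G\<^esub> scale G t y = scale G t (inv\<^bsub>FR G\<^esub> x \<otimes>\<^bsub>FR G\<^esub> y)"
    using assms by simp
  have "inv\<^bsub>FR G\<^esub> x \<otimes>\<^bsub>FR G\<^esub> y \<in> carrier (FR G)" using assms by simp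
  then show ?thesis unfolding norm_dist_def eq using assms(3) by (rule FR_norm_scale)
qed

lemma carrier_dir_group:
  "carrier (dir_group G nm T)
    = {w \<in> T \<rightarrow>\<^sub>E carrier (FZ G). Cauchy_on (FR G) (FR_norm G nm) T (rescaled G w)}"
  by (simp add: dir_group_def)

lemma dir_group_eq:
  "dir_group G nm T = (product_group T (\<lambda>_. FZ G))\<lparr>carrier := carrier (dir_group G nm T)\<rparr>"
  by (simp add: dir_group_def)

lemma dir_group_mem: "w \<in> carrier (dir_group G nm T) \<Longrightarrow> t \<in> T \<Longrightarrow> w t \<in> carrier (FZ G)"
  by (auto simp: carrier_dir_group)

lemma rescaled_closed: "w t \<in> carrier (FR G) \<Longrightarrow> rescaled G w t \<in> carrier (FR G)"
  by (simp add: rescaled_def scale_closed)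

lemma FR_norm_rescaled: "w t \<in> carrier (FR G) \<Longrightarrow> 0 < t \<Longrightarrow> FR_norm G nm (rescaled G w t) = FR_norm G nm (w t) / t"
  by (simp add: rescaled_def FR_norm_scale)

lemma subgroup_dir_group:
  "subgroup (carrier (dir_group G nm T)) (product_group T (\<lambda>_. FZ G))"
proof -
  interpret FR: conj_invariant_pseudonormed_group "FR G" "FR_norm G nm" by (rule FR_pseudonormed)
  interpret FZ: group "FZ G" by (rule group_FZ)
  let ?P = "product_group T (\<lambda>_. FZ G)"
  interpret P: group ?P by (simp add: group_FZ)
  interpret s: group_hom "FR G" "FR G" "scale G t" for t
    by (intro group_hom.intro group_hom_axioms.intro group_real_free_product scale_hom)
  note memD = dir_group_mem[THEN FZ_subset_FR]
  show ?thesis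
  proof (rule P.subgroupI)
    show "carrier (dir_group G nm T) \<subseteq> carrier ?P" by (auto simp: carrier_dir_group)
    have "(\<lambda>t\<in>T. \<one>\<^bsub>FR G\<^esub>) \<in> carrier (dir_group G nm T)"
      unfolding carrier_dir_group Cauchy_on_def using FZ.one_closed
      by (auto simp: rescaled_def FR.dist_self)
    then show "carrier (dir_group G nm T) \<noteq> {}" by blast
  next
    fix w assume w: "w \<in> carrier (dir_group G nm T)"
    have inv: "inv\<^bsub>?P\<^esub> w = (\<lambda>t\<in>T. inv\<^bsub>FZ G\<^esub> w t)"
      using w by (auto simp: carrier_dir_group group_FZ)
    have "FR_dist (rescaled G (inv\<^bsub>?P\<^esub> w) t) (rescaled G (inv\<^bsub>?P\<^esub> w) t') = FR_dist (rescaled G w t) (rescaled G w t')"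
      if "t \<in> T" "t' \<in> T" for t t'
    proof -
      have *: "rescaled G (inv\<^bsub>?P\<^esub> w) s = inv\<^bsub>FR G\<^esub> rescaled G w s" if "s \<in> T" for s
        using memD[OF w that] dir_group_mem[OF w that] that by (simp add: inv rescaled_def inv_FZ)
      show ?thesis
        using that memD[OF w] by (simp only: *) (rule FR.dist_inv; simp add: rescaled_closed)
    qed
    then show "inv\<^bsub>?P\<^esub> w \<in> carrier (dir_group G nm T)"
      using w dir_group_mem[OF w] unfolding carrier_dir_group Cauchy_on_def by (simp add: inv)
  next
    fix v w assume v: "v \<in> carrier (dir_group G nm T)" and w: "w \<in> carrier (dir_group G nm T)"
    let ?vw = "v \<otimes>\<^bsub>?P\<^esub> w"
    have *: "FR_dist (rescaled G ?vw t) (rescaled G ?vw t')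
        \<le> FR_dist (rescaled G v t) (rescaled G v t') + FR_dist (rescaled G w t) (rescaled G w t')"
      if "t \<in> T" "t' \<in> T" for t t'
    proof -
      have "rescaled G ?vw s = rescaled G v s \<otimes>\<^bsub>FR G\<^esub> rescaled G w s" if "s \<in> T" for s
        using memD[OF v that] memD[OF w that] that by (simp add: rescaled_def)
      then show ?thesis
        using that memD[OF v] memD[OF w] by (simp only:) (rule FR.dist_mult; simp add: rescaled_closed)
    qed
    have "Cauchy_on (FR G) (FR_norm G nm) T (rescaled G ?vw)"
      unfolding Cauchy_on_def
    proof (intro allI impI)
      fix \<epsilon> :: real assume "0 < \<epsilon>"
      then have e: "0 < \<epsilon> / 2" by simp
      obtain t1 where t1: "\<forall>t\<in>T. \<forall>t'\<in>T. t \<ge> t1 \<longrightarrow> t' \<ge> t1 \<longrightarrow> FR_dist (rescaled G v t) (rescaled G v t') < \<epsilon> / 2"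
        using v e unfolding carrier_dir_group Cauchy_on_def by blast
      obtain t2 where t2: "\<forall>t\<in>T. \<forall>t'\<in>T. t \<ge> t2 \<longrightarrow> t' \<ge> t2 \<longrightarrow> FR_dist (rescaled G w t) (rescaled G w t') < \<epsilon> / 2"
        using w e unfolding carrier_dir_group Cauchy_on_def by blast
      have "FR_dist (rescaled G ?vw t) (rescaled G ?vw t') < \<epsilon>"
        if "t \<in> T" "t' \<in> T" "t \<ge> max t1 t2" "t' \<ge> max t1 t2" for t t'
      proof -
        have "FR_dist (rescaled G v t) (rescaled G v t') < \<epsilon> / 2"
          "FR_dist (rescaled G w t) (rescaled G w t') < \<epsilon> / 2"
          using t1 t2 that by auto
        then show ?thesis using *[OF that(1,2)] by linarith
      qed
      then show "\<exists>t\<^sub>0. \<forall>t\<in>T. \<forall>t'\<in>T. t \<ge> t\<^sub>0 \<longrightarrow> t' \<ge> t\<^sub>0 \<longrightarrow> FR_dist (rescaled G ?vw t) (rescaled G ?vw t') < \<epsilon>"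
        by blast
    qed
    moreover have "?vw \<in> T \<rightarrow>\<^sub>E carrier (FZ G)"
      using dir_group_mem[OF v] dir_group_mem[OF w] FZ.m_closed by auto
    ultimately show "?vw \<in> carrier (dir_group G nm T)" unfolding carrier_dir_group by blast
  qed
qed

lemma dir_norm_eqI:
  assumes T: "scaling_set T" and w: "w \<in> carrier (dir_group G nm T)"
    and L: "((\<lambda>t. FR_norm G nm (w t) / t) \<longlongrightarrow> L) (along T)"
  shows "dir_norm G nm T w = L"
  unfolding dir_norm_def
proof (rule tendsto_Lim[OF along_neq_bot[OF T]])
  have "\<forall>\<^sub>F t in along T. FR_norm G nm (w t) / t = FR_norm G nm (rescaled G w t)"
    using eventually_along_mem
    by eventually_elim (simp add: FR_norm_rescaled FZ_subset_FR[OF dir_group_mem[OF w]] scaling_set_pos[OF T])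
  with L show "((\<lambda>t. FR_norm G nm (rescaled G w t)) \<longlongrightarrow> L) (along T)"
    by (rule Lim_transform_eventually)
qed

lemma tendsto_dir_norm:
  assumes T: "scaling_set T" and w: "w \<in> carrier (dir_group G nm T)"
  shows "((\<lambda>t. FR_norm G nm (w t) / t) \<longlongrightarrow> dir_norm G nm T w) (along T)"
proof -
  interpret FR: conj_invariant_pseudonormed_group "FR G" "FR_norm G nm" by (rule FR_pseudonormed)
  have mem: "w t \<in> carrier (FR G)" if "t \<in> T" for t using FZ_subset_FR[OF dir_group_mem[OF w that]] .
  have "\<exists>L. ((\<lambda>t. FR_norm G nm (w t) / t) \<longlongrightarrow> L) (along T)"
  proof (rule convergent_along_of_Cauchy[OF T])
    fix \<epsilon> :: real assume "0 < \<epsilon>"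
    then obtain t\<^sub>0 where t\<^sub>0: "\<forall>t\<in>T. \<forall>t'\<in>T. t \<ge> t\<^sub>0 \<longrightarrow> t' \<ge> t\<^sub>0 \<longrightarrow> FR_dist (rescaled G w t) (rescaled G w t') < \<epsilon>"
      using w unfolding carrier_dir_group Cauchy_on_def by blast
    have "\<bar>FR_norm G nm (w t) / t - FR_norm G nm (w t') / t'\<bar> < \<epsilon>"
      if "t \<in> T" "t' \<in> T" "t\<^sub>0 \<le> t" "t\<^sub>0 \<le> t'" for t t'
    proof -
      have "\<bar>FR_norm G nm (rescaled G w t) - FR_norm G nm (rescaled G w t')\<bar>
          \<le> FR_dist (rescaled G w t) (rescaled G w t')"
        using that mem by (intro FR.norm_diff_le_dist rescaled_closed)
      moreover have "FR_dist (rescaled G w t) (rescaled G w t') < \<epsilon>" using t\<^sub>0 that by blast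
      ultimately show ?thesis
        using that mem by (simp add: FR_norm_rescaled scaling_set_pos[OF T])
    qed
    then show "\<exists>t\<^sub>0. \<forall>t\<in>T. \<forall>t'\<in>T. t\<^sub>0 \<le> t \<longrightarrow> t\<^sub>0 \<le> t' \<longrightarrow>
        \<bar>FR_norm G nm (w t) / t - FR_norm G nm (w t') / t'\<bar> < \<epsilon>" by blast
  qed
  then show ?thesis using dir_norm_eqI[OF T w] by blast
qed

lemma dir_pseudonormed:
  assumes T: "scaling_set T"
  shows "conj_invariant_pseudonormed_group (dir_group G nm T) (dir_norm G nm T)"
  by (subst dir_group_eq) (rule conj_invariant_pseudonormed_group.limit_pseudonorm[OF FZ_pseudonormed subgroup_dir_group
        along_neq_bot[OF T] eventually_along_mem scaling_set_pos[OF T] tendsto_dir_norm[OF T]])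

lemma mult_dir_group [simp]: "v \<otimes>\<^bsub>dir_group G nm T\<^esub> w = (\<lambda>t\<in>T. v t \<otimes>\<^bsub>FR G\<^esub> w t)"
  by (simp add: dir_group_def)

lemma mult_precone [simp]: "g \<otimes>\<^bsub>precone G nm T\<^esub> h = (\<lambda>t\<in>T. g t \<otimes> h t)"
  by (simp add: precone_def)

lemma one_precone [simp]: "\<one>\<^bsub>precone G nm T\<^esub> = (\<lambda>t\<in>T. \<one>)"
  by (simp add: precone_def)

lemma carrier_precone: "carrier (precone G nm T) = proj_on G T ` carrier (dir_group G nm T)"
  by (simp add: precone_def)

lemma precone_eq:
  "precone G nm T = (product_group T (\<lambda>_. G))\<lparr>carrier := carrier (precone G nm T)\<rparr>"
  by (simp add: precone_def)

lemma subgroup_precone: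
  assumes T: "scaling_set T"
  shows "subgroup (carrier (precone G nm T)) (product_group T (\<lambda>_. G))"
proof -
  interpret D: conj_invariant_pseudonormed_group "dir_group G nm T" "dir_norm G nm T"
    by (rule dir_pseudonormed[OF T])
  have "group_hom (dir_group G nm T) (product_group T (\<lambda>_. G)) (proj_on G T)"
  proof (intro group_hom.intro group_hom_axioms.intro homI)
    show "proj_on G T w \<in> carrier (product_group T (\<lambda>_. G))" if "w \<in> carrier (dir_group G nm T)" for w
      using dir_group_mem[OF that] by (simp add: proj_on_def proj_closed)
    show "proj_on G T (v \<otimes>\<^bsub>dir_group G nm T\<^esub> w) = proj_on G T v \<otimes>\<^bsub>product_group T (\<lambda>_. G)\<^esub> proj_on G T w"
      if "v \<in> carrier (dir_group G nm T)" "w \<in> carrier (dir_group G nm T)" for v w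
      using dir_group_mem[OF that(1)] dir_group_mem[OF that(2)]
      by (auto simp: proj_on_def proj_mult)
  qed (simp_all add: D.is_group is_group)
  then show ?thesis unfolding carrier_precone by (rule group_hom.img_is_subgroup)
qed

lemma group_precone: "scaling_set T \<Longrightarrow> group (precone G nm T)"
  by (subst precone_eq) (simp add: group.subgroup_imp_group[OF _ subgroup_precone] is_group)

lemma precone_subset: "g \<in> carrier (precone G nm T) \<Longrightarrow> g \<in> T \<rightarrow>\<^sub>E carrier G"
  unfolding carrier_precone by (auto simp: proj_on_def proj_closed dir_group_mem)

lemma precone_mem: "g \<in> carrier (precone G nm T) \<Longrightarrow> t \<in> T \<Longrightarrow> g t \<in> carrier G"
  using precone_subset by blast

lemma proj_on_hom:
  assumes "scaling_set T"
  shows "proj_on G T \<in> hom (dir_group G nm T) (precone G nm T)"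
proof (rule homI)
  show "proj_on G T w \<in> carrier (precone G nm T)" if "w \<in> carrier (dir_group G nm T)" for w
    using that unfolding carrier_precone by blast
  show "proj_on G T (v \<otimes>\<^bsub>dir_group G nm T\<^esub> w) = proj_on G T v \<otimes>\<^bsub>precone G nm T\<^esub> proj_on G T w"
    if "v \<in> carrier (dir_group G nm T)" "w \<in> carrier (dir_group G nm T)" for v w
    using dir_group_mem[OF that(1)] dir_group_mem[OF that(2)]
    by (auto simp: proj_on_def proj_mult)
qed

lemma precone_pseudonormed:
  assumes T: "scaling_set T"
  shows "conj_invariant_pseudonormed_group (precone G nm T) (precone_norm G nm T)"
proof -
  have "precone_norm G nm T
      = (\<lambda>g. Inf {dir_norm G nm T w | w. w \<in> carrier (dir_group G nm T) \<and> proj_on G T w = g})"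
    by (simp add: precone_norm_def fun_eq_iff)
  then show ?thesis
    using conj_invariant_pseudonormed_group.quotient_pseudonorm[OF dir_pseudonormed[OF T]
        group_precone[OF T] proj_on_hom[OF T] carrier_precone[symmetric]]
    by simp
qed

lemma precone_norm_le:
  assumes T: "scaling_set T" and w: "w \<in> carrier (dir_group G nm T)"
  shows "precone_norm G nm T (proj_on G T w) \<le> dir_norm G nm T w"
  unfolding precone_norm_def
proof (rule cInf_lower)
  show "bdd_below {dir_norm G nm T v | v. v \<in> carrier (dir_group G nm T) \<and> proj_on G T v = proj_on G T w}"
    using conj_invariant_pseudonormed_group.nonneg[OF dir_pseudonormed[OF T]]
    by (intro bdd_belowI[of _ 0]) auto
qed (use w in auto)

lemma precone_norm_greatest:
  assumes "g \<in> carrier (precone G nm T)"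
    and "\<And>w. w \<in> carrier (dir_group G nm T) \<Longrightarrow> proj_on G T w = g \<Longrightarrow> b \<le> dir_norm G nm T w"
  shows "b \<le> precone_norm G nm T g"
  unfolding precone_norm_def
proof (rule cInf_greatest)
  show "{dir_norm G nm T w | w. w \<in> carrier (dir_group G nm T) \<and> proj_on G T w = g} \<noteq> {}"
    using assms(1) unfolding carrier_precone by blast
qed (use assms(2) in blast)

subsection \<open>Elements of pseudonorm zero\<close>

text \<open>Since \<open>\<pi>\<close> is Lipschitz with constant \<open>1\<close>, the pseudonorm of any lift of \<open>g\<close> bounds the growth
  of \<open>g\<close> from above.\<close>

lemma eventually_norm_less_precone_norm:
  assumes T: "scaling_set T" and g: "g \<in> carrier (precone G nm T)" and c: "precone_norm G nm T g < c"
  shows "\<forall>\<^sub>F t in along T. nm (g t) / t < c"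
proof -
  obtain w where w: "w \<in> carrier (dir_group G nm T)" "proj_on G T w = g" "dir_norm G nm T w < c"
    using precone_norm_greatest[OF g, of c] c by (meson not_le)
  have "\<forall>\<^sub>F t in along T. FR_norm G nm (w t) / t < c"
    using tendsto_dir_norm[OF T w(1)] w(3) by (rule order_tendstoD)
  then show ?thesis
    using eventually_along_mem
  proof eventually_elim
    case (elim t)
    have "nm (g t) \<le> FR_norm G nm (w t)"
      using norm_proj_le[OF dir_group_mem[OF w(1) elim(2)]] w(2) elim(2) by (auto simp: proj_on_def)
    then have "nm (g t) / t \<le> FR_norm G nm (w t) / t"
      using scaling_set_pos[OF T elim(2)] by (simp add: divide_right_mono)
    then show ?case using elim(1) by simp
  qed
qed

text \<open>A sublinear \<open>g\<close> has a lift of norm \<open>0\<close>, which sends \<open>t\<close> to the generator named \<open>g(t)\<close>; the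
  converse is the previous lemma. In this criterion no trace of the free product
  remains, and the values of \<open>g\<close> on a smaller scaling set can be compared directly.\<close>

lemma precone_norm_eq_0_iff:
  assumes T: "scaling_set T" and g: "g \<in> carrier (precone G nm T)"
  shows "precone_norm G nm T g = 0 \<longleftrightarrow> ((\<lambda>t. nm (g t) / t) \<longlongrightarrow> 0) (along T)"
proof
  assume *: "precone_norm G nm T g = 0"
  show "((\<lambda>t. nm (g t) / t) \<longlongrightarrow> 0) (along T)"
  proof (rule tendstoI)
    fix \<epsilon> :: real assume "0 < \<epsilon>"
    then have "\<forall>\<^sub>F t in along T. nm (g t) / t < \<epsilon>"
      using eventually_norm_less_precone_norm[OF T g, of \<epsilon>] * by simp
    then show "\<forall>\<^sub>F t in along T. Real_Vector_Spaces.dist (nm (g t) / t) 0 < \<epsilon>"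
      using eventually_along_mem
    proof eventually_elim
      case (elim t)
      have "0 \<le> nm (g t) / t"
        using norm_nonneg[OF precone_mem[OF g elim(2)]] scaling_set_pos[OF T elim(2)] by simp
      then show ?case using elim(1) by (simp add: dist_real_def)
    qed
  qed
next
  interpret FR: conj_invariant_pseudonormed_group "FR G" "FR_norm G nm" by (rule FR_pseudonormed)
  interpret C: conj_invariant_pseudonormed_group "precone G nm T" "precone_norm G nm T"
    by (rule precone_pseudonormed[OF T])
  assume lim: "((\<lambda>t. nm (g t) / t) \<longlongrightarrow> 0) (along T)"
  define w where "w = (\<lambda>t\<in>T. letter G (g t) 1)"
  have mem: "w t \<in> carrier (FZ G)" if "t \<in> T" for t
    using letter_in_FZ[OF precone_mem[OF g that]] that by (simp add: w_def)
  note mem' = FZ_subset_FR[OF mem]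
  have le: "FR_norm G nm (w t) / t \<le> nm (g t) / t" "0 \<le> FR_norm G nm (w t) / t" if "t \<in> T" for t
    using FR_norm_letter[OF precone_mem[OF g that], of 1] FR.nonneg[OF mem'[OF that]]
      scaling_set_pos[OF T that] that by (auto simp: w_def divide_right_mono)
  have lim0: "((\<lambda>t. FR_norm G nm (w t) / t) \<longlongrightarrow> 0) (along T)"
    by (rule tendsto_sandwich[OF _ _ tendsto_const lim])
      (use eventually_along_mem[of T] in \<open>auto elim!: eventually_mono simp: le\<close>)
  have "Cauchy_on (FR G) (FR_norm G nm) T (rescaled G w)"
    unfolding Cauchy_on_def
  proof (intro allI impI)
    fix \<epsilon> :: real assume "0 < \<epsilon>"
    then have "\<forall>\<^sub>F t in along T. FR_norm G nm (w t) / t < \<epsilon> / 2"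
      using order_tendstoD(2)[OF lim0, of "\<epsilon> / 2"] by simp
    then obtain t\<^sub>0 where t\<^sub>0: "\<And>t. t \<in> T \<Longrightarrow> t\<^sub>0 \<le> t \<Longrightarrow> FR_norm G nm (w t) / t < \<epsilon> / 2"
      unfolding eventually_along by blast
    have "FR_dist (rescaled G w t) (rescaled G w t') < \<epsilon>"
      if "t \<in> T" "t' \<in> T" "t\<^sub>0 \<le> t" "t\<^sub>0 \<le> t'" for t t'
    proof -
      have "FR_dist (rescaled G w t) (rescaled G w t')
          \<le> FR_norm G nm (rescaled G w t) + FR_norm G nm (rescaled G w t')"
        using FR.mult[of "inv\<^bsub>FR G\<^esub> rescaled G w t" "rescaled G w t'"] that mem'
        by (simp add: norm_dist_def FR.inverse rescaled_closed)
      also have "\<dots> = FR_norm G nm (w t) / t + FR_norm G nm (w t') / t'"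
        using that mem' by (simp add: FR_norm_rescaled scaling_set_pos[OF T])
      finally show ?thesis using t\<^sub>0[OF that(1,3)] t\<^sub>0[OF that(2,4)] by linarith
    qed
    then show "\<exists>t\<^sub>0. \<forall>t\<in>T. \<forall>t'\<in>T. t \<ge> t\<^sub>0 \<longrightarrow> t' \<ge> t\<^sub>0 \<longrightarrow> FR_dist (rescaled G w t) (rescaled G w t') < \<epsilon>"
      by blast
  qed
  then have w: "w \<in> carrier (dir_group G nm T)"
    unfolding carrier_dir_group using mem by (simp add: w_def)
  have "proj_on G T w t = g t" for t
    using precone_subset[OF g] precone_mem[OF g] proj_letter
    by (cases "t \<in> T") (auto simp: proj_on_def w_def PiE_def extensional_def)
  then have "proj_on G T w = g" by (rule ext)
  then show "precone_norm G nm T g = 0"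
    using precone_norm_le[OF T w] dir_norm_eqI[OF T w lim0] C.nonneg[OF g] by simp
qed

section \<open>Restriction and extension between scaling sets\<close>

lemma restrict_dir_group:
  assumes T: "scaling_set T" "scaling_set T'" "T \<subseteq> T'" and w: "w \<in> carrier (dir_group G nm T')"
  shows "restrict w T \<in> carrier (dir_group G nm T)"
    and "dir_norm G nm T (restrict w T) = dir_norm G nm T' w"
proof -
  have eq: "rescaled G (restrict w T) t = rescaled G w t" if "t \<in> T" for t
    using that by (simp add: rescaled_def)
  have "Cauchy_on (FR G) (FR_norm G nm) T (rescaled G (restrict w T))"
    unfolding Cauchy_on_def
  proof (intro allI impI)
    fix \<epsilon> :: real assume "0 < \<epsilon>"
    then obtain t\<^sub>0 where "\<forall>t\<in>T'. \<forall>t'\<in>T'. t \<ge> t\<^sub>0 \<longrightarrow> t' \<ge> t\<^sub>0 \<longrightarrow> FR_dist (rescaled G w t) (rescaled G w t') < \<epsilon>"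
      using w unfolding carrier_dir_group Cauchy_on_def by blast
    then show "\<exists>t\<^sub>0. \<forall>t\<in>T. \<forall>t'\<in>T. t \<ge> t\<^sub>0 \<longrightarrow> t' \<ge> t\<^sub>0 \<longrightarrow>
        FR_dist (rescaled G (restrict w T) t) (rescaled G (restrict w T) t') < \<epsilon>"
      using T(3) by (intro exI[of _ t\<^sub>0]) (auto simp: eq)
  qed
  then show r: "restrict w T \<in> carrier (dir_group G nm T)"
    unfolding carrier_dir_group using dir_group_mem[OF w] T(3) by auto
  have "((\<lambda>t. FR_norm G nm (w t) / t) \<longlongrightarrow> dir_norm G nm T' w) (along T)"
    using tendsto_dir_norm[OF T(2) w] along_mono[OF T(3)] tendsto_mono by blast
  then have "((\<lambda>t. FR_norm G nm (restrict w T t) / t) \<longlongrightarrow> dir_norm G nm T' w) (along T)"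
    by (rule Lim_transform_eventually) (use eventually_along_mem[of T] in \<open>auto elim!: eventually_mono\<close>)
  then show "dir_norm G nm T (restrict w T) = dir_norm G nm T' w" by (rule dir_norm_eqI[OF T(1) r])
qed

lemma restrict_proj_on: "T \<subseteq> T' \<Longrightarrow> restrict (proj_on G T' w) T = proj_on G T (restrict w T)"
  by (auto simp: proj_on_def fun_eq_iff)

lemma restrict_precone:
  assumes "scaling_set T" "scaling_set T'" "T \<subseteq> T'" "g \<in> carrier (precone G nm T')"
  shows "restrict g T \<in> carrier (precone G nm T)"
  using assms(4) restrict_dir_group(1)[OF assms(1-3)] restrict_proj_on[OF assms(3)]
  unfolding carrier_precone by auto

text \<open>At \<open>t' \<in> T' - T\<close> take the value \<open>w(\<sigma>)\<close> at some
  \<open>\<sigma> \<in> T\<close>, scale it by \<open>t'/\<sigma>\<close> and round the exponents. After division by \<open>t'\<close> the rounding error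
  is \<open>K(\<sigma>)/t'\<close>, where \<open>K(\<sigma>)\<close> depends on \<open>w(\<sigma>)\<close> only. So \<open>\<sigma>\<close> must tend to infinity with \<open>t'\<close>, but so
  slowly that \<open>K(\<sigma>)/t'\<close> tends to \<open>0\<close>.\<close>

lemma extend_dir_group:
  assumes T: "scaling_set T" "scaling_set T'" "T \<subseteq> T'" and w: "w \<in> carrier (dir_group G nm T)"
  shows "\<exists>W\<in>carrier (dir_group G nm T'). restrict W T = w"
proof -
  interpret FR: conj_invariant_pseudonormed_group "FR G" "FR_norm G nm" by (rule FR_pseudonormed)
  have mem: "w t \<in> carrier (FR G)" if "t \<in> T" for t using FZ_subset_FR[OF dir_group_mem[OF w that]] .
  have "\<forall>t\<in>T. \<exists>K. 0 \<le> K \<and> (\<forall>s. \<exists>z\<in>carrier (FZ G). FR_dist (scale G s (w t)) z \<le> K)"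
    using scale_near_FZ[OF mem] by blast
  then obtain K where K: "\<And>t. t \<in> T \<Longrightarrow> 0 \<le> K t"
    "\<And>t s. t \<in> T \<Longrightarrow> \<exists>z\<in>carrier (FZ G). FR_dist (scale G s (w t)) z \<le> K t"
    by metis
  have "\<forall>n::nat. \<exists>t. t \<in> T \<and> real n \<le> t" using scaling_set_unbounded[OF T(1)] by blast
  then obtain x where x: "\<And>n. x n \<in> T" "\<And>n. real n \<le> x n" by metis
  define A where "A t = {n. real n \<le> t \<and> real n * K (x n) \<le> t}" for t
  define N where "N t = Max (A t)" for t
  have finite_A: "finite (A t)" for t
  proof (rule finite_subset)
    show "A t \<subseteq> {..nat \<lfloor>t\<rfloor>}" by (auto simp: A_def le_nat_floor)
  qed simp
  have N_ge: "m \<le> N t" if "m \<in> A t" for m t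
    unfolding N_def using finite_A that by (rule Max_ge)
  have N_in: "N t \<in> A t" if "0 < t" for t
    unfolding N_def using finite_A by (rule Max_in) (use that in \<open>auto simp: A_def intro: exI[of _ 0]\<close>)
  define \<sigma> where "\<sigma> t = (if t \<in> T then t else x (N t))" for t
  have \<sigma>: "\<sigma> t \<in> T" for t using x(1) by (simp add: \<sigma>_def)
  have "\<exists>z\<in>carrier (FZ G). FR_dist (scale G (t / \<sigma> t) (w (\<sigma> t))) z \<le> K (\<sigma> t)" for t
    by (rule K(2)[OF \<sigma>])
  then obtain z where z: "\<And>t. z t \<in> carrier (FZ G)"
    "\<And>t. FR_dist (scale G (t / \<sigma> t) (w (\<sigma> t))) (z t) \<le> K (\<sigma> t)"
    by metis
  define W where "W = (\<lambda>t\<in>T'. if t \<in> T then w t else z t)"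
  have W_mem: "W t \<in> carrier (FZ G)" if "t \<in> T'" for t
    using that z(1) dir_group_mem[OF w] by (simp add: W_def)
  have near: "FR_dist (rescaled G w (\<sigma> t)) (rescaled G W t) \<le> (if t \<in> T then 0 else K (\<sigma> t) / t)"
    if t: "t \<in> T'" for t
  proof (cases "t \<in> T")
    case True
    then show ?thesis
      using t FR.dist_self[OF rescaled_closed[of w t, OF mem[OF True]]] by (simp add: \<sigma>_def W_def rescaled_def)
  next
    case False
    have pos: "0 < t" "0 < \<sigma> t" using scaling_set_pos T t \<sigma> by auto
    have "rescaled G w (\<sigma> t) = scale G (1 / t) (scale G (t / \<sigma> t) (w (\<sigma> t)))"
      unfolding rescaled_def using pos mem[OF \<sigma>] by (simp add: scale_scale)
    moreover have "rescaled G W t = scale G (1 / t) (z t)"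
      using t False by (simp add: rescaled_def W_def)
    ultimately have "FR_dist (rescaled G w (\<sigma> t)) (rescaled G W t)
        = 1 / t * FR_dist (scale G (t / \<sigma> t) (w (\<sigma> t))) (z t)"
      using FR_dist_scale[of "scale G (t / \<sigma> t) (w (\<sigma> t))" "z t" "1 / t"] pos
        scale_closed[OF mem[OF \<sigma>]] FZ_subset_FR[OF z(1)] by simp
    also have "\<dots> \<le> K (\<sigma> t) / t" using z(2)[of t] pos by (simp add: divide_right_mono)
    finally show ?thesis using False by simp
  qed
  have "Cauchy_on (FR G) (FR_norm G nm) T' (rescaled G W)"
    unfolding Cauchy_on_def
  proof (intro allI impI)
    fix \<epsilon> :: real assume \<epsilon>: "0 < \<epsilon>"
    then have "0 < \<epsilon> / 3" by simp
    then obtain t\<^sub>0 where t\<^sub>0: "\<And>t t'. t \<in> T \<Longrightarrow> t' \<in> T \<Longrightarrow> t\<^sub>0 \<le> t \<Longrightarrow> t\<^sub>0 \<le> t' \<Longrightarrow>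
        FR_dist (rescaled G w t) (rescaled G w t') < \<epsilon> / 3"
      using w unfolding carrier_dir_group Cauchy_on_def by blast
    obtain m :: nat where m: "max (max t\<^sub>0 1) (4 / \<epsilon>) \<le> real m" using real_arch_simple by blast
    have "4 / \<epsilon> \<le> real m" "0 < real m" using m by auto
    then have m3: "1 / real m < \<epsilon> / 3" using \<epsilon> by (simp add: field_simps)
    define t1 where "t1 = max t\<^sub>0 (max (real m) (real m * K (x m)))"
    have *: "t\<^sub>0 \<le> \<sigma> t \<and> FR_dist (rescaled G w (\<sigma> t)) (rescaled G W t) < \<epsilon> / 3"
      if t: "t \<in> T'" "t1 \<le> t" for t
    proof (cases "t \<in> T")
      case True
      then show ?thesis using near[OF t(1)] t(2) \<epsilon> by (simp add: \<sigma>_def t1_def)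
    next
      case False
      have pos: "0 < t" using scaling_set_pos T t by auto
      have "m \<in> A t" using t(2) by (simp add: A_def t1_def)
      then have mN: "real m \<le> real (N t)" using N_ge by simp
      have "real (N t) * K (x (N t)) \<le> t" using N_in[OF pos] by (simp add: A_def)
      then have "K (\<sigma> t) / t \<le> 1 / real (N t)"
        using pos mN \<open>0 < real m\<close> False by (simp add: \<sigma>_def field_simps)
      also have "\<dots> \<le> 1 / real m" using mN \<open>0 < real m\<close> by (simp add: frac_le)
      finally have "FR_dist (rescaled G w (\<sigma> t)) (rescaled G W t) < \<epsilon> / 3"
        using near[OF t(1)] False m3 by simp
      moreover have "t\<^sub>0 \<le> \<sigma> t" using m mN x(2)[of "N t"] False by (simp add: \<sigma>_def)
      ultimately show ?thesis by simp
    qed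
    have "FR_dist (rescaled G W t) (rescaled G W t') < \<epsilon>"
      if t: "t \<in> T'" "t' \<in> T'" "t1 \<le> t" "t1 \<le> t'" for t t'
    proof -
      have cl: "rescaled G W t \<in> carrier (FR G)" "rescaled G W t' \<in> carrier (FR G)"
        "rescaled G w (\<sigma> t) \<in> carrier (FR G)" "rescaled G w (\<sigma> t') \<in> carrier (FR G)"
        using FZ_subset_FR[OF W_mem] mem[OF \<sigma>] t by (auto intro: rescaled_closed)
      have "FR_dist (rescaled G W t) (rescaled G W t')
          \<le> FR_dist (rescaled G W t) (rescaled G w (\<sigma> t)) + FR_dist (rescaled G w (\<sigma> t)) (rescaled G W t')"
        using cl by (intro FR.dist_triangle)
      moreover have "FR_dist (rescaled G w (\<sigma> t)) (rescaled G W t')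
          \<le> FR_dist (rescaled G w (\<sigma> t)) (rescaled G w (\<sigma> t')) + FR_dist (rescaled G w (\<sigma> t')) (rescaled G W t')"
        using cl by (intro FR.dist_triangle)
      moreover have "FR_dist (rescaled G W t) (rescaled G w (\<sigma> t)) = FR_dist (rescaled G w (\<sigma> t)) (rescaled G W t)"
        using cl by (intro FR.dist_commute)
      moreover have "FR_dist (rescaled G w (\<sigma> t)) (rescaled G w (\<sigma> t')) < \<epsilon> / 3"
        using *[OF t(1,3)] *[OF t(2,4)] t\<^sub>0[OF \<sigma> \<sigma>] by blast
      ultimately show ?thesis using *[OF t(1,3)] *[OF t(2,4)] by linarith
    qed
    then show "\<exists>t\<^sub>0. \<forall>t\<in>T'. \<forall>t'\<in>T'. t \<ge> t\<^sub>0 \<longrightarrow> t' \<ge> t\<^sub>0 \<longrightarrow> FR_dist (rescaled G W t) (rescaled G W t') < \<epsilon>"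
      by blast
  qed
  moreover have "W \<in> T' \<rightarrow>\<^sub>E carrier (FZ G)" using W_mem by (auto simp: W_def)
  ultimately have "W \<in> carrier (dir_group G nm T')" unfolding carrier_dir_group by blast
  moreover have "restrict W T = w"
  proof (rule ext)
    fix t show "restrict W T t = w t"
      using T(3) w by (cases "t \<in> T") (auto simp: W_def carrier_dir_group)
  qed
  ultimately show ?thesis by blast
qed

end

section \<open>Non-principal ultrafilters on the natural numbers\<close>

text \<open>An ultrafilter that contains a finite set contains one of its points, and then is principal.\<close>

lemma nonprincipal_ultrafilter_le_sequentially:
  assumes "nonprincipal_ultrafilter \<omega>"
  shows "\<omega> \<le> sequentially"
proof -
  have proper: "\<omega> \<noteq> bot" and ultra: "\<And>P. eventually P \<omega> \<or> eventually (\<lambda>n. \<not> P n) \<omega>"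
    and nonprincipal: "\<And>n. \<omega> \<noteq> principal {n}"
    using assms by (auto simp: nonprincipal_ultrafilter_def)
  have neq: "\<forall>\<^sub>F m in \<omega>. m \<noteq> n" for n
  proof (rule ccontr)
    assume "\<not> (\<forall>\<^sub>F m in \<omega>. m \<noteq> n)"
    then have eq: "\<forall>\<^sub>F m in \<omega>. m = n" using ultra[of "\<lambda>m. m \<noteq> n"] by simp
    have "eventually P \<omega> \<longleftrightarrow> P n" for P
    proof
      assume "eventually P \<omega>"
      with eq have "\<forall>\<^sub>F m in \<omega>. P n" by eventually_elim simp
      then show "P n" using proper by simp
    next
      assume "P n"
      with eq show "eventually P \<omega>" by (auto elim: eventually_mono)
    qed
    then have "\<omega> = principal {n}" by (simp add: filter_eq_iff eventually_principal)
    with nonprincipal show False by blast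
  qed
  show ?thesis
  proof (rule filter_leI)
    fix P assume "eventually P sequentially"
    then obtain N where N: "\<And>n. N \<le> n \<Longrightarrow> P n" by (auto simp: eventually_sequentially)
    have "\<forall>\<^sub>F m in \<omega>. \<forall>n\<in>{..<N}. m \<noteq> n"
      by (rule eventually_ball_finite) (use neq in auto)
    then show "eventually P \<omega>"
      by (rule eventually_mono) (use N in \<open>auto simp: not_less[symmetric]\<close>)
  qed
qed

text \<open>Zorn's lemma for the proper filters finer than the cofinite filter, ordered by refinement. The
  infimum of a chain is proper because finite infima in it are members of the chain.\<close>

lemma ex_nonprincipal_ultrafilter: "\<exists>\<omega>. nonprincipal_ultrafilter \<omega>"
proof -
  define A where "A = {F :: nat filter. F \<noteq> bot \<and> F \<le> sequentially}"
  have po: "partial_order_on A (relation_of (\<lambda>F F'. F' \<le> F) A)"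
    by (rule partial_order_on_relation_ofI) auto
  have "\<exists>m\<in>A. \<forall>a\<in>A. a \<le> m \<longrightarrow> a = m"
  proof (rule predicate_Zorn[OF po])
    fix C assume "C \<in> Chains (relation_of (\<lambda>F F'. F' \<le> F) A)"
    then have C: "\<And>F. F \<in> C \<Longrightarrow> F \<in> A" "\<And>F F'. F \<in> C \<Longrightarrow> F' \<in> C \<Longrightarrow> F \<le> F' \<or> F' \<le> F"
      unfolding Chains_def relation_of_def by blast+
    show "\<exists>u\<in>A. \<forall>a\<in>C. u \<le> a"
    proof (cases "C = {}")
      case True
      have "sequentially \<in> A" by (simp add: A_def)
      with True show ?thesis by blast
    next
      case False
      have Inf_mem: "Inf X \<in> C" if "finite X" "X \<noteq> {}" "X \<subseteq> C" for X
        using that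
      proof (induction X rule: finite_ne_induct)
        case (insert F X)
        then have "F \<in> C" "Inf X \<in> C" by auto
        then have "inf F (Inf X) = F \<or> inf F (Inf X) = Inf X"
          using C(2)[of F "Inf X"] by (auto simp: inf_absorb1 inf_absorb2)
        then show ?case using \<open>F \<in> C\<close> \<open>Inf X \<in> C\<close> by auto
      qed auto
      have "Inf C \<noteq> bot"
      proof (rule Inf_filter_not_bot)
        fix X assume "X \<subseteq> C" "finite X"
        moreover have "(top_class.top :: nat filter) \<noteq> bot" by (simp add: trivial_limit_def)
        ultimately show "Inf X \<noteq> bot"
          using Inf_mem[of X] C(1) by (cases "X = {}") (auto simp: A_def)
      qed
      moreover have "Inf C \<le> sequentially"
        using False C(1) by (auto simp: A_def intro: Inf_lower2)
      ultimately have "Inf C \<in> A" by (simp add: A_def)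
      then show ?thesis by (auto intro: Inf_lower)
    qed
  qed
  then obtain \<omega> where \<omega>: "\<omega> \<in> A" "\<And>F. F \<in> A \<Longrightarrow> F \<le> \<omega> \<Longrightarrow> F = \<omega>" by blast
  have "eventually P \<omega> \<or> eventually (\<lambda>n. \<not> P n) \<omega>" for P
  proof (cases "eventually P \<omega>")
    case False
    let ?F = "inf \<omega> (principal {n. \<not> P n})"
    have "?F \<noteq> bot"
      using False by (simp add: trivial_limit_def eventually_inf_principal)
    moreover have "?F \<le> sequentially" using \<omega>(1) by (simp add: A_def le_infI1)
    ultimately have "?F = \<omega>" by (intro \<omega>(2)) (simp_all add: A_def)
    moreover have "eventually (\<lambda>n. \<not> P n) ?F" by (simp add: eventually_inf_principal)
    ultimately show ?thesis by simp
  qed simp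
  moreover have "\<omega> \<noteq> principal {n}" for n
  proof
    assume "\<omega> = principal {n}"
    moreover have "\<forall>\<^sub>F m in sequentially. n < m" by (rule eventually_gt_at_top)
    then have "\<forall>\<^sub>F m in \<omega>. n < m"
      using filter_leD[of \<omega> sequentially "\<lambda>m. n < m"] \<omega>(1) by (simp add: A_def)
    ultimately show False by (simp add: eventually_principal)
  qed
  ultimately have "nonprincipal_ultrafilter \<omega>"
    using \<omega>(1) by (simp add: nonprincipal_ultrafilter_def A_def)
  then show ?thesis by blast
qed

text \<open>The limit is the supremum of the eventual lower bounds of \<open>f\<close>: a larger number is not an
  eventual lower bound, so along an ultrafilter it is an eventual upper bound.\<close>

lemma ultrafilter_bounded_convergent:
  fixes f :: "nat \<Rightarrow> real"
  assumes "nonprincipal_ultrafilter \<omega>" "\<forall>\<^sub>F n in \<omega>. f n \<in> {a..b}"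
  shows "\<exists>L. (f \<longlongrightarrow> L) \<omega>"
proof -
  have proper: "\<omega> \<noteq> bot" and ultra: "\<And>P. eventually P \<omega> \<or> eventually (\<lambda>n. \<not> P n) \<omega>"
    using assms by (auto simp: nonprincipal_ultrafilter_def)
  define S where "S = {c. \<forall>\<^sub>F n in \<omega>. c \<le> f n}"
  have "a \<in> S" unfolding S_def using assms(2) by (auto elim: eventually_mono)
  have "c \<le> b" if "c \<in> S" for c
  proof -
    have "\<forall>\<^sub>F n in \<omega>. c \<le> b"
      using that[unfolded S_def mem_Collect_eq] assms(2) by eventually_elim auto
    then show ?thesis using proper by simp
  qed
  then have bdd: "bdd_above S" by (rule bdd_aboveI)
  have "(f \<longlongrightarrow> Sup S) \<omega>"
  proof (rule order_tendstoI)
    fix y assume "y < Sup S"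
    then obtain c where "c \<in> S" "y < c" using less_cSup_iff[OF _ bdd] \<open>a \<in> S\<close> by blast
    then show "\<forall>\<^sub>F n in \<omega>. y < f n" unfolding S_def by (auto elim: eventually_mono)
  next
    fix y assume "Sup S < y"
    then have "y \<notin> S" using cSup_upper[OF _ bdd, of y] by auto
    then have "\<not> (\<forall>\<^sub>F n in \<omega>. y \<le> f n)" by (simp add: S_def)
    then have "\<forall>\<^sub>F n in \<omega>. \<not> y \<le> f n" using ultra by blast
    then show "\<forall>\<^sub>F n in \<omega>. f n < y" by (simp add: not_le)
  qed
  then show ?thesis by blast
qed

section \<open>Homomorphisms induced on quotients by the null elements\<close>

text \<open>Both \<open>\<rho>\<close> and the restriction between directional cones are induced by such a homomorphism
  on the level of functions. The kernel criterion below reduces injectivity to elements of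
  pseudonorm \<open>0\<close>.\<close>

locale pseudonorm_decreasing_hom =
  C: conj_invariant_pseudonormed_group C \<mu> + B: conj_invariant_pseudonormed_group B \<nu>
  for C (structure) and \<mu> and B (structure) and \<nu> +
  fixes \<Phi>
  assumes hom: "\<Phi> \<in> hom C B" and decreasing: "g \<in> carrier C \<Longrightarrow> \<nu> (\<Phi> g) \<le> \<mu> g"
begin

sublocale \<Phi>: group_hom C B \<Phi>
  using hom by unfold_locales

lemma dist_hom:
  "g \<in> carrier C \<Longrightarrow> h \<in> carrier C \<Longrightarrow>
    B.dist (\<Phi> g) (\<Phi> h) = \<nu> (\<Phi> (inv\<^bsub>C\<^esub> g \<otimes>\<^bsub>C\<^esub> h))"
  by (simp add: norm_dist_def)

lemma dist_decreasing:
  "g \<in> carrier C \<Longrightarrow> h \<in> carrier C \<Longrightarrow> B.dist (\<Phi> g) (\<Phi> h) \<le> C.dist g h"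
  unfolding dist_hom using decreasing[of "inv\<^bsub>C\<^esub> g \<otimes>\<^bsub>C\<^esub> h"] by (simp add: norm_dist_def)

lemma induced_well_defined:
  assumes "g \<in> carrier C" "\<And>h. h \<in> carrier C \<Longrightarrow> f h = B.null #>\<^bsub>B\<^esub> \<Phi> h"
  shows "the_elem (f ` (C.null #>\<^bsub>C\<^esub> g)) = B.null #>\<^bsub>B\<^esub> \<Phi> g"
proof -
  have "the_elem (f ` (C.null #>\<^bsub>C\<^esub> g)) = f g"
  proof (rule C.the_elem_null_coset[OF assms(1)])
    fix h assume h: "h \<in> carrier C" "C.dist g h = 0"
    then have "B.dist (\<Phi> g) (\<Phi> h) = 0"
      using dist_decreasing[OF assms(1) h(1)] B.dist_nonneg[of "\<Phi> g" "\<Phi> h"] assms(1) by simp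
    then show "f h = f g"
      using B.null_coset_eq_iff[of "\<Phi> g" "\<Phi> h"] assms h(1) by simp
  qed
  then show ?thesis using assms by simp
qed

lemma induced_hom:
  assumes "\<And>g. g \<in> carrier C \<Longrightarrow> F (C.null #>\<^bsub>C\<^esub> g) = B.null #>\<^bsub>B\<^esub> \<Phi> g"
  shows "F \<in> hom (C Mod C.null) (B Mod B.null)"
proof (rule homI)
  fix X assume "X \<in> carrier (C Mod C.null)"
  then obtain g where g: "g \<in> carrier C" "X = C.null #>\<^bsub>C\<^esub> g" unfolding C.carrier_Mod_null by blast
  show "F X \<in> carrier (B Mod B.null)"
    unfolding B.carrier_Mod_null g(2) assms[OF g(1)] using g(1) by simp
  fix Y assume "Y \<in> carrier (C Mod C.null)"
  then obtain h where h: "h \<in> carrier C" "Y = C.null #>\<^bsub>C\<^esub> h" unfolding C.carrier_Mod_null by blast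
  show "F (X \<otimes>\<^bsub>C Mod C.null\<^esub> Y) = F X \<otimes>\<^bsub>B Mod B.null\<^esub> F Y"
    using g h by (simp add: C.mult_null_cosets B.mult_null_cosets assms)
qed

lemma induced_inj_iff:
  assumes "\<And>g. g \<in> carrier C \<Longrightarrow> F (C.null #>\<^bsub>C\<^esub> g) = B.null #>\<^bsub>B\<^esub> \<Phi> g"
  shows "inj_on F (carrier (C Mod C.null)) \<longleftrightarrow> (\<forall>k\<in>carrier C. \<nu> (\<Phi> k) = 0 \<longrightarrow> \<mu> k = 0)"
proof
  assume inj: "inj_on F (carrier (C Mod C.null))"
  show "\<forall>k\<in>carrier C. \<nu> (\<Phi> k) = 0 \<longrightarrow> \<mu> k = 0"
  proof (intro ballI impI)
    fix k assume k: "k \<in> carrier C" "\<nu> (\<Phi> k) = 0"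
    have "B.dist (\<Phi> \<one>\<^bsub>C\<^esub>) (\<Phi> k) = 0"
      using k by (simp add: norm_dist_def)
    then have "F (C.null #>\<^bsub>C\<^esub> \<one>\<^bsub>C\<^esub>) = F (C.null #>\<^bsub>C\<^esub> k)"
      using B.null_coset_eq_iff[of "\<Phi> \<one>\<^bsub>C\<^esub>" "\<Phi> k"] k(1) by (simp only: assms C.one_closed \<Phi>.hom_closed)
    then have "C.null #>\<^bsub>C\<^esub> \<one>\<^bsub>C\<^esub> = C.null #>\<^bsub>C\<^esub> k"
      using inj_onD[OF inj] k(1) unfolding C.carrier_Mod_null by blast
    then show "\<mu> k = 0"
      using C.null_coset_eq_iff[of "\<one>\<^bsub>C\<^esub>" k] k(1) by (simp add: norm_dist_def)
  qed
next
  assume *: "\<forall>k\<in>carrier C. \<nu> (\<Phi> k) = 0 \<longrightarrow> \<mu> k = 0"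
  show "inj_on F (carrier (C Mod C.null))"
  proof (rule inj_onI)
    fix X Y assume "X \<in> carrier (C Mod C.null)" "Y \<in> carrier (C Mod C.null)" and FXY: "F X = F Y"
    then obtain g h where g: "g \<in> carrier C" "X = C.null #>\<^bsub>C\<^esub> g" and h: "h \<in> carrier C" "Y = C.null #>\<^bsub>C\<^esub> h"
      unfolding C.carrier_Mod_null by blast
    have "B.dist (\<Phi> g) (\<Phi> h) = 0"
      using FXY B.null_coset_eq_iff[of "\<Phi> g" "\<Phi> h"] g h by (simp only: assms \<Phi>.hom_closed)
    then have "\<nu> (\<Phi> (inv\<^bsub>C\<^esub> g \<otimes>\<^bsub>C\<^esub> h)) = 0" unfolding dist_hom[OF g(1) h(1)] .
    moreover have "inv\<^bsub>C\<^esub> g \<otimes>\<^bsub>C\<^esub> h \<in> carrier C" using g h by simp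
    ultimately have "C.dist g h = 0" using * unfolding norm_dist_def by blast
    then show "X = Y" using C.null_coset_eq_iff[OF g(1) h(1)] g h by simp
  qed
qed

end

lemma (in conj_invariant_pseudonormed_group) dist_null_cosets:
  assumes "g \<in> carrier G" "h \<in> carrier G"
  shows "norm_dist (G Mod null) (\<lambda>X. the_elem (nm ` X)) (null #> g) (null #> h) = dist g h"
proof -
  have "inv\<^bsub>G Mod null\<^esub> (null #> g) \<otimes>\<^bsub>G Mod null\<^esub> (null #> h) = null #> (inv g \<otimes> h)"
    using assms by (simp add: inv_Mod_null mult_null_cosets)
  then show ?thesis unfolding norm_dist_def using norm_null_coset[of "inv g \<otimes> h"] assms by simp
qed

context conj_invariant_normed_group
begin

section \<open>The ultrafilter cone\<close>

lemma scaling_sequence_pos: "scaling_sequence s \<Longrightarrow> 0 < s n"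
  by (simp add: scaling_sequence_def)

lemma mem_bounded_sequences_iff:
  "g \<in> carrier (bounded_sequences G nm s)
    \<longleftrightarrow> (\<forall>n. g n \<in> carrier G) \<and> (\<exists>b. \<forall>\<^sub>F n in sequentially. nm (g n) / s n \<le> b)"
proof -
  have "limsup (\<lambda>n. ereal (nm (g n) / s n)) < \<infinity> \<longleftrightarrow> (\<exists>b. \<forall>\<^sub>F n in sequentially. nm (g n) / s n \<le> b)"
  proof
    assume "limsup (\<lambda>n. ereal (nm (g n) / s n)) < \<infinity>"
    then obtain k :: nat where "limsup (\<lambda>n. ereal (nm (g n) / s n)) < ereal (real k)"
      using less_PInf_Ex_of_nat by auto
    then have "\<forall>\<^sub>F n in sequentially. ereal (nm (g n) / s n) < ereal (real k)"
      by (rule Limsup_lessD)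
    then have "\<forall>\<^sub>F n in sequentially. nm (g n) / s n \<le> real k"
      by (rule eventually_mono) simp
    then show "\<exists>b. \<forall>\<^sub>F n in sequentially. nm (g n) / s n \<le> b" by blast
  next
    assume "\<exists>b. \<forall>\<^sub>F n in sequentially. nm (g n) / s n \<le> b"
    then obtain b where "\<forall>\<^sub>F n in sequentially. nm (g n) / s n \<le> b" by blast
    then have "limsup (\<lambda>n. ereal (nm (g n) / s n)) \<le> ereal b"
      by (intro Limsup_bounded) (auto elim: eventually_mono)
    then show "limsup (\<lambda>n. ereal (nm (g n) / s n)) < \<infinity>"
      by (rule le_less_trans) simp
  qed
  then show ?thesis by (simp add: bounded_sequences_def)
qed

lemma subgroup_bounded_sequences:
  assumes s: "scaling_sequence s"
  shows "subgroup (carrier (bounded_sequences G nm s)) (product_group UNIV (\<lambda>_. G))"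
proof -
  let ?P = "product_group (UNIV :: nat set) (\<lambda>_. G)"
  interpret P: group ?P by (simp add: is_group)
  show ?thesis
  proof (rule P.subgroupI)
    show "carrier (bounded_sequences G nm s) \<subseteq> carrier ?P"
      unfolding subset_iff mem_bounded_sequences_iff by auto
    have "(\<lambda>_. \<one>) \<in> carrier (bounded_sequences G nm s)"
      unfolding mem_bounded_sequences_iff by (auto simp: one intro!: exI[of _ 0])
    then show "carrier (bounded_sequences G nm s) \<noteq> {}" by blast
  next
    fix g assume g: "g \<in> carrier (bounded_sequences G nm s)"
    then have "inv\<^bsub>?P\<^esub> g = (\<lambda>n. inv g n)"
      unfolding mem_bounded_sequences_iff
      by (subst inv_product_group) (auto simp: is_group restrict_def)
    then show "inv\<^bsub>?P\<^esub> g \<in> carrier (bounded_sequences G nm s)"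
      using g unfolding mem_bounded_sequences_iff by (simp add: inverse)
  next
    fix g h assume "g \<in> carrier (bounded_sequences G nm s)" "h \<in> carrier (bounded_sequences G nm s)"
    then obtain a b where g: "\<And>n. g n \<in> carrier G" "\<forall>\<^sub>F n in sequentially. nm (g n) / s n \<le> a"
      and h: "\<And>n. h n \<in> carrier G" "\<forall>\<^sub>F n in sequentially. nm (h n) / s n \<le> b"
      unfolding mem_bounded_sequences_iff by blast
    from g(2) h(2) have "\<forall>\<^sub>F n in sequentially. nm (g n \<otimes> h n) / s n \<le> a + b"
    proof eventually_elim
      case (elim n)
      have "nm (g n \<otimes> h n) / s n \<le> (nm (g n) + nm (h n)) / s n"
        using mult[OF g(1) h(1)] scaling_sequence_pos[OF s, of n] by (intro divide_right_mono) auto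
      then show ?case using elim by (simp add: add_divide_distrib)
    qed
    then show "g \<otimes>\<^bsub>?P\<^esub> h \<in> carrier (bounded_sequences G nm s)"
      unfolding mem_bounded_sequences_iff using g(1) h(1) by auto
  qed
qed

abbreviation ultra_norm :: "nat filter \<Rightarrow> (nat \<Rightarrow> real) \<Rightarrow> (nat \<Rightarrow> 'a) \<Rightarrow> real"
  where "ultra_norm \<omega> s g \<equiv> Lim \<omega> (\<lambda>n. nm (g n) / s n)"

lemma tendsto_ultra_norm:
  assumes \<omega>: "nonprincipal_ultrafilter \<omega>" and s: "scaling_sequence s"
    and g: "g \<in> carrier (bounded_sequences G nm s)"
  shows "((\<lambda>n. nm (g n) / s n) \<longlongrightarrow> ultra_norm \<omega> s g) \<omega>"
proof -
  obtain b where b: "\<And>n. g n \<in> carrier G" "\<forall>\<^sub>F n in sequentially. nm (g n) / s n \<le> b"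
    using g unfolding mem_bounded_sequences_iff by blast
  have "\<forall>\<^sub>F n in \<omega>. nm (g n) / s n \<le> b"
    using filter_leD[OF nonprincipal_ultrafilter_le_sequentially[OF \<omega>] b(2)] .
  then have "\<forall>\<^sub>F n in \<omega>. nm (g n) / s n \<in> {0..b}"
    by (rule eventually_mono) (simp add: norm_nonneg b(1) scaling_sequence_pos[OF s] less_imp_le)
  from ultrafilter_bounded_convergent[OF \<omega> this] obtain L where L: "((\<lambda>n. nm (g n) / s n) \<longlongrightarrow> L) \<omega>" by blast
  moreover have "\<omega> \<noteq> bot" using \<omega> by (simp add: nonprincipal_ultrafilter_def)
  ultimately show ?thesis using tendsto_Lim by metis
qed

lemma bounded_sequences_pseudonormed:
  assumes \<omega>: "nonprincipal_ultrafilter \<omega>" and s: "scaling_sequence s"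
  shows "conj_invariant_pseudonormed_group (bounded_sequences G nm s) (ultra_norm \<omega> s)"
proof -
  have eq: "bounded_sequences G nm s
      = (product_group UNIV (\<lambda>_. G))\<lparr>carrier := carrier (bounded_sequences G nm s)\<rparr>"
    by (simp add: bounded_sequences_def)
  show ?thesis
    by (subst eq, rule limit_pseudonorm[OF subgroup_bounded_sequences[OF s], where F = \<omega> and s = s])
      (use \<omega> in \<open>simp_all add: nonprincipal_ultrafilter_def scaling_sequence_pos[OF s]
        tendsto_ultra_norm[OF \<omega> s]\<close>)
qed

lemma mult_bounded_sequences [simp]: "g \<otimes>\<^bsub>bounded_sequences G nm s\<^esub> h = (\<lambda>n. g n \<otimes> h n)"
  by (simp add: bounded_sequences_def restrict_def)

lemma inv_bounded_sequences:
  assumes "scaling_sequence s" "g \<in> carrier (bounded_sequences G nm s)"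
  shows "inv\<^bsub>bounded_sequences G nm s\<^esub> g = (\<lambda>n. inv g n)"
proof -
  let ?P = "product_group (UNIV :: nat set) (\<lambda>_. G)"
  have "group ?P" by (simp add: is_group)
  then have "inv\<^bsub>?P\<lparr>carrier := carrier (bounded_sequences G nm s)\<rparr>\<^esub> g = inv\<^bsub>?P\<^esub> g"
    using subgroup_bounded_sequences[OF assms(1)] assms(2) by (rule group.m_inv_consistent)
  moreover have "?P\<lparr>carrier := carrier (bounded_sequences G nm s)\<rparr> = bounded_sequences G nm s"
    by (simp add: bounded_sequences_def)
  moreover have "inv\<^bsub>?P\<^esub> g = (\<lambda>n. inv g n)"
    using assms(2) unfolding mem_bounded_sequences_iff by (subst inv_product_group) (auto simp: is_group restrict_def)
  ultimately show ?thesis by simp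
qed

lemma ultra_norm_eq_0_iff:
  assumes \<omega>: "nonprincipal_ultrafilter \<omega>" and s: "scaling_sequence s"
    and g: "g \<in> carrier (bounded_sequences G nm s)"
  shows "ultra_norm \<omega> s g = 0 \<longleftrightarrow> ((\<lambda>n. nm (g n) / s n) \<longlongrightarrow> 0) \<omega>"
proof -
  have "\<omega> \<noteq> bot" using \<omega> by (simp add: nonprincipal_ultrafilter_def)
  then show ?thesis using tendsto_ultra_norm[OF assms] tendsto_Lim by metis
qed

lemma ultra_class_eq_null_coset:
  assumes \<omega>: "nonprincipal_ultrafilter \<omega>" and s: "scaling_sequence s"
    and g: "g \<in> carrier (bounded_sequences G nm s)"
  shows "ultra_class G nm \<omega> s g
    = {h \<in> carrier (bounded_sequences G nm s). ultra_norm \<omega> s h = 0} #>\<^bsub>bounded_sequences G nm s\<^esub> g"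
proof -
  interpret B: conj_invariant_pseudonormed_group "bounded_sequences G nm s" "ultra_norm \<omega> s"
    by (rule bounded_sequences_pseudonormed[OF \<omega> s])
  have "h \<in> ultra_class G nm \<omega> s g \<longleftrightarrow> h \<in> B.null #>\<^bsub>bounded_sequences G nm s\<^esub> g" for h
  proof (cases "h \<in> carrier (bounded_sequences G nm s)")
    case True
    have "inv\<^bsub>bounded_sequences G nm s\<^esub> g \<otimes>\<^bsub>bounded_sequences G nm s\<^esub> h = (\<lambda>n. inv g n \<otimes> h n)"
      using inv_bounded_sequences[OF s g] by simp
    moreover have "inv\<^bsub>bounded_sequences G nm s\<^esub> g \<otimes>\<^bsub>bounded_sequences G nm s\<^esub> h
        \<in> carrier (bounded_sequences G nm s)"
      using g True by (intro B.m_closed B.inv_closed)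
    ultimately have "B.dist g h = 0 \<longleftrightarrow> ((\<lambda>n. nm (inv g n \<otimes> h n) / s n) \<longlongrightarrow> 0) \<omega>"
      using ultra_norm_eq_0_iff[OF \<omega> s, of "\<lambda>n. inv g n \<otimes> h n"] by (simp add: norm_dist_def)
    then show ?thesis
      using g True B.mem_null_coset_iff[OF g] by (simp add: ultra_class_def ultra_rel_def)
  next
    case False
    then show ?thesis using B.mem_null_coset_iff[OF g] by (simp add: ultra_class_def ultra_rel_def)
  qed
  then show ?thesis by blast
qed

lemma ultra_cone_eq_Mod:
  assumes \<omega>: "nonprincipal_ultrafilter \<omega>" and s: "scaling_sequence s"
  shows "ultra_cone G nm \<omega> s = bounded_sequences G nm s
    Mod {h \<in> carrier (bounded_sequences G nm s). ultra_norm \<omega> s h = 0}"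
proof -
  interpret B: conj_invariant_pseudonormed_group "bounded_sequences G nm s" "ultra_norm \<omega> s"
    by (rule bounded_sequences_pseudonormed[OF \<omega> s])
  have "carrier (bounded_sequences G nm s) // ultra_rel G nm \<omega> s
      = (\<lambda>g. ultra_class G nm \<omega> s g) ` carrier (bounded_sequences G nm s)"
    by (auto simp: quotient_def ultra_class_def)
  also have "\<dots> = (\<lambda>g. B.null #>\<^bsub>bounded_sequences G nm s\<^esub> g) ` carrier (bounded_sequences G nm s)"
    using ultra_class_eq_null_coset[OF \<omega> s] by (intro image_cong) simp_all
  also have "\<dots> = rcosets\<^bsub>bounded_sequences G nm s\<^esub> B.null"
    by (auto simp: RCOSETS_def)
  finally have "carrier (bounded_sequences G nm s) // ultra_rel G nm \<omega> s
      = rcosets\<^bsub>bounded_sequences G nm s\<^esub> B.null" .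
  moreover have "ultra_class G nm \<omega> s \<one>\<^bsub>bounded_sequences G nm s\<^esub> = B.null"
    using ultra_class_eq_null_coset[OF \<omega> s B.one_closed] B.coset_mult_one[of B.null] by auto
  ultimately show ?thesis by (simp add: ultra_cone_def FactGroup_def)
qed

section \<open>The homomorphism to the ultrafilter cone\<close>

lemma scaling_sequence_tendsto_along:
  "scaling_sequence s \<Longrightarrow> filterlim s (along {0<..}) sequentially"
  by (auto simp: scaling_sequence_def filterlim_inf filterlim_principal)

text \<open>The norm decreases because \<open>\<parallel>g(t)\<parallel> / t\<close> is eventually below every number larger than
  \<open>\<parallel>g\<parallel>\<close>, and \<open>\<omega>\<close> refines the filter of cofinite sets.\<close>

lemma sample_hom:
  assumes \<omega>: "nonprincipal_ultrafilter \<omega>" and s: "scaling_sequence s"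
  shows "pseudonorm_decreasing_hom (precone G nm {0<..}) (precone_norm G nm {0<..})
    (bounded_sequences G nm s) (ultra_norm \<omega> s) (\<lambda>g n. g (s n))"
proof -
  interpret C: conj_invariant_pseudonormed_group "precone G nm {0<..}" "precone_norm G nm {0<..}"
    by (rule precone_pseudonormed[OF scaling_set_UNIV])
  interpret B: conj_invariant_pseudonormed_group "bounded_sequences G nm s" "ultra_norm \<omega> s"
    by (rule bounded_sequences_pseudonormed[OF \<omega> s])
  have less: "\<forall>\<^sub>F n in sequentially. nm (g (s n)) / s n < c"
    if "g \<in> carrier (precone G nm {0<..})" "precone_norm G nm {0<..} g < c" for g c
    using filterlim_iff[THEN iffD1, OF scaling_sequence_tendsto_along[OF s]]
      eventually_norm_less_precone_norm[OF scaling_set_UNIV that] by blast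
  have closed: "(\<lambda>n. g (s n)) \<in> carrier (bounded_sequences G nm s)"
    if g: "g \<in> carrier (precone G nm {0<..})" for g
    unfolding mem_bounded_sequences_iff
  proof
    show "\<forall>n. g (s n) \<in> carrier G" using precone_mem[OF g] scaling_sequence_pos[OF s] by simp
    have "\<forall>\<^sub>F n in sequentially. nm (g (s n)) / s n \<le> precone_norm G nm {0<..} g + 1"
      using less[OF g, of "precone_norm G nm {0<..} g + 1"] by (auto elim: eventually_mono)
    then show "\<exists>b. \<forall>\<^sub>F n in sequentially. nm (g (s n)) / s n \<le> b" by blast
  qed
  show ?thesis
  proof
    show "(\<lambda>g n. g (s n)) \<in> hom (precone G nm {0<..}) (bounded_sequences G nm s)"
      by (rule homI) (simp_all add: closed scaling_sequence_pos[OF s])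
  next
    fix g assume g: "g \<in> carrier (precone G nm {0<..})"
    show "ultra_norm \<omega> s (\<lambda>n. g (s n)) \<le> precone_norm G nm {0<..} g"
    proof (rule dense_ge)
      fix c assume "precone_norm G nm {0<..} g < c"
      from less[OF g this] have "\<forall>\<^sub>F n in sequentially. nm (g (s n)) / s n \<le> c"
        by (auto elim: eventually_mono)
      then have "\<forall>\<^sub>F n in \<omega>. nm (g (s n)) / s n \<le> c"
        using filter_leD[OF nonprincipal_ultrafilter_le_sequentially[OF \<omega>]] by blast
      moreover have "\<omega> \<noteq> bot" using \<omega> by (simp add: nonprincipal_ultrafilter_def)
      ultimately show "ultra_norm \<omega> s (\<lambda>n. g (s n)) \<le> c"
        using tendsto_upperbound[OF tendsto_ultra_norm[OF \<omega> s closed[OF g]]] by blast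
    qed
  qed
qed

lemma dir_class_eq:
  "dir_class G nm T g = {g \<in> carrier (precone G nm T). precone_norm G nm T g = 0} #>\<^bsub>precone G nm T\<^esub> g"
  by (simp add: dir_class_def null_subgroup_def)

lemma dir_cone_eq:
  "dir_cone G nm T = precone G nm T Mod {g \<in> carrier (precone G nm T). precone_norm G nm T g = 0}"
  by (simp add: dir_cone_def null_subgroup_def)

lemma rho_dir_class:
  assumes \<omega>: "nonprincipal_ultrafilter \<omega>" and s: "scaling_sequence s"
    and g: "g \<in> carrier (precone G nm {0<..})"
  shows "(\<lambda>n. g (s n)) \<in> carrier (bounded_sequences G nm s)"
    and "rho G nm \<omega> s (dir_class G nm {0<..} g) = ultra_class G nm \<omega> s (\<lambda>n. g (s n))"
proof -
  interpret pseudonorm_decreasing_hom "precone G nm {0<..}" "precone_norm G nm {0<..}"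
    "bounded_sequences G nm s" "ultra_norm \<omega> s" "\<lambda>g n. g (s n)"
    by (rule sample_hom[OF \<omega> s])
  show closed: "(\<lambda>n. g (s n)) \<in> carrier (bounded_sequences G nm s)" using \<Phi>.hom_closed[OF g] .
  show "rho G nm \<omega> s (dir_class G nm {0<..} g) = ultra_class G nm \<omega> s (\<lambda>n. g (s n))"
    unfolding rho_def dir_class_eq ultra_class_eq_null_coset[OF \<omega> s closed]
    by (rule induced_well_defined[OF g])
      (rule ultra_class_eq_null_coset[OF \<omega> s \<Phi>.hom_closed])
qed

lemma rho_null_coset:
  assumes \<omega>: "nonprincipal_ultrafilter \<omega>" and s: "scaling_sequence s"
    and g: "g \<in> carrier (precone G nm {0<..})"
  shows "rho G nm \<omega> s ({g \<in> carrier (precone G nm {0<..}). precone_norm G nm {0<..} g = 0}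
      #>\<^bsub>precone G nm {0<..}\<^esub> g)
    = {h \<in> carrier (bounded_sequences G nm s). ultra_norm \<omega> s h = 0}
      #>\<^bsub>bounded_sequences G nm s\<^esub> (\<lambda>n. g (s n))"
  using rho_dir_class[OF assms] ultra_class_eq_null_coset[OF \<omega> s] unfolding dir_class_eq by simp

lemma rho_lipschitz_hom:
  assumes \<omega>: "nonprincipal_ultrafilter \<omega>" and s: "scaling_sequence s"
  shows "lipschitz_hom (dir_cone G nm {0<..}) (dir_cone_norm G nm {0<..})
    (ultra_cone G nm \<omega> s) (ultra_cone_norm nm \<omega> s) 1 (rho G nm \<omega> s)"
proof -
  interpret pseudonorm_decreasing_hom "precone G nm {0<..}" "precone_norm G nm {0<..}"
    "bounded_sequences G nm s" "ultra_norm \<omega> s" "\<lambda>g n. g (s n)"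
    by (rule sample_hom[OF \<omega> s])
  note rho = rho_null_coset[OF \<omega> s]
  have "ultra_cone_norm nm \<omega> s (rho G nm \<omega> s X) \<le> 1 * dir_cone_norm G nm {0<..} X"
    if X: "X \<in> carrier (dir_cone G nm {0<..})" for X
  proof -
    obtain g where g: "g \<in> carrier (precone G nm {0<..})" "X = C.null #>\<^bsub>precone G nm {0<..}\<^esub> g"
      using X unfolding dir_cone_eq C.carrier_Mod_null by blast
    show ?thesis
      unfolding g(2) rho[OF g(1)] ultra_cone_norm_def dir_cone_norm_def
      using B.norm_null_coset[OF \<Phi>.hom_closed[OF g(1)]] C.norm_null_coset[OF g(1)] decreasing[OF g(1)]
      by simp
  qed
  then show ?thesis
    unfolding lipschitz_hom_def using induced_hom[OF rho] by (simp add: dir_cone_eq ultra_cone_eq_Mod[OF \<omega> s])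
qed

lemma rho_inj_iff:
  assumes \<omega>: "nonprincipal_ultrafilter \<omega>" and s: "scaling_sequence s"
  shows "inj_on (rho G nm \<omega> s) (carrier (dir_cone G nm {0<..})) \<longleftrightarrow>
    (\<forall>k\<in>carrier (precone G nm {0<..}). ((\<lambda>n. nm (k (s n)) / s n) \<longlongrightarrow> 0) \<omega> \<longrightarrow> precone_norm G nm {0<..} k = 0)"
proof -
  interpret pseudonorm_decreasing_hom "precone G nm {0<..}" "precone_norm G nm {0<..}"
    "bounded_sequences G nm s" "ultra_norm \<omega> s" "\<lambda>g n. g (s n)"
    by (rule sample_hom[OF \<omega> s])
  note rho = rho_null_coset[OF \<omega> s]
  show ?thesis
    using induced_inj_iff[OF rho] ultra_norm_eq_0_iff[OF \<omega> s \<Phi>.hom_closed] by (simp add: dir_cone_eq)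
qed

section \<open>Restriction between directional cones\<close>

lemma restriction_decreasing_hom:
  assumes T: "scaling_set T" "scaling_set T'" "T \<subseteq> T'"
  shows "pseudonorm_decreasing_hom (precone G nm T') (precone_norm G nm T')
    (precone G nm T) (precone_norm G nm T) (\<lambda>g. restrict g T)"
proof -
  interpret C: conj_invariant_pseudonormed_group "precone G nm T'" "precone_norm G nm T'"
    by (rule precone_pseudonormed[OF T(2)])
  interpret B: conj_invariant_pseudonormed_group "precone G nm T" "precone_norm G nm T"
    by (rule precone_pseudonormed[OF T(1)])
  show ?thesis
  proof
    show "(\<lambda>g. restrict g T) \<in> hom (precone G nm T') (precone G nm T)"
    proof (rule homI)
      show "restrict (g \<otimes>\<^bsub>precone G nm T'\<^esub> h) T = restrict g T \<otimes>\<^bsub>precone G nm T\<^esub> restrict h T" for g h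
        using T(3) by (auto simp: fun_eq_iff)
    qed (rule restrict_precone[OF T])
  next
    fix g assume g: "g \<in> carrier (precone G nm T')"
    show "precone_norm G nm T (restrict g T) \<le> precone_norm G nm T' g"
    proof (rule precone_norm_greatest[OF g])
      fix w assume w: "w \<in> carrier (dir_group G nm T')" "proj_on G T' w = g"
      have "restrict g T = proj_on G T (restrict w T)" using w(2) restrict_proj_on[OF T(3)] by blast
      then show "precone_norm G nm T (restrict g T) \<le> dir_norm G nm T' w"
        using precone_norm_le[OF T(1) restrict_dir_group(1)[OF T w(1)]] restrict_dir_group(2)[OF T w(1)] by simp
    qed
  qed
qed

lemma restriction_null_coset:
  assumes T: "scaling_set T" "scaling_set T'" "T \<subseteq> T'" and g: "g \<in> carrier (precone G nm T')"
  shows "restriction G nm T ({g \<in> carrier (precone G nm T'). precone_norm G nm T' g = 0} #>\<^bsub>precone G nm T'\<^esub> g)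
    = {g \<in> carrier (precone G nm T). precone_norm G nm T g = 0} #>\<^bsub>precone G nm T\<^esub> restrict g T"
  unfolding restriction_def
  by (rule pseudonorm_decreasing_hom.induced_well_defined[OF restriction_decreasing_hom[OF T] g])
    (rule dir_class_eq)

lemma restriction_inj_iff:
  assumes T: "scaling_set T" "scaling_set T'" "T \<subseteq> T'"
  shows "inj_on (restriction G nm T) (carrier (dir_cone G nm T')) \<longleftrightarrow>
    (\<forall>k\<in>carrier (precone G nm T'). precone_norm G nm T (restrict k T) = 0 \<longrightarrow> precone_norm G nm T' k = 0)"
  unfolding dir_cone_eq
  by (rule pseudonorm_decreasing_hom.induced_inj_iff[OF restriction_decreasing_hom[OF T] restriction_null_coset[OF T]])

lemma extend_precone:
  assumes T: "scaling_set T" "scaling_set T'" "T \<subseteq> T'" and g: "g \<in> carrier (precone G nm T)"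
  shows "\<exists>k\<in>carrier (precone G nm T'). restrict k T = g"
proof -
  obtain w where w: "w \<in> carrier (dir_group G nm T)" "g = proj_on G T w"
    using g unfolding carrier_precone by blast
  obtain W where W: "W \<in> carrier (dir_group G nm T')" "restrict W T = w"
    using extend_dir_group[OF T w(1)] by blast
  then show ?thesis
    using w(2) restrict_proj_on[OF T(3), of W] unfolding carrier_precone by blast
qed

text \<open>Since all elements of \<open>\<D>(G,T)\<close> extend with the same norm, restriction is always a
  quotient map of normed groups, so it is an isometry as soon as it is injective.\<close>

lemma restriction_isometry_iff_inj:
  assumes T: "scaling_set T" "scaling_set T'" "T \<subseteq> T'"
  shows "isometry (dir_cone G nm T') (dir_cone_norm G nm T') (dir_cone G nm T) (dir_cone_norm G nm T)
      (restriction G nm T) \<longleftrightarrow> inj_on (restriction G nm T) (carrier (dir_cone G nm T'))"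
proof
  assume "inj_on (restriction G nm T) (carrier (dir_cone G nm T'))"
  note inj = this and inj' = this[unfolded restriction_inj_iff[OF T], rule_format]
  interpret pseudonorm_decreasing_hom "precone G nm T'" "precone_norm G nm T'"
    "precone G nm T" "precone_norm G nm T" "\<lambda>g. restrict g T"
    by (rule restriction_decreasing_hom[OF T])
  note coset = restriction_null_coset[OF T]
  have norm_eq: "precone_norm G nm T (restrict k T) = precone_norm G nm T' k"
    if k: "k \<in> carrier (precone G nm T')" for k
  proof (rule antisym[OF decreasing[OF k] precone_norm_greatest[OF \<Phi>.hom_closed[OF k]]])
    fix w assume w: "w \<in> carrier (dir_group G nm T)" "proj_on G T w = restrict k T"
    obtain W where W: "W \<in> carrier (dir_group G nm T')" "restrict W T = w"
      using extend_dir_group[OF T w(1)] by blast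
    let ?K = "proj_on G T' W"
    have K: "?K \<in> carrier (precone G nm T')" using W(1) unfolding carrier_precone by blast
    have "restrict ?K T = restrict k T" using restrict_proj_on[OF T(3), of W] W(2) w(2) by simp
    then have "B.dist (restrict k T) (restrict ?K T) = 0"
      using B.dist_self[OF \<Phi>.hom_closed[OF k]] by simp
    then have "precone_norm G nm T (restrict (inv\<^bsub>precone G nm T'\<^esub> k \<otimes>\<^bsub>precone G nm T'\<^esub> ?K) T) = 0"
      unfolding dist_hom[OF k K] .
    then have "C.dist k ?K = 0"
      unfolding norm_dist_def using k K by (intro inj' C.m_closed C.inv_closed)
    then have "precone_norm G nm T' k = precone_norm G nm T' ?K"
      using C.norm_diff_le_dist[OF k K] by simp
    also have "\<dots> \<le> dir_norm G nm T w"
      using precone_norm_le[OF T(2) W(1)] restrict_dir_group(2)[OF T W(1)] W(2) by simp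
    finally show "precone_norm G nm T' k \<le> dir_norm G nm T w" .
  qed
  have "restriction G nm T ` carrier (dir_cone G nm T') = carrier (dir_cone G nm T)"
  proof -
    have "restriction G nm T ` carrier (dir_cone G nm T')
        = (\<lambda>g. B.null #>\<^bsub>precone G nm T\<^esub> restrict g T) ` carrier (precone G nm T')"
      unfolding dir_cone_eq C.carrier_Mod_null image_image by (rule image_cong[OF HOL.refl coset])
    also have "\<dots> = (\<lambda>g. B.null #>\<^bsub>precone G nm T\<^esub> g) ` ((\<lambda>g. restrict g T) ` carrier (precone G nm T'))"
      by (simp add: image_image)
    also have "(\<lambda>g. restrict g T) ` carrier (precone G nm T') = carrier (precone G nm T)"
    proof
      show "(\<lambda>g. restrict g T) ` carrier (precone G nm T') \<subseteq> carrier (precone G nm T)"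
        using \<Phi>.hom_closed by blast
      show "carrier (precone G nm T) \<subseteq> (\<lambda>g. restrict g T) ` carrier (precone G nm T')"
        using extend_precone[OF T] by blast
    qed
    finally show ?thesis unfolding dir_cone_eq B.carrier_Mod_null .
  qed
  then have "bij_betw (restriction G nm T) (carrier (dir_cone G nm T')) (carrier (dir_cone G nm T))"
    using inj by (simp add: bij_betw_def)
  moreover have "norm_dist (dir_cone G nm T) (dir_cone_norm G nm T) (restriction G nm T X) (restriction G nm T Y)
      = norm_dist (dir_cone G nm T') (dir_cone_norm G nm T') X Y"
    if XY: "X \<in> carrier (dir_cone G nm T')" "Y \<in> carrier (dir_cone G nm T')" for X Y
  proof -
    obtain g where g: "g \<in> carrier (precone G nm T')" "X = C.null #>\<^bsub>precone G nm T'\<^esub> g"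
      using XY(1) unfolding dir_cone_eq C.carrier_Mod_null by blast
    obtain h where h: "h \<in> carrier (precone G nm T')" "Y = C.null #>\<^bsub>precone G nm T'\<^esub> h"
      using XY(2) unfolding dir_cone_eq C.carrier_Mod_null by blast
    have norms: "dir_cone_norm G nm S = (\<lambda>X. the_elem (precone_norm G nm S ` X))" for S
      by (simp add: dir_cone_norm_def fun_eq_iff)
    have "norm_dist (dir_cone G nm T) (dir_cone_norm G nm T) (restriction G nm T X) (restriction G nm T Y)
        = B.dist (restrict g T) (restrict h T)"
      unfolding g(2) h(2) coset[OF g(1)] coset[OF h(1)] dir_cone_eq norms
      using g(1) h(1) by (intro B.dist_null_cosets \<Phi>.hom_closed)
    also have "\<dots> = precone_norm G nm T (restrict (inv\<^bsub>precone G nm T'\<^esub> g \<otimes>\<^bsub>precone G nm T'\<^esub> h) T)"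
      by (rule dist_hom[OF g(1) h(1)])
    also have "\<dots> = C.dist g h"
      unfolding norm_dist_def
      using g(1) h(1) by (intro norm_eq C.m_closed C.inv_closed)
    also have "\<dots> = norm_dist (dir_cone G nm T') (dir_cone_norm G nm T') X Y"
      unfolding g(2) h(2) dir_cone_eq norms
      using g(1) h(1) by (intro C.dist_null_cosets[symmetric])
    finally show ?thesis .
  qed
  ultimately show "isometry (dir_cone G nm T') (dir_cone_norm G nm T') (dir_cone G nm T)
      (dir_cone_norm G nm T) (restriction G nm T)"
    unfolding isometry_def by blast
qed (simp add: isometry_def bij_betw_def)

section \<open>Injectivity and independence of scaling\<close>

text \<open>The scaling set consists of one point \<open>t\<^sub>j \<ge> j\<close> with \<open>|f(t\<^sub>j)| < 1/(j+1)\<close> for each \<open>j\<close>. Such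
  points exist among the \<open>s\<^sub>n\<close>, as members of \<open>\<omega>\<close> are not empty.\<close>

lemma sublinear_along_scaling_set:
  assumes \<omega>: "nonprincipal_ultrafilter \<omega>" and s: "scaling_sequence s"
    and f: "((\<lambda>n. f (s n)) \<longlongrightarrow> 0) \<omega>"
  shows "\<exists>T. scaling_set T \<and> ((f :: real \<Rightarrow> real) \<longlongrightarrow> 0) (along T)"
proof -
  have "\<exists>t>0. real j \<le> t \<and> \<bar>f t\<bar> < 1 / real (Suc j)" for j
  proof -
    have "\<forall>\<^sub>F n in sequentially. real j \<le> s n"
      using s by (simp add: scaling_sequence_def filterlim_at_top)
    then have 1: "\<forall>\<^sub>F n in \<omega>. real j \<le> s n"
      using filter_leD[OF nonprincipal_ultrafilter_le_sequentially[OF \<omega>]] by blast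
    have 2: "\<forall>\<^sub>F n in \<omega>. \<bar>f (s n)\<bar> < 1 / real (Suc j)"
      using tendstoD[OF f, of "1 / real (Suc j)"] by (simp add: dist_real_def)
    have "\<omega> \<noteq> bot" using \<omega> by (simp add: nonprincipal_ultrafilter_def)
    then obtain n where "real j \<le> s n" "\<bar>f (s n)\<bar> < 1 / real (Suc j)"
      using eventually_happens'[OF _ eventually_conj[OF 1 2]] by blast
    then show ?thesis using scaling_sequence_pos[OF s] by blast
  qed
  then obtain t where t: "\<And>j. 0 < t j" "\<And>j. real j \<le> t j" "\<And>j. \<bar>f (t j)\<bar> < 1 / real (Suc j)" by metis
  have "scaling_set (range t)"
    unfolding scaling_set_def
  proof
    show "range t \<subseteq> {0<..}" using t(1) by auto
    show "\<not> bdd_above (range t)"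
    proof
      assume "bdd_above (range t)"
      then obtain b where b: "\<And>j. t j \<le> b" by (auto simp: bdd_above_def)
      obtain j :: nat where "b < real j" using reals_Archimedean2 by blast
      then show False using b[of j] t(2)[of j] by simp
    qed
  qed
  moreover have "(f \<longlongrightarrow> 0) (along (range t))"
  proof (rule tendstoI)
    fix \<epsilon> :: real assume "0 < \<epsilon>"
    then obtain J where J: "1 / real (Suc J) < \<epsilon>" using nat_approx_posE by blast
    \<comment> \<open>beyond the finitely many points with small index only bounds below \<open>\<epsilon>\<close> occur\<close>
    have "\<forall>\<^sub>F x in at_top. \<forall>i\<in>{..J}. t i < x"
      by (rule eventually_ball_finite) (auto intro: eventually_gt_at_top)
    then have "\<forall>\<^sub>F x in at_top. x \<in> range t \<longrightarrow> \<bar>f x\<bar> < \<epsilon>"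
    proof eventually_elim
      case (elim x)
      show ?case
      proof
        assume "x \<in> range t"
        then obtain j where j: "x = t j" by blast
        with elim have "J < j" by (metis atMost_iff less_irrefl not_le)
        then have "1 / real (Suc j) \<le> 1 / real (Suc J)" by (simp add: frac_le)
        then show "\<bar>f x\<bar> < \<epsilon>" using t(3)[of j] j J by simp
      qed
    qed
    then show "\<forall>\<^sub>F x in along (range t). Real_Vector_Spaces.dist (f x) 0 < \<epsilon>"
      by (simp add: eventually_inf_principal dist_real_def)
  qed
  ultimately show ?thesis by blast
qed

lemma precone_norm_restrict_eq_0_iff:
  assumes "scaling_set T" "scaling_set T'" "T \<subseteq> T'" "g \<in> carrier (precone G nm T')"
  shows "precone_norm G nm T (restrict g T) = 0 \<longleftrightarrow> ((\<lambda>t. nm (g t) / t) \<longlongrightarrow> 0) (along T)"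
proof -
  have "\<forall>\<^sub>F t in along T. nm (restrict g T t) / t = nm (g t) / t"
    using eventually_along_mem by (rule eventually_mono) simp
  from tendsto_cong[OF this] show ?thesis
    unfolding precone_norm_eq_0_iff[OF assms(1) restrict_precone[OF assms]] .
qed

text \<open>If \<open>\<rho>\<close> kills the class of \<open>k\<close>, then \<open>k\<close> is sublinear along some scaling set \<open>T\<close>. So \<open>[k|\<^sub>T]\<close> is
  trivial, and independence of scaling makes \<open>[k]\<close> trivial.\<close>

lemma rho_inj_of_independent:
  assumes \<omega>: "nonprincipal_ultrafilter \<omega>" and s: "scaling_sequence s"
    and indep: "independent_of_scaling G nm"
  shows "inj_on (rho G nm \<omega> s) (carrier (dir_cone G nm {0<..}))"
  unfolding rho_inj_iff[OF \<omega> s]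
proof (intro ballI impI)
  fix k assume k: "k \<in> carrier (precone G nm {0<..})" and lim: "((\<lambda>n. nm (k (s n)) / s n) \<longlongrightarrow> 0) \<omega>"
  obtain T where T: "scaling_set T" "((\<lambda>t. nm (k t) / t) \<longlongrightarrow> 0) (along T)"
    using sublinear_along_scaling_set[OF \<omega> s lim] by blast
  have sub: "T \<subseteq> {0<..}" using T(1) by (simp add: scaling_set_def)
  have "inj_on (restriction G nm T) (carrier (dir_cone G nm {0<..}))"
    using indep T(1) scaling_set_UNIV sub
    unfolding independent_of_scaling_def isometry_def bij_betw_def by blast
  then show "precone_norm G nm {0<..} k = 0"
    using restriction_inj_iff[OF T(1) scaling_set_UNIV sub]
      precone_norm_restrict_eq_0_iff[OF T(1) scaling_set_UNIV sub k] T(2) k by blast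
qed

text \<open>If \<open>[k|\<^sub>T]\<close> is trivial, let \<open>K\<close> be an extension of \<open>k\<close> to all positive reals. It is sublinear
  along any scaling sequence in \<open>T\<close>, so \<open>\<rho>\<close> kills \<open>[K]\<close> for this sequence and any ultrafilter.
  Hence \<open>[K]\<close>, and with it its restriction \<open>[k]\<close>, is trivial.\<close>

lemma independent_of_rho_inj:
  assumes inj: "\<And>\<omega> s. nonprincipal_ultrafilter \<omega> \<Longrightarrow> scaling_sequence s \<Longrightarrow>
      inj_on (rho G nm \<omega> s) (carrier (dir_cone G nm {0<..}))"
  shows "independent_of_scaling G nm"
  unfolding independent_of_scaling_def
proof (intro allI impI)
  fix T T' assume T: "scaling_set T" "scaling_set T'" "T \<subseteq> T'"
  have sub: "T \<subseteq> {0<..}" "T' \<subseteq> {0<..}" using T by (auto simp: scaling_set_def)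
  show "isometry (dir_cone G nm T') (dir_cone_norm G nm T') (dir_cone G nm T) (dir_cone_norm G nm T)
      (restriction G nm T)"
    unfolding restriction_isometry_iff_inj[OF T] restriction_inj_iff[OF T]
  proof (intro ballI impI)
    fix k assume k: "k \<in> carrier (precone G nm T')" "precone_norm G nm T (restrict k T) = 0"
    obtain K where K: "K \<in> carrier (precone G nm {0<..})" "restrict K T' = k"
      using extend_precone[OF T(2) scaling_set_UNIV sub(2) k(1)] by blast
    have "k t = K t" if "t \<in> T" for t
      using fun_cong[OF K(2), of t] that T(3) by (simp add: subset_iff)
    then have "restrict k T = restrict K T" by (auto simp: fun_eq_iff)
    then have lim: "((\<lambda>t. nm (K t) / t) \<longlongrightarrow> 0) (along T)"
      using k(2) precone_norm_restrict_eq_0_iff[OF T(1) scaling_set_UNIV sub(1) K(1)] by simp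
    have "\<forall>n::nat. \<exists>t. t \<in> T \<and> real n \<le> t" using scaling_set_unbounded[OF T(1)] by blast
    then obtain s where s: "\<And>n. s n \<in> T" "\<And>n. real n \<le> s n" by metis
    have s_top: "filterlim s at_top sequentially"
      by (rule filterlim_at_top_mono[OF filterlim_real_sequentially]) (simp add: s(2))
    then have seq: "scaling_sequence s"
      using s(1) scaling_set_pos[OF T(1)] by (simp add: scaling_sequence_def)
    have "filterlim s (along T) sequentially"
      using s_top s(1) by (simp add: filterlim_inf filterlim_principal)
    then have "(\<lambda>n. nm (K (s n)) / s n) \<longlonglongrightarrow> 0" by (rule filterlim_compose[OF lim])
    moreover obtain \<omega> where \<omega>: "nonprincipal_ultrafilter \<omega>" using ex_nonprincipal_ultrafilter by blast
    ultimately have "((\<lambda>n. nm (K (s n)) / s n) \<longlongrightarrow> 0) \<omega>"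
      using tendsto_mono[OF nonprincipal_ultrafilter_le_sequentially] by blast
    then have "precone_norm G nm {0<..} K = 0"
      using inj[OF \<omega> seq, unfolded rho_inj_iff[OF \<omega> seq]] K(1) by blast
    then have "((\<lambda>t. nm (K t) / t) \<longlongrightarrow> 0) (along {0<..})"
      using precone_norm_eq_0_iff[OF scaling_set_UNIV K(1)] by blast
    then have "((\<lambda>t. nm (K t) / t) \<longlongrightarrow> 0) (along T')"
      using along_mono[OF sub(2)] tendsto_mono by blast
    then show "precone_norm G nm T' k = 0"
      using precone_norm_restrict_eq_0_iff[OF T(2) scaling_set_UNIV sub(2) K(1)] K(2) by simp
  qed
qed

end

theorem theorem1p1:
  fixes G :: "('a, 'b) monoid_scheme" and nm :: "'a \<Rightarrow> real"
  assumes "conj_invariant_normed_group G nm"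
  shows "(\<forall>\<omega> s. nonprincipal_ultrafilter \<omega> \<longrightarrow> scaling_sequence s \<longrightarrow>
            (\<forall>g\<in>carrier (precone G nm {0<..}).
               (\<lambda>n. g (s n)) \<in> carrier (bounded_sequences G nm s) \<and>
               rho G nm \<omega> s (dir_class G nm {0<..} g) = ultra_class G nm \<omega> s (\<lambda>n. g (s n))) \<and>
            lipschitz_hom (dir_cone G nm {0<..}) (dir_cone_norm G nm {0<..})
              (ultra_cone G nm \<omega> s) (ultra_cone_norm nm \<omega> s) 1 (rho G nm \<omega> s))
       \<and> ((\<forall>\<omega> s. nonprincipal_ultrafilter \<omega> \<longrightarrow> scaling_sequence s \<longrightarrow>
              inj_on (rho G nm \<omega> s) (carrier (dir_cone G nm {0<..})))
          \<longleftrightarrow> independent_of_scaling G nm)"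
proof -
  interpret conj_invariant_normed_group G nm by (rule assms)
  show ?thesis
    using rho_dir_class rho_lipschitz_hom rho_inj_of_independent independent_of_rho_inj by blast
qed

end
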